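(* Let $d\ge1$. The homogeneous Galois foliations of degree $d$ on $\mathbb{P}^2$ are exactly those in the orbits under the left-right action of $\mathrm{PSL}_2(\mathbb{C})\times\mathrm{PSL}_2(\mathbb{C})$ of the following ones: (1) $x^{d}\partial_x+y^{d}\partial_y$, for every $d$; (2) $(x^{n}+y^{n})^{2}\partial_x+(x^{n}-y^{n})^{2}\partial_y$, if $d=2n$ is even; (3) $(x^{4}+2i\sqrt{3}\,x^{2}y^{2}+y^{4})^{3}\partial_x+(x^{4}-2i\sqrt{3}\,x^{2}y^{2}+y^{4})^{3}\partial_y$, if $d=12$; (4) $(x^{8}+14x^{4}y^{4}+y^{8})^{3}\partial_x+(xy(x^{4}-y^{4}))^{4}\partial_y$, if $d=24$; (5) $(x^{20}-228x^{15}y^{5}+494x^{10}y^{10}+228x^{5}y^{15}+y^{20})^{3}\partial_x+(xy(x^{10}+11x^{5}y^{5}-y^{10}))^{5}\partial_y$, if $d=60$.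
   Context: A homogeneous foliation of degree $d$ on $\mathbb{P}^2$ is a foliation given in an affine chart $(x,y)$ by a vector field $A(x,y)\partial_x+B(x,y)\partial_y$ with $A,B\in\mathbb{C}[x,y]$ coprime homogeneous polynomials of degree $d$; it is identified with the class $[A,B]\in\mathbb{P}(\mathbb{C}_d[x,y]^{\oplus2})$, where $\mathbb{C}_d[x,y]$ is the space of homogeneous polynomials of degree $d$. The left-right action of $\mathrm{PSL}_2(\mathbb{C})\times\mathrm{PSL}_2(\mathbb{C})$ on these classes is $$([\alpha_{ij}],[\beta_{ij}],[A_1,A_2])\mapsto[\beta_{11}A_1^{\alpha}+\beta_{12}A_2^{\alpha},\ \beta_{21}A_1^{\alpha}+\beta_{22}A_2^{\alpha}],\qquad A_i^{\alpha}(x,y)=A_i(\alpha_{11}x+\alpha_{12}y,\alpha_{21}x+\alpha_{22}y).$$ A foliation $\mathcal{F}$ of degree $d\ge1$ on $\mathbb{P}^2$ is Galois if its Gauss map $\mathcal{G}_{\mathcal{F}}:\mathbb{P}^2\dashrightarrow\check{\mathbb{P}}^2$ (sending a non-singular point $p$ to the line tangent to $\mathcal{F}$ at $p$), which is dominant of topological degree $d$, induces a Galois field extension $\mathbb{C}(\check{\mathbb{P}}^2)\hookrightarrow\mathbb{C}(\mathbb{P}^2)$.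
   Formalization: For d = 1 the orbit of (1) contains the radial class x∂_x + y∂_y, which defines a foliation of degree 0 with non-dominant Gauss map; the formal statement excludes exactly this class (yA = xB) from the orbits, a condition that is automatic for d ≥ 2. *)

theory Defs
  imports "HOL-Analysis.Analysis" "HOL-Computational_Algebra.Computational_Algebra"
begin

(* C[x,y] is encoded as C[x][y] and C[x,y,z] as C[x,y][z]: the innermost
   variable is x, and the inclusion of C[x,y] in C[x,y,z] is A \<mapsto> [:A:]. *)

type_synonym cpoly2 = "complex poly poly"
type_synonym cpoly3 = "complex poly poly poly"

definition const2 :: "complex \<Rightarrow> cpoly2" where
  "const2 c = [:[:c:]:]"

definition varx :: cpoly2 where
  "varx = [:[:0, 1:]:]"

definition vary :: cpoly2 where
  "vary = [:0, 1:]"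

definition const3 :: "complex \<Rightarrow> cpoly3" where
  "const3 c = [:const2 c:]"

definition varz :: cpoly3 where
  "varz = [:0, 1:]"

definition homogeneous2 :: "nat \<Rightarrow> cpoly2 \<Rightarrow> bool" where
  "homogeneous2 n P \<longleftrightarrow> (\<forall>i j. coeff (coeff P j) i \<noteq> 0 \<longrightarrow> i + j = n)"

definition homogeneous3 :: "nat \<Rightarrow> cpoly3 \<Rightarrow> bool" where
  "homogeneous3 n P \<longleftrightarrow> (\<forall>i j k. coeff (coeff (coeff P k) j) i \<noteq> 0 \<longrightarrow> i + j + k = n)"

(* P(u,v) for u, v in C[x,y]. *)
definition subst2 :: "cpoly2 \<Rightarrow> cpoly2 \<Rightarrow> cpoly2 \<Rightarrow> cpoly2" where
  "subst2 P u v = poly (map_poly (\<lambda>p. poly (map_poly const2 p) u) P) v"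

(* P(u,v,w) for u, v, w in C[x,y,z]. *)
definition subst3 :: "cpoly3 \<Rightarrow> cpoly3 \<Rightarrow> cpoly3 \<Rightarrow> cpoly3 \<Rightarrow> cpoly3" where
  "subst3 P u v w =
     poly (map_poly (\<lambda>p. poly (map_poly (\<lambda>q. poly (map_poly const3 q) u) p) v) P) w"


(* Automorphisms of L over K, for subfields K of L of an ambient field. Their values
   outside L are irrelevant. *)
definition field_automorphisms :: "'a::field set \<Rightarrow> 'a set \<Rightarrow> ('a \<Rightarrow> 'a) set" where
  "field_automorphisms K L =
     {\<sigma>. bij_betw \<sigma> L L \<and>
         (\<forall>a\<in>L. \<forall>b\<in>L. \<sigma> (a + b) = \<sigma> a + \<sigma> b \<and> \<sigma> (a * b) = \<sigma> a * \<sigma> b) \<and>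
         (\<forall>a\<in>K. \<sigma> a = a)}"

definition galois_extension :: "'a::field set \<Rightarrow> 'a set \<Rightarrow> bool" where
  "galois_extension K L \<longleftrightarrow>
     K \<subseteq> L \<and>
     (\<forall>a\<in>L. \<exists>p. p \<noteq> 0 \<and> (\<forall>i. coeff p i \<in> K) \<and> poly p a = 0) \<and>
     {a \<in> L. \<forall>\<sigma>\<in>field_automorphisms K L. \<sigma> a = a} = K"


(* The function field of the projective plane, in homogeneous coordinates. *)
definition function_field_P2 :: "cpoly3 fract set" where
  "function_field_P2 =
     {Fract P Q | P Q n. homogeneous3 n P \<and> homogeneous3 n Q \<and> Q \<noteq> 0}"

(* The image of the pullback by the rational map [a : b : c] into a projective plane.
   If the map is dominant, subst3 Q a b c = 0 only for Q = 0, so that this is the image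
   of the whole function field of the target. *)
fun pullback_field :: "cpoly3 \<times> cpoly3 \<times> cpoly3 \<Rightarrow> cpoly3 fract set" where
  "pullback_field (a, b, c) =
     {Fract (subst3 P a b c) (subst3 Q a b c) | P Q n.
        homogeneous3 n P \<and> homogeneous3 n Q \<and> subst3 Q a b c \<noteq> 0}"

(* A foliation of degree d is given by a 1-form a dx + b dy + c dz on C^3 with coefficients
   homogeneous of degree d + 1 and without common factor, annihilated by the Euler field. *)
fun P2_foliation :: "nat \<Rightarrow> cpoly3 \<times> cpoly3 \<times> cpoly3 \<Rightarrow> bool" where
  "P2_foliation d (a, b, c) \<longleftrightarrow>
     homogeneous3 (d + 1) a \<and> homogeneous3 (d + 1) b \<and> homogeneous3 (d + 1) c \<and>
     [:varx:] * a + [:vary:] * b + varz * c = 0 \<and>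
     (\<forall>p. p dvd a \<and> p dvd b \<and> p dvd c \<longrightarrow> is_unit p)"

(* The tangent line at p is the kernel of the 1-form at p, so in dual homogeneous
   coordinates the Gauss map is p \<mapsto> [a(p) : b(p) : c(p)]. *)
definition galois_foliation :: "cpoly3 \<times> cpoly3 \<times> cpoly3 \<Rightarrow> bool" where
  "galois_foliation \<omega> \<longleftrightarrow> galois_extension (pullback_field \<omega>) function_field_P2"

(* The homogenization of the 1-form B dx - A dy dual to the vector field A d/dx + B d/dy
   of the chart z = 1, for A and B homogeneous of the same degree. *)
fun projective_form :: "cpoly2 \<times> cpoly2 \<Rightarrow> cpoly3 \<times> cpoly3 \<times> cpoly3" where
  "projective_form (A, B) = (varz * [:B:], - (varz * [:A:]), [:vary * A - varx * B:])"

(* The last condition follows from the others unless y A = x B, which forces d = 1 and a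
   multiple of the radial field x d/dx + y d/dy; that field defines a foliation of
   degree 0 (the pencil of lines through a point), not 1. *)
fun homogeneous_foliation :: "nat \<Rightarrow> cpoly2 \<times> cpoly2 \<Rightarrow> bool" where
  "homogeneous_foliation d (A, B) \<longleftrightarrow>
     homogeneous2 d A \<and> homogeneous2 d B \<and> coprime A B \<and>
     P2_foliation d (projective_form (A, B))"


definition SL2 :: "(complex^2^2) set" where
  "SL2 = {M. det M = 1}"

definition linear_subst :: "complex^2^2 \<Rightarrow> cpoly2 \<Rightarrow> cpoly2" where
  "linear_subst \<alpha> P =
     subst2 P (const2 (\<alpha>$1$1) * varx + const2 (\<alpha>$1$2) * vary)
              (const2 (\<alpha>$2$1) * varx + const2 (\<alpha>$2$2) * vary)"

fun left_right_act ::
    "complex^2^2 \<Rightarrow> complex^2^2 \<Rightarrow> cpoly2 \<times> cpoly2 \<Rightarrow> cpoly2 \<times> cpoly2" where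
  "left_right_act \<alpha> \<beta> (A, B) =
     (const2 (\<beta>$1$1) * linear_subst \<alpha> A + const2 (\<beta>$1$2) * linear_subst \<alpha> B,
      const2 (\<beta>$2$1) * linear_subst \<alpha> A + const2 (\<beta>$2$2) * linear_subst \<alpha> B)"

(* Equality of classes in the projectivization of the space of pairs. *)
fun same_class :: "cpoly2 \<times> cpoly2 \<Rightarrow> cpoly2 \<times> cpoly2 \<Rightarrow> bool" where
  "same_class (A, B) (A', B') \<longleftrightarrow> (\<exists>c. c \<noteq> 0 \<and> A' = const2 c * A \<and> B' = const2 c * B)"

(* Elements of PSL_2 are represented by matrices in SL_2; the class of the resulting pair
   does not depend on the representatives. *)
definition left_right_orbit :: "cpoly2 \<times> cpoly2 \<Rightarrow> (cpoly2 \<times> cpoly2) set" where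
  "left_right_orbit F = {G. \<exists>\<alpha>\<in>SL2. \<exists>\<beta>\<in>SL2. same_class (left_right_act \<alpha> \<beta> F) G}"

end

theory Submission
  imports Defs "HOL-Computational_Algebra.Field_as_Ring"
begin

text \<open>
  The tangent line at a point of the chart z = 1 has the direction A : B, so the Gauss map determines the
  rational function r = A/B of degree d in the slope \<open>T = x/y\<close>. If T is known besides the
  tangent line, so is the point, which lies on the line through the origin with this slope. Hence
  \<open>\<complex>(x, y)\<close> is generated by T over the function field K of the target, T is a
  root of \<open>A(t, 1) - r B(t, 1)\<close>, and this polynomial has the minimal degree d
  (\<open>minpoly_minimal\<close>, \<open>L_generated\<close>). The extension is Galois if and only
  if it contains d conjugates of T. A conjugate is a quotient of coprime forms U/V for which A(U,V) and
  B(U,V) are proportional to A and B, and this makes U and V linear. So the foliation is Galois if and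
  only if there are d Moebius transformations g with \<open>r \<circ> g = r\<close>
  (\<open>galois_iff_many_deck\<close>). The left-right action of the statement is the change of
  coordinates in the source and the target of r.

  Suppose that there are d such deck transformations. They act transitively on the fibres of r, so that
  all points of a fibre have the same multiplicity e, and counting the zeros of the derivative gives the
  Riemann-Hurwitz relation (\<open>riemann_hurwitz\<close>). It admits only the multiplicities of the
  classical finite rotation groups: no ramification at all, for d = 1, two totally ramified fibres, or
  three ramified fibres of multiplicities (2,2,n), (2,3,3), (2,3,4) or (2,3,5), with d = 2n, 12, 24 or 60
  (\<open>signature\<close>). A ramified fibre is the e-th power of a squarefree polynomial, and three
  members of a pencil satisfy a linear relation. It remains to solve equations such as \<open>P\<^sup>3
  + Q\<^sup>5 = R\<^sup>2\<close> up to linear changes of the variable. Over the complex numbers those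
  for (2,2,n), (2,3,3) and (2,3,4) are solved by descent: coprime factors of a power are powers, and this
  exhibits linear polynomials u and v in which the equation is the standard one
  (\<open>dihedral_equation\<close>, \<open>tetrahedral_equation\<close>; the octahedral equation
  reduces to the tetrahedral one). For the icosahedron, differentiating the equation shows that P is a
  multiple of the Hessian of Q and that the fourth transvectant of Q with itself vanishes
  (\<open>icosahedral_equation\<close>). With one zero of Q moved to infinity, the vanishing of the
  transvectant is a recursion that determines Q up to an affine substitution
  (\<open>icosa_normal_form\<close>).

  Conversely, each model has d deck transformations, counted as the orbit of infinity times the rotations
  that fix it (\<open>many_deck_if_orbit_stabilizer\<close>). Only the icosahedral symmetries are not
  written down; they come from the uniqueness of the normal form, applied to each of the twelve vertices
  (\<open>icosa_vertex_symmetry\<close>).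
\<close>

section \<open>Simple field extensions and their automorphisms\<close>

definition is_subfield :: "'a::field set \<Rightarrow> bool" where
  "is_subfield K \<longleftrightarrow> 1 \<in> K \<and> (\<forall>a\<in>K. \<forall>b\<in>K. a - b \<in> K \<and> a * b \<in> K \<and> inverse a \<in> K)"

lemma subfield_closed:
  assumes "is_subfield K"
  shows "1 \<in> K" "0 \<in> K" "\<And>a b. a \<in> K \<Longrightarrow> b \<in> K \<Longrightarrow> a + b \<in> K"
    "\<And>a. a \<in> K \<Longrightarrow> - a \<in> K" "\<And>a b. a \<in> K \<Longrightarrow> b \<in> K \<Longrightarrow> a - b \<in> K"
    "\<And>a b. a \<in> K \<Longrightarrow> b \<in> K \<Longrightarrow> a * b \<in> K" "\<And>a. a \<in> K \<Longrightarrow> inverse a \<in> K"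
    "\<And>a b. a \<in> K \<Longrightarrow> b \<in> K \<Longrightarrow> a / b \<in> K" "\<And>a n. a \<in> K \<Longrightarrow> a ^ n \<in> K"
proof -
  note K = assms[unfolded is_subfield_def]
  show one: "1 \<in> K" using K by blast
  show zero: "0 \<in> K" using K by (metis diff_self)
  show neg: "- a \<in> K" if "a \<in> K" for a using K zero that by (metis diff_0)
  show "a + b \<in> K" if "a \<in> K" "b \<in> K" for a b
    using K neg that by (metis diff_minus_eq_add)
  show "a - b \<in> K" if "a \<in> K" "b \<in> K" for a b using K that by blast
  show mult: "a * b \<in> K" if "a \<in> K" "b \<in> K" for a b using K that by blast
  show inv: "inverse a \<in> K" if "a \<in> K" for a using K that by blast
  show "a / b \<in> K" if "a \<in> K" "b \<in> K" for a b
    using mult inv that by (simp add: divide_inverse)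
  show "a ^ n \<in> K" if "a \<in> K" for a n
    by (induction n) (auto simp: one mult that)
qed

definition polys_over :: "'a::field set \<Rightarrow> 'a poly set" where
  "polys_over K = {p. \<forall>i. coeff p i \<in> K}"

lemma polys_overD: "p \<in> polys_over K \<Longrightarrow> coeff p i \<in> K"
  by (simp add: polys_over_def)

lemma polys_over_mono: "K \<subseteq> L \<Longrightarrow> polys_over K \<subseteq> polys_over L"
  by (auto simp: polys_over_def)

lemma pCons_polys_over: "pCons a p \<in> polys_over K \<longleftrightarrow> a \<in> K \<and> p \<in> polys_over K"
proof
  assume *: "pCons a p \<in> polys_over K"
  have "coeff (pCons a p) 0 \<in> K" "coeff (pCons a p) (Suc i) \<in> K" for i
    using * by (auto simp: polys_over_def simp del: coeff_pCons_Suc coeff_pCons_0)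
  then show "a \<in> K \<and> p \<in> polys_over K" by (auto simp: polys_over_def)
qed (auto simp: polys_over_def coeff_pCons split: nat.splits)

lemma polys_over_closed:
  assumes "is_subfield K"
  shows "0 \<in> polys_over K" "1 \<in> polys_over K"
    "\<And>p q. p \<in> polys_over K \<Longrightarrow> q \<in> polys_over K \<Longrightarrow> p + q \<in> polys_over K"
    "\<And>p q. p \<in> polys_over K \<Longrightarrow> q \<in> polys_over K \<Longrightarrow> p - q \<in> polys_over K"
    "\<And>p. p \<in> polys_over K \<Longrightarrow> - p \<in> polys_over K"
    "\<And>p q. p \<in> polys_over K \<Longrightarrow> q \<in> polys_over K \<Longrightarrow> p * q \<in> polys_over K"
    "\<And>a p. a \<in> K \<Longrightarrow> p \<in> polys_over K \<Longrightarrow> smult a p \<in> polys_over K"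
proof -
  note K = subfield_closed[OF assms]
  have sum: "(\<Sum>i\<in>I. f i) \<in> K" if "\<And>i. i \<in> I \<Longrightarrow> f i \<in> K" for I :: "nat set" and f
    using that by (induction I rule: infinite_finite_induct) (auto simp: K)
  show "p * q \<in> polys_over K" if "p \<in> polys_over K" "q \<in> polys_over K" for p q
    using that by (auto simp: polys_over_def coeff_mult intro!: sum K)
qed (auto simp: polys_over_def subfield_closed[OF assms] coeff_pCons one_pCons split: nat.splits)

lemma div_mod_polys_over:
  assumes K: "is_subfield K" and g: "g \<in> polys_over K"
  shows "f \<in> polys_over K \<Longrightarrow> f div g \<in> polys_over K \<and> f mod g \<in> polys_over K"
proof (induction f)
  case 0
  then show ?case using polys_over_closed[OF K] by simp
next
  case (pCons a f)
  then have a: "a \<in> K" and IH: "f div g \<in> polys_over K" "f mod g \<in> polys_over K"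
    by (auto simp: pCons_polys_over)
  let ?c = "coeff (pCons a (f mod g)) (degree g) / lead_coeff g"
  have c: "?c \<in> K"
    using a IH g by (intro subfield_closed[OF K] polys_overD) (auto simp: pCons_polys_over)
  show ?case
    unfolding div_pCons_eq mod_pCons_eq using a IH g c polys_over_closed[OF K] pCons(3)
    by (auto simp: pCons_polys_over)
qed

lemma poly_in_subfield:
  assumes "is_subfield L" "p \<in> polys_over L" "x \<in> L"
  shows "poly p x \<in> L"
  using assms(2) by (induction p) (auto simp: pCons_polys_over subfield_closed[OF assms(1)] assms(3))

text \<open>The field generated by an algebraic element \<open>\<theta>\<close> consists of the values at \<open>\<theta>\<close> of polynomials:
  dividing the minimal polynomial by p leaves a remainder of smaller degree, whose value at \<open>\<theta>\<close> is a
  multiple of that of p.\<close>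

lemma inverse_in_simple_extension:
  assumes K: "is_subfield K"
    and m: "m \<in> polys_over K" "poly m \<theta> = 0" "m \<noteq> 0"
    and minimal: "\<And>p. p \<in> polys_over K \<Longrightarrow> degree p < degree m \<Longrightarrow> poly p \<theta> = 0 \<Longrightarrow> p = 0"
    and p: "p \<in> polys_over K" "poly p \<theta> \<noteq> 0"
  shows "\<exists>q\<in>polys_over K. poly q \<theta> = inverse (poly p \<theta>)"
proof -
  have "\<exists>q\<in>polys_over K. poly q \<theta> = inverse (poly p \<theta>)"
    if "p \<in> polys_over K" "poly p \<theta> \<noteq> 0" "degree p < degree m" for p
    using that
  proof (induction "degree p" arbitrary: p rule: less_induct)
    case less
    note dm = div_mod_polys_over[OF K less.prems(1) m(1)]
    have p0: "p \<noteq> 0" using less.prems by auto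
    have eq: "poly (m div p) \<theta> * poly p \<theta> + poly (m mod p) \<theta> = 0"
      by (metis div_mult_mod_eq m(2) poly_add poly_mult)
    show ?case
    proof (cases "degree p = 0")
      case True
      then obtain c where "p = [:c:]" by (auto elim: degree_eq_zeroE)
      with less.prems K show ?thesis
        by (intro bexI[of _ "[:inverse c:]"])
           (auto simp: pCons_polys_over polys_over_closed subfield_closed)
    next
      case False
      have r_less: "degree (m mod p) < degree p \<or> m mod p = 0"
        using p0 degree_mod_less[of p m] by blast
      have r0: "poly (m mod p) \<theta> \<noteq> 0"
      proof
        assume r: "poly (m mod p) \<theta> = 0"
        then have "m mod p = 0" using minimal[of "m mod p"] dm r_less less.prems by auto
        moreover have "poly (m div p) \<theta> = 0" using eq r less.prems by simp
        moreover have e: "(m div p) * p = m" using \<open>m mod p = 0\<close> by auto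
        then have "m div p \<noteq> 0" using m(3) by auto
        then have "degree m = degree (m div p) + degree p"
          using degree_mult_eq[of "m div p" p, OF _ p0] unfolding e by blast
        then have "degree (m div p) < degree m" using False by simp
        ultimately have "m div p = 0" using minimal[of "m div p"] dm by auto
        with e m(3) show False by simp
      qed
      then obtain q where q: "q \<in> polys_over K" "poly q \<theta> = inverse (poly (m mod p) \<theta>)"
        using less.hyps[of "m mod p"] r_less dm less.prems by force
      have "poly (- (m div p) * q) \<theta> = inverse (poly p \<theta>)"
      proof -
        have r: "poly (m mod p) \<theta> = - (poly (m div p) \<theta> * poly p \<theta>)"
          using eq by (simp add: add_eq_0_iff)
        with r0 have "poly (m div p) \<theta> \<noteq> 0" by auto
        then show ?thesis using less.prems(2) by (simp add: q r field_simps)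
      qed
      then show ?thesis
        using q dm polys_over_closed[OF K] by (intro bexI[of _ "- (m div p) * q"]) auto
    qed
  qed
  moreover have "degree (p mod m) < degree m \<or> p mod m = 0" using m(3) degree_mod_less by blast
  moreover have "poly (p mod m) \<theta> = poly p \<theta>"
    by (metis add_0 div_mult_mod_eq m(2) mult_zero_right poly_add poly_mult)
  ultimately show ?thesis using div_mod_polys_over[OF K m(1) p(1)] p(2) by force
qed

subsection \<open>Automorphisms\<close>

lemma field_automorphismD:
  assumes "\<sigma> \<in> field_automorphisms K L"
  shows "bij_betw \<sigma> L L" "\<And>a. a \<in> L \<Longrightarrow> \<sigma> a \<in> L"
    "\<And>a b. a \<in> L \<Longrightarrow> b \<in> L \<Longrightarrow> \<sigma> (a + b) = \<sigma> a + \<sigma> b"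
    "\<And>a b. a \<in> L \<Longrightarrow> b \<in> L \<Longrightarrow> \<sigma> (a * b) = \<sigma> a * \<sigma> b" "\<And>a. a \<in> K \<Longrightarrow> \<sigma> a = a"
  using assms by (auto simp: field_automorphisms_def bij_betw_def)

lemma automorphism_zero:
  assumes "\<sigma> \<in> field_automorphisms K L" "is_subfield L"
  shows "\<sigma> 0 = 0"
  using field_automorphismD(3)[OF assms(1), of 0 0] subfield_closed(2)[OF assms(2)]
  by (metis add_cancel_right_right)

lemma poly_automorphism:
  assumes \<sigma>: "\<sigma> \<in> field_automorphisms K L" and L: "is_subfield L" and KL: "K \<subseteq> L"
    and p: "p \<in> polys_over K" and x: "x \<in> L"
  shows "\<sigma> (poly p x) = poly p (\<sigma> x)"
  using p
proof (induction p)
  case 0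
  then show ?case using automorphism_zero[OF \<sigma> L] by simp
next
  case (pCons a p)
  then have "a \<in> K" "p \<in> polys_over K" by (auto simp: pCons_polys_over)
  moreover have "poly p x \<in> L"
    using polys_over_mono[OF KL] poly_in_subfield[OF L _ x] calculation by blast
  ultimately show ?case
    using pCons KL x by (simp add: field_automorphismD[OF \<sigma>] subfield_closed[OF L] subsetD)
qed

lemma automorphism_comp:
  assumes "\<sigma> \<in> field_automorphisms K L" "\<tau> \<in> field_automorphisms K L"
  shows "\<sigma> \<circ> \<tau> \<in> field_automorphisms K L"
  using bij_betw_trans[OF field_automorphismD(1)[OF assms(2)] field_automorphismD(1)[OF assms(1)]]
  unfolding field_automorphisms_def
  by (auto simp: field_automorphismD[OF assms(1)] field_automorphismD[OF assms(2)])

lemma id_automorphism: "id \<in> field_automorphisms K L"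
  by (auto simp: field_automorphisms_def)

text \<open>The automorphisms permute the conjugates of \<open>\<theta>\<close>, so they fix the coefficients of the polynomial with
  these conjugates as roots.\<close>

lemma root_poly_over_fixed:
  assumes L: "is_subfield L" and \<theta>: "\<theta> \<in> L"
    and fixd: "{a \<in> L. \<forall>\<sigma>\<in>field_automorphisms K L. \<sigma> a = a} = K"
    and S: "S = (\<lambda>\<sigma>. \<sigma> \<theta>) ` field_automorphisms K L" "finite S"
  shows "(\<Prod>s\<in>S. [:- s, 1:]) \<in> polys_over K"
proof -
  have SL: "S \<subseteq> L" using S \<theta> by (auto simp: field_automorphismD)
  have act: "coeff (\<Prod>s\<in>A. [:- s, 1:]) i \<in> L \<and>
      \<sigma> (coeff (\<Prod>s\<in>A. [:- s, 1:]) i) = coeff (\<Prod>s\<in>A. [:- \<sigma> s, 1:]) i"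
    if \<sigma>: "\<sigma> \<in> field_automorphisms K L" and A: "finite A" "A \<subseteq> L" for \<sigma> A i
    using A
  proof (induction A arbitrary: i rule: finite_induct)
    case empty
    have "0 \<in> K" "1 \<in> K"
    proof -
      show "0 \<in> K" using fixd subfield_closed(2)[OF L] automorphism_zero[OF _ L] by blast
      have "\<tau> 1 = 1" if "\<tau> \<in> field_automorphisms K L" for \<tau>
      proof -
        have "\<tau> 1 * \<tau> 1 = \<tau> 1" using field_automorphismD(4)[OF that, of 1 1] subfield_closed[OF L] by simp
        moreover have "\<tau> 1 \<noteq> 0"
        proof
          assume "\<tau> 1 = 0"
          moreover have "\<tau> 0 = 0"
            using automorphism_zero[OF that L] .
          ultimately show False
            using field_automorphismD(1)[OF that] subfield_closed(1,2)[OF L]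
            by (metis bij_betw_iff_bijections zero_neq_one)
        qed
        ultimately show ?thesis by simp
      qed
      then show "1 \<in> K" using fixd subfield_closed(1)[OF L] by blast
    qed
    then show ?case using subfield_closed[OF L] field_automorphismD(5)[OF \<sigma>]
      by (auto simp: coeff_pCons one_pCons split: nat.splits)
  next
    case (insert a A)
    have \<sigma>L: "\<sigma> x \<in> L" if "x \<in> L" for x using field_automorphismD[OF \<sigma>] that by blast
    have neg: "\<sigma> (- x) = - \<sigma> x" if "x \<in> L" for x
    proof -
      have "\<sigma> (x + - x) = \<sigma> x + \<sigma> (- x)"
        using that subfield_closed[OF L] by (intro field_automorphismD(3)[OF \<sigma>]) auto
      moreover have "\<sigma> 0 = 0"
        using automorphism_zero[OF \<sigma> L] .
      ultimately show ?thesis by (simp add: eq_neg_iff_add_eq_0 add.commute)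
    qed
    have zero: "\<sigma> 0 = 0"
      using automorphism_zero[OF \<sigma> L] .
    have diff: "\<sigma> (x - y) = \<sigma> x - \<sigma> y" if "x \<in> L" "y \<in> L" for x y
      using field_automorphismD(3)[OF \<sigma>, of x "- y"] that neg subfield_closed[OF L] by simp
    show ?case
      using insert \<sigma>L diff
      by (cases i) (auto simp: subfield_closed[OF L] field_automorphismD[OF \<sigma>] neg zero)
  qed
  have "coeff (\<Prod>s\<in>S. [:- s, 1:]) i \<in> K" for i
  proof -
    have "\<sigma> (coeff (\<Prod>s\<in>S. [:- s, 1:]) i) = coeff (\<Prod>s\<in>S. [:- s, 1:]) i"
      if \<sigma>: "\<sigma> \<in> field_automorphisms K L" for \<sigma>
    proof -
      have inj: "inj_on \<sigma> S" using field_automorphismD(1)[OF \<sigma>] SL by (auto simp: bij_betw_def inj_on_def)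
      have "\<sigma> ` S \<subseteq> S"
      proof safe
        fix s assume "s \<in> S"
        then obtain \<tau> where \<tau>: "\<tau> \<in> field_automorphisms K L" "s = \<tau> \<theta>" using S(1) by blast
        have "\<sigma> s = (\<sigma> \<circ> \<tau>) \<theta>" by (simp add: \<tau>)
        then show "\<sigma> s \<in> S" unfolding S(1) using automorphism_comp[OF \<sigma> \<tau>(1)] by (rule image_eqI)
      qed
      then have "\<sigma> ` S = S" using inj S(2) by (simp add: endo_inj_surj)
      then have "(\<Prod>s\<in>S. [:- \<sigma> s, 1:]) = (\<Prod>s\<in>S. [:- s, 1:])"
        using prod.reindex[OF inj, of "\<lambda>s. [:- s, 1:]"] by simp
      then show ?thesis using act[OF \<sigma> S(2) SL] by simp
    qed
    then show ?thesis using act[OF id_automorphism S(2) SL] fixd by blast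
  qed
  then show ?thesis by (simp add: polys_over_def)
qed

text \<open>The polynomial with the conjugates as roots has its coefficients in K and vanishes at \<open>\<theta>\<close>, so it
  cannot have degree less than d.\<close>

lemma galois_imp_many_conjugates:
  assumes L: "is_subfield L" and \<theta>: "\<theta> \<in> L"
    and m: "m \<in> polys_over K" "m \<noteq> 0" "poly m \<theta> = 0"
    and minimal: "\<And>p. p \<in> polys_over K \<Longrightarrow> degree p < d \<Longrightarrow> poly p \<theta> = 0 \<Longrightarrow> p = 0"
    and galois: "galois_extension K L"
  shows "finite ((\<lambda>\<sigma>. \<sigma> \<theta>) ` field_automorphisms K L)"
    "card ((\<lambda>\<sigma>. \<sigma> \<theta>) ` field_automorphisms K L) \<ge> d"
proof -
  let ?S = "(\<lambda>\<sigma>. \<sigma> \<theta>) ` field_automorphisms K L"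
  have KL: "K \<subseteq> L" and fixd: "{a \<in> L. \<forall>\<sigma>\<in>field_automorphisms K L. \<sigma> a = a} = K"
    using galois by (auto simp: galois_extension_def)
  have zero: "\<sigma> 0 = 0" if "\<sigma> \<in> field_automorphisms K L" for \<sigma>
    using automorphism_zero[OF that L] .
  have "?S \<subseteq> {x. poly m x = 0}"
    using poly_automorphism[OF _ L KL m(1) \<theta>] zero m(3) by force
  then show fin: "finite ?S" using poly_roots_finite[OF m(2)] finite_subset by blast
  let ?p = "\<Prod>s\<in>?S. [:- s, 1:]"
  have "?p \<in> polys_over K" by (rule root_poly_over_fixed[OF L \<theta> fixd refl fin])
  moreover have "poly ?p \<theta> = 0"
    using fin image_eqI[OF _ id_automorphism[of K L], of \<theta> "\<lambda>\<sigma>. \<sigma> \<theta>"] by (auto simp: poly_prod)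
  moreover have "?p \<noteq> 0" using fin by simp
  moreover have "degree ?p = card ?S" by (subst degree_prod_sum_eq) auto
  ultimately show "card ?S \<ge> d" using minimal[of ?p] by (cases "card ?S < d") auto
qed

text \<open>If the minimal polynomial of the generator splits into distinct factors over L, substituting one root
  for another gives enough automorphisms: an element of degree less than d in \<open>\<theta>\<close> that they all fix is a
  polynomial taking one value at d points, hence a constant.\<close>

lemma galois_if_many_conjugates:
  fixes K L :: "'a::field set"
  assumes K: "is_subfield K" and L: "is_subfield L" and KL: "K \<subseteq> L" and \<theta>: "\<theta> \<in> L"
    and m: "m \<in> polys_over K" "poly m \<theta> = 0" "degree m > 0"
    and minimal: "\<And>p. p \<in> polys_over K \<Longrightarrow> degree p < degree m \<Longrightarrow> poly p \<theta> = 0 \<Longrightarrow> p = 0"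
    and generated: "\<And>a. a \<in> L \<Longrightarrow> \<exists>p\<in>polys_over K. a = poly p \<theta>"
    and R: "R \<subseteq> L" "\<And>r. r \<in> R \<Longrightarrow> poly m r = 0" "card R \<ge> degree m"
  shows "galois_extension K L"
proof -
  have m0: "m \<noteq> 0" using m(3) by auto
  have finR: "finite R" by (rule ccontr) (use R(3) m(3) in simp)
  have RL: "{x. poly m x = 0} = R"
  proof (rule sym, rule card_seteq)
    show "finite {x. poly m x = 0}" by (rule poly_roots_finite[OF m0])
    show "card {x. poly m x = 0} \<le> card R" using card_poly_roots_bound[OF m0] R(3) by (rule le_trans)
  qed (use R(2) in blast)
  have value_mod: "poly (p mod m) r = poly p r" if "poly m r = 0" for p r
    by (metis add_0 div_mult_mod_eq that mult_zero_right poly_add poly_mult)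
  have vanish: "poly p r = 0" if "p \<in> polys_over K" "poly p \<theta> = 0" "r \<in> R" for p r
  proof -
    have "degree (p mod m) < degree m \<or> p mod m = 0" using m0 degree_mod_less by blast
    then have "p mod m = 0"
      using minimal[of "p mod m"] value_mod[OF m(2)] that div_mod_polys_over[OF K m(1)] by auto
    then show ?thesis using value_mod[of r p] R(2) that by simp
  qed
  define P where "P a = (SOME p. p \<in> polys_over K \<and> a = poly p \<theta>)" for a
  have P: "P a \<in> polys_over K" "poly (P a) \<theta> = a" if "a \<in> L" for a
    using someI_ex[of "\<lambda>p. p \<in> polys_over K \<and> a = poly p \<theta>"] generated[OF that]
    unfolding P_def[symmetric] by (auto simp: Bex_def)
  define \<sigma> where "\<sigma> r a = poly (P a) r" for r a
  have \<sigma>_poly: "\<sigma> r (poly p \<theta>) = poly p r" if "p \<in> polys_over K" "r \<in> R" for p r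
  proof -
    have "poly p \<theta> \<in> L" using polys_over_mono[OF KL] poly_in_subfield[OF L _ \<theta>] that by blast
    note Pp = P[OF this]
    have "poly (P (poly p \<theta>) - p) r = 0"
      by (rule vanish) (use that Pp polys_over_closed[OF K] in auto)
    then show ?thesis by (simp add: \<sigma>_def)
  qed
  have aut: "\<sigma> r \<in> field_automorphisms K L" if r: "r \<in> R" for r
  proof -
    have add: "\<sigma> r (a + b) = \<sigma> r a + \<sigma> r b" and mult: "\<sigma> r (a * b) = \<sigma> r a * \<sigma> r b"
      if "a \<in> L" "b \<in> L" for a b
      using \<sigma>_poly[of "P a + P b" r] \<sigma>_poly[of "P a * P b" r] P[OF that(1)] P[OF that(2)] r
        polys_over_closed[OF K] by (auto simp: \<sigma>_def)
    have const: "\<sigma> r a = a" if "a \<in> K" for a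
      using \<sigma>_poly[of "[:a:]" r] that r by (simp add: pCons_polys_over polys_over_closed[OF K])
    have closed: "\<sigma> r a \<in> L" if "a \<in> L" for a
      unfolding \<sigma>_def using P[OF that] polys_over_mono[OF KL] poly_in_subfield[OF L] R(1) r by blast
    have inj: "inj_on (\<sigma> r) L"
    proof (rule inj_onI)
      fix a b assume ab: "a \<in> L" "b \<in> L" "\<sigma> r a = \<sigma> r b"
      show "a = b"
      proof (rule ccontr)
        assume "a \<noteq> b"
        let ?c = "a + (- b)"
        have c: "?c \<in> L" "?c \<noteq> 0" using ab \<open>a \<noteq> b\<close> subfield_closed[OF L] by auto
        have "\<sigma> r (- b) = \<sigma> r ((-1) * b)" by simp
        also have "\<dots> = - \<sigma> r b"
          using mult[of "-1" b] const[of "-1"] ab subfield_closed[OF K] subfield_closed[OF L] by simp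
        finally have "\<sigma> r ?c = 0" using add[of a "- b"] ab subfield_closed[OF L] by simp
        then have "\<sigma> r (?c * inverse ?c) = 0"
          using mult[of ?c "inverse ?c"] c subfield_closed[OF L] by simp
        then show False using const[of 1] c subfield_closed(1)[OF K] by simp
      qed
    qed
    have perm: "\<sigma> r ` R = R"
    proof (rule endo_inj_surj[OF finR])
      show "\<sigma> r ` R \<subseteq> R"
      proof safe
        fix s assume s: "s \<in> R"
        then have sL: "s \<in> L" using R by auto
        \<comment> \<open>Composing m with the polynomial that expresses s gives a polynomial over K that vanishes at
          the generator, hence at r.\<close>
        have "poly m s = 0" using R s by auto
        then have "poly (pcompose m (P s)) \<theta> = 0" using P[OF sL] by (simp add: poly_pcompose)
        moreover have "pcompose m (P s) \<in> polys_over K"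
          using m(1) P(1)[OF sL]
          by (induction m) (auto simp: pcompose_pCons pCons_polys_over polys_over_closed[OF K])
        ultimately have "poly (pcompose m (P s)) r = 0" using vanish r by blast
        then have "poly m (\<sigma> r s) = 0" by (simp add: \<sigma>_def poly_pcompose)
        then show "\<sigma> r s \<in> R" using RL by auto
      qed
      show "inj_on (\<sigma> r) R" using inj R(1) by (meson inj_on_subset)
    qed
    have "L \<subseteq> \<sigma> r ` L"
    proof
      fix a assume a: "a \<in> L"
      have "\<theta> \<in> R" using RL m(2) by auto
      then obtain s where s: "s \<in> R" "\<sigma> r s = \<theta>" using perm by (metis imageE)
      then have sL: "s \<in> L" using R by auto
      have pc: "pcompose p (P s) \<in> polys_over K" if "p \<in> polys_over K" for p
        using that P(1)[OF sL]
        by (induction p) (auto simp: pcompose_pCons pCons_polys_over polys_over_closed[OF K])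
      have "\<sigma> r (poly (pcompose (P a) (P s)) \<theta>) = poly (pcompose (P a) (P s)) r"
        by (rule \<sigma>_poly) (use pc P(1)[OF a] r in auto)
      also have "\<dots> = a" using s P[OF a] by (simp add: poly_pcompose \<sigma>_def)
      finally have "\<sigma> r (poly (pcompose (P a) (P s)) \<theta>) = a" .
      moreover have "poly (pcompose (P a) (P s)) \<theta> \<in> L"
        using pc[OF P(1)[OF a]] polys_over_mono[OF KL] by (intro poly_in_subfield[OF L _ \<theta>]) blast
      ultimately show "a \<in> \<sigma> r ` L" by (metis imageI)
    qed
    then show ?thesis
      using inj closed add mult const by (auto simp: field_automorphisms_def bij_betw_def)
  qed
  have fixd: "{a \<in> L. \<forall>\<sigma>\<in>field_automorphisms K L. \<sigma> a = a} = K"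
  proof safe
    fix a assume a: "a \<in> L" and fixed: "\<forall>\<sigma>\<in>field_automorphisms K L. \<sigma> a = a"
    let ?p = "P a mod m"
    have p: "?p \<in> polys_over K" using div_mod_polys_over[OF K m(1)] P(1)[OF a] by blast
    have "degree ?p < degree m" using m0 m(3) degree_mod_less[of m "P a"] by auto
    have "?p = [:a:]"
    proof (rule poly_eqI_degree[of R])
      fix r assume r: "r \<in> R"
      have "poly ?p r = poly (P a) r" using value_mod R(2) r by blast
      also have "\<dots> = a" using fixed aut[OF r] by (auto simp: \<sigma>_def)
      finally show "poly ?p r = poly [:a:] r" by simp
    qed (use \<open>degree ?p < degree m\<close> R(3) m(3) in auto)
    then show "a \<in> K" using p by (simp add: pCons_polys_over)
  next
    fix a assume "a \<in> K" then show "a \<in> L" using KL by auto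
  next
    fix a \<sigma> assume "a \<in> K" "\<sigma> \<in> field_automorphisms K L"
    then show "\<sigma> a = a" by (simp add: field_automorphismD)
  qed
  have alg: "\<exists>p. p \<noteq> 0 \<and> (\<forall>i. coeff p i \<in> K) \<and> poly p a = 0" if a: "a \<in> L" for a
  proof -
    let ?S = "(\<lambda>\<sigma>. \<sigma> a) ` field_automorphisms K L"
    have zero: "\<sigma> 0 = 0" if "\<sigma> \<in> field_automorphisms K L" for \<sigma>
      using automorphism_zero[OF that L] .
    have "?S \<subseteq> poly (P a) ` R"
    proof safe
      fix \<tau> assume \<tau>: "\<tau> \<in> field_automorphisms K L"
      have "poly m (\<tau> \<theta>) = 0"
        using poly_automorphism[OF \<tau> L KL m(1) \<theta>] m(2) zero[OF \<tau>] by simp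
      then have "\<tau> \<theta> \<in> R" using RL by auto
      moreover have "\<tau> a = poly (P a) (\<tau> \<theta>)"
        using poly_automorphism[OF \<tau> L KL P(1)[OF a] \<theta>] P(2)[OF a] by simp
      ultimately show "\<tau> a \<in> poly (P a) ` R" by simp
    qed
    then have fin: "finite ?S" using finR finite_surj by blast
    let ?p = "\<Prod>s\<in>?S. [:- s, 1:]"
    have "?p \<in> polys_over K" by (rule root_poly_over_fixed[OF L a fixd refl fin])
    moreover have "poly ?p a = 0"
      using fin image_eqI[OF _ id_automorphism[of K L], of a "\<lambda>\<sigma>. \<sigma> a"] by (auto simp: poly_prod)
    moreover have "?p \<noteq> 0" using fin by simp
    ultimately show ?thesis by (auto simp: polys_over_def)
  qed
  show ?thesis using KL alg fixd by (auto simp: galois_extension_def)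
qed

section \<open>Forms in two and three variables\<close>

text \<open>Identities between polynomials in several variables are proved below by evaluation at complex points,
  which commutes with the substitutions and with the linear actions.\<close>

definition ev2 :: "cpoly2 \<Rightarrow> complex \<Rightarrow> complex \<Rightarrow> complex" where
  "ev2 A x y = poly (poly A [:y:]) x"

definition ev3 :: "cpoly3 \<Rightarrow> complex \<Rightarrow> complex \<Rightarrow> complex \<Rightarrow> complex" where
  "ev3 P x y z = ev2 (poly P (const2 z)) x y"

lemma ev2_simps [simp]:
  "ev2 0 x y = 0" "ev2 1 x y = 1" "ev2 (A + B) x y = ev2 A x y + ev2 B x y"
  "ev2 (A - B) x y = ev2 A x y - ev2 B x y" "ev2 (- A) x y = - ev2 A x y"
  "ev2 (A * B) x y = ev2 A x y * ev2 B x y" "ev2 (A ^ n) x y = ev2 A x y ^ n"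
  "ev2 (const2 c) x y = c" "ev2 varx x y = x" "ev2 vary x y = y" "ev2 (numeral k) x y = numeral k"
  "ev2 (pCons p A) x y = poly p x + y * ev2 A x y"
  "ev2 (smult p A) x y = poly p x * ev2 A x y"
  by (simp_all add: ev2_def const2_def varx_def vary_def)

lemma ev2_sum [simp]: "ev2 (\<Sum>i\<in>I. A i) x y = (\<Sum>i\<in>I. ev2 (A i) x y)"
  by (simp add: ev2_def poly_sum)

lemma ev3_simps [simp]:
  "ev3 0 x y z = 0" "ev3 1 x y z = 1" "ev3 (P + Q) x y z = ev3 P x y z + ev3 Q x y z"
  "ev3 (P - Q) x y z = ev3 P x y z - ev3 Q x y z" "ev3 (- P) x y z = - ev3 P x y z"
  "ev3 (P * Q) x y z = ev3 P x y z * ev3 Q x y z" "ev3 (P ^ n) x y z = ev3 P x y z ^ n"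
  "ev3 (const3 c) x y z = c" "ev3 varz x y z = z"
  "ev3 (pCons A P) x y z = ev2 A x y + z * ev3 P x y z"
  "ev3 (smult A P) x y z = ev2 A x y * ev3 P x y z"
  by (simp_all add: ev3_def const3_def varz_def)

lemma ev3_sum [simp]: "ev3 (\<Sum>i\<in>I. P i) x y z = (\<Sum>i\<in>I. ev3 (P i) x y z)"
  by (simp add: ev3_def poly_sum)

lemma poly_eqI_infinite:
  fixes p q :: "'a::idom poly"
  assumes "infinite S" "\<And>x. x \<in> S \<Longrightarrow> poly p x = poly q x"
  shows "p = q"
proof (rule ccontr)
  assume "p \<noteq> q"
  then have "finite {x. poly (p - q) x = 0}" by (intro poly_roots_finite) auto
  moreover have "S \<subseteq> {x. poly (p - q) x = 0}" using assms(2) by auto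
  ultimately show False using assms(1) finite_subset by blast
qed

lemma ev2_eqI:
  assumes "\<And>x y. ev2 A x y = ev2 B x y"
  shows "A = B"
proof (rule poly_eqI_infinite[of "range (\<lambda>c::complex. [:c:])"])
  show "infinite (range (\<lambda>c::complex. [:c:]))"
    by (subst finite_image_iff) (auto simp: inj_on_def infinite_UNIV_char_0)
  show "poly A p = poly B p" if "p \<in> range (\<lambda>c. [:c:])" for p
    using that assms by (auto simp: ev2_def poly_eq_poly_eq_iff[symmetric])
qed

lemma ev3_eqI:
  assumes "\<And>x y z. ev3 P x y z = ev3 Q x y z"
  shows "P = Q"
proof (rule poly_eqI_infinite[of "range const2"])
  show "infinite (range const2)"
    by (subst finite_image_iff) (auto simp: inj_on_def const2_def infinite_UNIV_char_0)
  show "poly P p = poly Q p" if "p \<in> range const2" for p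
    using that assms by (auto simp: ev3_def intro: ev2_eqI)
qed

lemma ev3_nonzero: "P \<noteq> 0 \<Longrightarrow> \<exists>x y z. ev3 P x y z \<noteq> 0"
  using ev3_eqI[of P 0] by auto

lemma ev2_subst2 [simp]: "ev2 (subst2 P u v) x y = ev2 P (ev2 u x y) (ev2 v x y)"
proof -
  have c: "const2 0 = 0" by (simp add: const2_def)
  have inner: "ev2 (poly (map_poly const2 p) u) x y = poly p (ev2 u x y)" for p
    by (induction p) (auto simp: map_poly_pCons c)
  show ?thesis unfolding subst2_def
    by (induction P) (auto simp: map_poly_pCons c inner)
qed

lemma ev3_subst3 [simp]:
  "ev3 (subst3 P u v w) x y z = ev3 P (ev3 u x y z) (ev3 v x y z) (ev3 w x y z)"
proof -
  have c: "const3 0 = 0" by (simp add: const3_def const2_def)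
  have inner: "ev3 (poly (map_poly const3 p) u) x y z = poly p (ev3 u x y z)" for p
    by (induction p) (auto simp: map_poly_pCons c)
  have middle: "ev3 (poly (map_poly (\<lambda>q. poly (map_poly const3 q) u) p) v) x y z
      = ev2 p (ev3 u x y z) (ev3 v x y z)" for p
    by (induction p) (auto simp: map_poly_pCons inner)
  show ?thesis unfolding subst3_def
    by (induction P) (auto simp: map_poly_pCons middle)
qed

lemma ev2_linear_subst [simp]:
  "ev2 (linear_subst \<alpha> P) x y = ev2 P (\<alpha>$1$1 * x + \<alpha>$1$2 * y) (\<alpha>$2$1 * x + \<alpha>$2$2 * y)"
  by (simp add: linear_subst_def)

subsection \<open>Homogeneity\<close>

definition scale2 :: "complex \<Rightarrow> cpoly2 \<Rightarrow> cpoly2" where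
  "scale2 c A = pcompose (map_poly (\<lambda>p. pcompose p [:0, c:]) A) [:0, [:c:]:]"

definition scale3 :: "complex \<Rightarrow> cpoly3 \<Rightarrow> cpoly3" where
  "scale3 c P = pcompose (map_poly (scale2 c) P) [:0, const2 c:]"

lemma coeff_scale2: "coeff (coeff (scale2 c A) j) i = c ^ (i + j) * coeff (coeff A j) i"
proof -
  have "[:c:] ^ n = [:c ^ n:]" for n by (induction n) (auto simp: one_pCons)
  then show ?thesis
    by (simp add: scale2_def coeff_pcompose_linear coeff_map_poly power_add)
qed

lemma coeff_scale3:
  "coeff (coeff (coeff (scale3 c P) k) j) i = c ^ (i + j + k) * coeff (coeff (coeff P k) j) i"
proof -
  have 0: "scale2 c 0 = 0" by (simp add: scale2_def)
  have "const2 c ^ n = const2 (c ^ n)" for n by (intro ev2_eqI) simp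
  then show ?thesis
    by (simp add: scale3_def coeff_pcompose_linear coeff_map_poly 0)
      (simp add: const2_def coeff_scale2 power_add)
qed

lemma ev2_scale2: "ev2 (scale2 c A) x y = ev2 A (c * x) (c * y)"
proof (induction A)
  case (pCons p A)
  then show ?case by (simp add: scale2_def map_poly_pCons pcompose_pCons poly_pcompose mult_ac)
qed (simp add: scale2_def)

lemma ev3_scale3: "ev3 (scale3 c P) x y z = ev3 P (c * x) (c * y) (c * z)"
proof (induction P)
  case (pCons A P)
  have 0: "scale2 c 0 = 0" by (simp add: scale2_def)
  then show ?case using pCons
    by (simp add: scale3_def map_poly_pCons pcompose_pCons ev2_scale2 mult_ac)
qed (simp add: scale3_def)

lemma two_power_eq_iff: "(2::complex) ^ m = 2 ^ n \<longleftrightarrow> m = n"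
proof
  assume "(2::complex) ^ m = 2 ^ n"
  then have "norm ((2::complex) ^ m) = norm ((2::complex) ^ n)" by simp
  then show "m = n" by (simp add: norm_power)
qed simp

text \<open>For the converse the factor c = 2 suffices, because the powers of 2 are distinct.\<close>

lemma homogeneous2_iff:
  "homogeneous2 n A \<longleftrightarrow> (\<forall>c x y. ev2 A (c * x) (c * y) = c ^ n * ev2 A x y)"
proof
  assume h: "homogeneous2 n A"
  have "scale2 c A = const2 (c ^ n) * A" for c
    using h by (intro poly_eqI) (auto simp: coeff_scale2 const2_def homogeneous2_def)
  then show "\<forall>c x y. ev2 A (c * x) (c * y) = c ^ n * ev2 A x y"
    by (metis ev2_scale2 ev2_simps(6,8))
next
  assume "\<forall>c x y. ev2 A (c * x) (c * y) = c ^ n * ev2 A x y"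
  then have s: "scale2 2 A = const2 (2 ^ n) * A" by (intro ev2_eqI) (simp add: ev2_scale2)
  have "2 ^ (i + j) * coeff (coeff A j) i = 2 ^ n * coeff (coeff A j) i" for i j
    using arg_cong[OF s, of "\<lambda>P. coeff (coeff P j) i"] by (simp add: coeff_scale2 const2_def)
  then show "homogeneous2 n A" unfolding homogeneous2_def by (metis mult_right_cancel two_power_eq_iff)
qed

lemma homogeneous3_iff:
  "homogeneous3 n P \<longleftrightarrow> (\<forall>c x y z. ev3 P (c * x) (c * y) (c * z) = c ^ n * ev3 P x y z)"
proof
  assume h: "homogeneous3 n P"
  have "scale3 c P = const3 (c ^ n) * P" for c
    using h by (intro poly_eqI) (auto simp: coeff_scale3 const3_def const2_def homogeneous3_def)
  then show "\<forall>c x y z. ev3 P (c * x) (c * y) (c * z) = c ^ n * ev3 P x y z"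
    by (metis ev3_scale3 ev3_simps(6,8))
next
  assume "\<forall>c x y z. ev3 P (c * x) (c * y) (c * z) = c ^ n * ev3 P x y z"
  then have s: "scale3 2 P = const3 (2 ^ n) * P" by (intro ev3_eqI) (simp add: ev3_scale3)
  have "2 ^ (i + j + k) * coeff (coeff (coeff P k) j) i = 2 ^ n * coeff (coeff (coeff P k) j) i" for i j k
    using arg_cong[OF s, of "\<lambda>P. coeff (coeff (coeff P k) j) i"]
    by (simp add: coeff_scale3 const3_def const2_def)
  then show "homogeneous3 n P" unfolding homogeneous3_def by (metis mult_right_cancel two_power_eq_iff)
qed

lemma homogeneous2_scale: "homogeneous2 n A \<Longrightarrow> ev2 A (c * x) (c * y) = c ^ n * ev2 A x y"
  by (simp add: homogeneous2_iff)

lemma homogeneous3_scale: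
  "homogeneous3 n P \<Longrightarrow> ev3 P (c * x) (c * y) (c * z) = c ^ n * ev3 P x y z"
  by (simp add: homogeneous3_iff)

definition dehom :: "cpoly2 \<Rightarrow> complex poly" where
  "dehom A = poly A 1"

lemma poly_dehom: "poly (dehom A) t = ev2 A t 1"
  by (simp add: dehom_def ev2_def one_pCons)

lemma coeff_dehom:
  assumes "homogeneous2 n A"
  shows "coeff (dehom A) i = (if i \<le> n then coeff (coeff A (n - i)) i else 0)"
proof -
  have "coeff (dehom A) i = (\<Sum>j\<le>degree A. coeff (coeff A j) i)"
    by (simp add: dehom_def poly_altdef coeff_sum)
  also have "\<dots> = (\<Sum>j\<le>degree A. if j = n - i \<and> i \<le> n then coeff (coeff A (n - i)) i else 0)"
  proof (rule sum.cong[OF refl])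
    fix j
    show "coeff (coeff A j) i = (if j = n - i \<and> i \<le> n then coeff (coeff A (n - i)) i else 0)"
    proof (cases "coeff (coeff A j) i = 0")
      case False
      then have "i + j = n" using assms by (simp add: homogeneous2_def)
      then show ?thesis by auto
    qed auto
  qed
  also have "\<dots> = (if i \<le> n then coeff (coeff A (n - i)) i else 0)"
  proof (cases "n - i \<le> degree A")
    case True
    then show ?thesis by (cases "i \<le> n") (auto simp: sum.delta)
  next
    case False
    then have "coeff A (n - i) = 0" by (simp add: coeff_eq_0)
    then show ?thesis by (auto intro!: sum.neutral)
  qed
  finally show ?thesis .
qed

lemma degree_dehom: "homogeneous2 n A \<Longrightarrow> degree (dehom A) \<le> n"
  by (rule degree_le) (auto simp: coeff_dehom)

text \<open>The form of degree n with dehomogenization p, as a function. The degree has to be given, because zeros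
  at the point at infinity lower the degree of p.\<close>

definition hom_eval :: "nat \<Rightarrow> complex poly \<Rightarrow> complex \<Rightarrow> complex \<Rightarrow> complex" where
  "hom_eval n p x y = (\<Sum>i\<le>n. coeff p i * x ^ i * y ^ (n - i))"

definition homogenize :: "nat \<Rightarrow> complex poly \<Rightarrow> cpoly2" where
  "homogenize n p = (\<Sum>i\<le>n. const2 (coeff p i) * varx ^ i * vary ^ (n - i))"

lemma ev2_homogenize [simp]: "ev2 (homogenize n p) x y = hom_eval n p x y"
  by (simp add: homogenize_def hom_eval_def)

lemma hom_eval_eq:
  assumes "degree p \<le> n" "y \<noteq> 0"
  shows "hom_eval n p x y = y ^ n * poly p (x / y)"
proof -
  have "poly p (x / y) = (\<Sum>i\<le>n. coeff p i * (x / y) ^ i)"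
    unfolding poly_altdef by (rule sum.mono_neutral_left) (use assms in \<open>auto simp: coeff_eq_0\<close>)
  then show ?thesis
    using assms(2) by (auto simp: hom_eval_def sum_distrib_left power_diff field_simps intro!: sum.cong)
qed

lemma hom_eval_1: "degree p \<le> n \<Longrightarrow> hom_eval n p t 1 = poly p t"
  using hom_eval_eq[of p n 1 t] by simp

lemma hom_eval_0: "hom_eval n p x 0 = coeff p n * x ^ n"
proof -
  have "hom_eval n p x 0 = (\<Sum>i\<le>n. if i = n then coeff p n * x ^ n else 0)"
    unfolding hom_eval_def by (rule sum.cong) auto
  then show ?thesis by simp
qed

lemma hom_eval_scale: "hom_eval n p (c * x) (c * y) = c ^ n * hom_eval n p x y"
proof -
  have "c ^ n = c ^ i * c ^ (n - i)" if "i \<le> n" for i using that by (simp flip: power_add)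
  then show ?thesis by (auto simp: hom_eval_def sum_distrib_left power_mult_distrib intro!: sum.cong)
qed

lemma homogeneous2_homogenize: "homogeneous2 n (homogenize n p)"
  by (simp add: homogeneous2_iff hom_eval_scale)

lemma ev2_dehom:
  assumes "homogeneous2 n A"
  shows "ev2 A x y = hom_eval n (dehom A) x y"
proof -
  have generic: "ev2 A x y = hom_eval n (dehom A) x y" if "y \<noteq> 0" for x y
    using homogeneous2_scale[OF assms, of y "x / y" 1] that
    by (simp add: hom_eval_eq[OF degree_dehom[OF assms] that] poly_dehom)
  have "poly A [:y:] = poly (homogenize n (dehom A)) [:y:]" if "y \<noteq> 0" for y
    using generic[OF that] ev2_homogenize[of n "dehom A"]
    by (auto simp: ev2_def poly_eq_poly_eq_iff[symmetric])
  then have "A = homogenize n (dehom A)"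
  proof (intro poly_eqI_infinite[of "(\<lambda>c::complex. [:c:]) ` (UNIV - {0})" A])
    show "infinite ((\<lambda>c::complex. [:c:]) ` (UNIV - {0}))"
      by (subst finite_image_iff) (auto simp: inj_on_def infinite_UNIV_char_0)
  qed auto
  then show ?thesis using ev2_homogenize by metis
qed

lemma homogenize_dehom: "homogeneous2 n A \<Longrightarrow> homogenize n (dehom A) = A"
  by (rule ev2_eqI) (simp add: ev2_dehom[of n A])

lemma dehom_homogenize: "degree p \<le> n \<Longrightarrow> dehom (homogenize n p) = p"
  by (rule poly_eqI_infinite[OF infinite_UNIV_char_0]) (simp add: poly_dehom hom_eval_1)

section \<open>Pairs of binary forms without common zero\<close>

lemma homogenize_mult:
  assumes "degree p \<le> m" "degree q \<le> n"
  shows "homogenize (m + n) (p * q) = homogenize m p * homogenize n q"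
proof -
  have "degree (p * q) \<le> m + n" using degree_mult_le[of p q] assms by simp
  moreover have "homogeneous2 (m + n) (homogenize m p * homogenize n q)"
    by (simp add: homogeneous2_iff hom_eval_scale power_add mult_ac)
  moreover have "dehom (homogenize m p * homogenize n q) = p * q"
    using assms by (simp add: dehom_def) (metis dehom_def dehom_homogenize)
  ultimately show ?thesis by (metis homogenize_dehom)
qed

lemma hom_eval_mult:
  assumes "degree p \<le> m" "degree q \<le> n"
  shows "hom_eval (m + n) (p * q) x y = hom_eval m p x y * hom_eval n q x y"
  using homogenize_mult[OF assms] by (metis ev2_homogenize ev2_simps(6))

lemma hom_eval_add: "hom_eval n (p + q) x y = hom_eval n p x y + hom_eval n q x y"
  by (simp add: hom_eval_def algebra_simps sum.distrib)

lemma hom_eval_diff: "hom_eval n (p - q) x y = hom_eval n p x y - hom_eval n q x y"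
  by (simp add: hom_eval_def algebra_simps sum_subtractf)

lemma hom_eval_smult: "hom_eval n (smult c p) x y = c * hom_eval n p x y"
  by (simp add: hom_eval_def algebra_simps sum_distrib_left)

lemma hom_eval_linear: "hom_eval 1 p x y = coeff p 0 * y + coeff p 1 * x"
  by (simp add: hom_eval_def)

lemma hom_eval_const: "hom_eval 0 p x y = coeff p 0"
  by (simp add: hom_eval_def)

lemma hom_eval_power:
  assumes "degree p \<le> m"
  shows "hom_eval (k * m) (p ^ k) x y = hom_eval m p x y ^ k"
proof (induction k)
  case (Suc k)
  have "degree (p ^ k) \<le> k * m" using degree_power_le[of p k] assms
    by (metis le_trans mult.commute mult_le_mono1)
  then show ?case using hom_eval_mult[OF assms, of "p ^ k" "k * m"] Suc by simp
qed (simp add: hom_eval_const)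

definition no_common_zero :: "(complex \<Rightarrow> complex \<Rightarrow> complex) \<Rightarrow> (complex \<Rightarrow> complex \<Rightarrow> complex) \<Rightarrow> bool" where
  "no_common_zero F G \<longleftrightarrow> (\<forall>x y. F x y = 0 \<and> G x y = 0 \<longrightarrow> x = 0 \<and> y = 0)"

text \<open>A zero on the line at infinity shows as a drop of the degree of the dehomogenization, which makes y a
  factor; any other zero is a root of the dehomogenization.\<close>

lemma linear_factor:
  assumes A: "homogeneous2 d A" and d: "d \<ge> 1" and zero: "ev2 A x0 y0 = 0" "x0 \<noteq> 0 \<or> y0 \<noteq> 0"
  shows "const2 y0 * varx - const2 x0 * vary dvd A"
proof (cases "y0 = 0")
  case True
  then have c: "coeff (dehom A) d = 0" using zero ev2_dehom[OF A] by (simp add: hom_eval_0)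
  have "degree (dehom A) \<le> d - 1"
  proof (rule degree_le, safe)
    fix i assume "d - 1 < i"
    then show "coeff (dehom A) i = 0"
      using c d degree_dehom[OF A] by (cases "i = d") (auto intro: coeff_eq_0)
  qed
  then have "hom_eval (1 + (d - 1)) (1 * dehom A) x y = hom_eval 1 1 x y * hom_eval (d - 1) (dehom A) x y" for x y
    by (intro hom_eval_mult) auto
  then have "ev2 A x y = y * hom_eval (d - 1) (dehom A) x y" for x y
    using d ev2_dehom[OF A] by (simp add: hom_eval_linear[unfolded One_nat_def] one_pCons)
  then have "A = (const2 y0 * varx - const2 x0 * vary) * (const2 (- 1 / x0) * homogenize (d - 1) (dehom A))"
    using True zero by (intro ev2_eqI) auto
  then show ?thesis by (rule dvdI)
next
  case False
  let ?t = "x0 / y0"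
  have "poly (dehom A) ?t = 0"
    using zero False hom_eval_eq[OF degree_dehom[OF A] False, of x0] ev2_dehom[OF A, of x0 y0] by simp
  then obtain q where q: "dehom A = [:- ?t, 1:] * q" by (auto simp: poly_eq_0_iff_dvd)
  have "degree q \<le> d - 1"
    using degree_dehom[OF A] degree_mult_eq[of "[:- ?t, 1:]" q] by (cases "q = 0") (auto simp: q)
  then have "hom_eval (1 + (d - 1)) ([:- ?t, 1:] * q) x y = hom_eval 1 [:- ?t, 1:] x y * hom_eval (d - 1) q x y" for x y
    by (intro hom_eval_mult) auto
  moreover have "hom_eval 1 [:- ?t, 1:] x y = x - ?t * y" for x y by (simp only: hom_eval_linear) simp
  moreover have "1 + (d - 1) = d" using d by simp
  ultimately have "ev2 A x y = (x - ?t * y) * hom_eval (d - 1) q x y" for x y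
    using ev2_dehom[OF A, of x y] q by metis
  then have "A = (const2 y0 * varx - const2 x0 * vary) * (const2 (1 / y0) * homogenize (d - 1) q)"
    using False by (intro ev2_eqI) (auto simp: field_simps)
  then show ?thesis by (rule dvdI)
qed

lemma coprime_imp_no_common_zero:
  assumes A: "homogeneous2 d A" and B: "homogeneous2 d B" and d: "d \<ge> 1" and AB: "coprime A B"
  shows "no_common_zero (ev2 A) (ev2 B)"
  unfolding no_common_zero_def
proof safe
  fix x y assume z: "ev2 A x y = 0" "ev2 B x y = 0"
  have "x = 0 \<and> y = 0"
  proof (rule ccontr)
    assume "\<not> ?thesis"
    then have "is_unit (const2 y * varx - const2 x * vary)"
      using linear_factor[OF A d z(1)] linear_factor[OF B d z(2)] AB by (auto simp: coprime_def)
    then obtain q where "1 = (const2 y * varx - const2 x * vary) * q" by (auto elim: dvdE)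
    from arg_cong[OF this, of "\<lambda>P. ev2 P x y"] show False by simp
  qed
  then show "x = 0" "y = 0" by auto
qed

text \<open>The dehomogenizations are coprime; their Bezout identity, homogenized, expresses a power of y. Such
  expressions make it possible to substitute other polynomials for the variables and keep coprimality.\<close>

lemma power_of_y_in_ideal:
  assumes A: "homogeneous2 d A" and B: "homogeneous2 d B"
    and nz: "no_common_zero (ev2 A) (ev2 B)"
  shows "\<exists>N u v. vary ^ N = u * A + v * B"
proof -
  let ?a = "dehom A" and ?b = "dehom B"
  have "coprime ?a ?b"
  proof (rule coprimeI)
    fix c assume c: "c dvd ?a" "c dvd ?b"
    show "is_unit c"
    proof (rule ccontr)
      assume "\<not> is_unit c"
      moreover have "c \<noteq> 0"
      proof
        assume "c = 0"
        then have "?a = 0" "?b = 0" using c by auto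
        then show False
          using nz unfolding no_common_zero_def by (metis poly_dehom poly_0 one_neq_zero)
      qed
      ultimately have "degree c \<noteq> 0" by (simp add: is_unit_iff_degree)
      then obtain t where "poly c t = 0"
        using fundamental_theorem_of_algebra[of c] by (auto simp: constant_degree)
      then have "ev2 A t 1 = 0" "ev2 B t 1 = 0" using c by (auto simp flip: poly_dehom elim!: dvdE)
      then show False using nz unfolding no_common_zero_def by (metis one_neq_zero)
    qed
  qed
  then obtain p q where pq: "p * ?a + q * ?b = 1"
    using bezout_coefficients_fst_snd[of ?a ?b] by (auto simp: coprime_iff_gcd_eq_1)
  let ?n = "max (degree p) (degree q)"
  have "vary ^ (?n + d) = homogenize ?n p * A + homogenize ?n q * B"
  proof (rule ev2_eqI)
    fix x y
    have "hom_eval (?n + d) (p * ?a + q * ?b) x y = hom_eval ?n p x y * ev2 A x y + hom_eval ?n q x y * ev2 B x y"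
      by (simp add: hom_eval_add hom_eval_mult degree_dehom[OF A] degree_dehom[OF B]
          ev2_dehom[OF A, of x y] ev2_dehom[OF B, of x y])
    moreover have "hom_eval (?n + d) 1 x y = y ^ (?n + d)"
    proof -
      have "hom_eval (?n + d) 1 x y = (\<Sum>i\<le>?n + d. if i = 0 then y ^ (?n + d) else 0)"
        unfolding hom_eval_def by (intro sum.cong) auto
      then show ?thesis by simp
    qed
    ultimately show "ev2 (vary ^ (?n + d)) x y = ev2 (homogenize ?n p * A + homogenize ?n q * B) x y"
      by (simp add: pq)
  qed
  then show ?thesis by blast
qed

lemma powers_in_ideal:
  assumes A: "homogeneous2 d A" and B: "homogeneous2 d B"
    and nz: "no_common_zero (ev2 A) (ev2 B)"
  obtains N u v N' u' v' where "vary ^ N = u * A + v * B" "varx ^ N' = u' * A + v' * B"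
proof -
  define swap where "swap P = subst2 P vary varx" for P
  have ev_swap: "ev2 (swap P) x y = ev2 P y x" for P x y by (simp add: swap_def)
  have "homogeneous2 d (swap A)" "homogeneous2 d (swap B)"
    using A B by (auto simp: homogeneous2_iff ev_swap)
  moreover have "no_common_zero (ev2 (swap A)) (ev2 (swap B))"
    using nz unfolding no_common_zero_def ev_swap by metis
  ultimately obtain N u v where "vary ^ N = u * swap A + v * swap B"
    using power_of_y_in_ideal by blast
  then have "ev2 (vary ^ N) y x = ev2 (u * swap A + v * swap B) y x" for x y by simp
  then have "varx ^ N = swap u * A + swap v * B"
    by (intro ev2_eqI) (simp add: ev_swap)
  then show ?thesis using power_of_y_in_ideal[OF A B nz] that by blast
qed

lemma coprime_varx_vary: "coprime varx vary"
proof (rule coprimeI)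
  fix h assume h: "h dvd varx" "h dvd vary"
  have "degree h \<le> degree varx" by (rule dvd_imp_degree_le[OF h(1)]) (simp add: varx_def)
  then obtain p where p: "h = [:p:]" by (auto simp: varx_def elim: degree_eq_zeroE)
  then have "p dvd coeff vary 1" using h(2) by (simp add: const_poly_dvd_iff)
  then show "is_unit h" by (simp add: p vary_def is_unit_const_poly_iff)
qed

lemma no_common_zero_imp_coprime:
  assumes A: "homogeneous2 d A" and B: "homogeneous2 d B"
    and nz: "no_common_zero (ev2 A) (ev2 B)"
  shows "coprime A B"
proof (rule coprimeI)
  fix h assume h: "h dvd A" "h dvd B"
  obtain N u v N' u' v' where "vary ^ N = u * A + v * B" "varx ^ N' = u' * A + v' * B"
    by (rule powers_in_ideal[OF A B nz])
  then have "h dvd vary ^ N" "h dvd varx ^ N'" using h by auto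
  moreover have "coprime (varx ^ N') (vary ^ N)" using coprime_varx_vary by simp
  ultimately show "is_unit h" by (auto simp: coprime_def)
qed

lemma form_has_zero:
  assumes A: "homogeneous2 d A" and d: "d \<ge> 1"
  shows "\<exists>x y. (x \<noteq> 0 \<or> y \<noteq> 0) \<and> ev2 A x y = 0"
proof (cases "degree (dehom A) = d")
  case True
  then obtain t where "poly (dehom A) t = 0"
    using d fundamental_theorem_of_algebra[of "dehom A"] by (auto simp: constant_degree)
  then show ?thesis by (metis poly_dehom one_neq_zero)
next
  case False
  then have "coeff (dehom A) d = 0" using degree_dehom[OF A] by (intro coeff_eq_0) auto
  then have "ev2 A 1 0 = 0" using ev2_dehom[OF A] by (simp add: hom_eval_0)
  then show ?thesis by (metis one_neq_zero)
qed

text \<open>Restricted to the line through the origin and a point, both sides are polynomials in the parameter, and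
  A contributes the power d of the parameter, while the left side only has degree e.\<close>

lemma form_dvd_lower_degree:
  assumes A: "homogeneous2 d A" and C: "homogeneous2 e C" and "e < d" and "A dvd C"
  shows "C = 0"
proof (rule ev2_eqI)
  fix x y
  obtain q where q: "C = A * q" using \<open>A dvd C\<close> by (auto elim: dvdE)
  have "\<exists>Q. \<forall>c. poly Q c = ev2 q (c * x) (c * y)"
  proof (induction q)
    case 0
    show ?case by (intro exI[of _ 0]) simp
  next
    case (pCons p q)
    then obtain Q where Q: "\<And>c. poly Q c = ev2 q (c * x) (c * y)" by blast
    show ?case by (intro exI[of _ "pcompose p [:0, x:] + [:0, y:] * Q"]) (simp add: poly_pcompose Q)
  qed
  then obtain Q where Q: "\<And>c. poly Q c = ev2 q (c * x) (c * y)" by blast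
  have "[:ev2 C x y:] = monom (ev2 A x y) (d - e) * Q"
  proof (rule poly_eqI_infinite[of "UNIV - {0}"])
    show "infinite (UNIV - {0::complex})" by (simp add: infinite_UNIV_char_0)
    fix c :: complex assume "c \<in> UNIV - {0}"
    have "c ^ e * ev2 C x y = c ^ d * ev2 A x y * poly Q c"
      using homogeneous2_scale[OF C, of c x y, symmetric] homogeneous2_scale[OF A, of c x y] by (simp add: q Q)
    also have "c ^ d = c ^ e * c ^ (d - e)" using \<open>e < d\<close> by (simp flip: power_add)
    finally show "poly [:ev2 C x y:] c = poly (monom (ev2 A x y) (d - e) * Q) c"
      using \<open>c \<in> UNIV - {0}\<close> by (simp add: poly_monom mult_ac)
  qed
  from arg_cong[OF this, of "\<lambda>p. poly p 0"] show "ev2 C x y = ev2 0 x y"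
    using \<open>e < d\<close> by (simp add: poly_monom)
qed

text \<open>The forms \<open>x\<^sup>i y\<^sup>d\<^sup>-\<^sup>1\<^sup>-\<^sup>i\<close> are independent over the ring of forms in A and B. This is an induction on
  the degree of the coefficients: modulo A only the pure powers of B survive, and since A is coprime to B and
  cannot divide a nonzero form of degree less than d, their coefficients vanish; what is left is
  divisible by A.\<close>

lemma forms_independent:
  assumes A: "homogeneous2 d A" and cop: "coprime A B" and A0: "A \<noteq> 0"
  shows "(\<forall>i<d. homogeneous2 k (G i)) \<Longrightarrow>
    (\<Sum>i<d. subst2 (G i) B (- A) * varx ^ i * vary ^ (d - 1 - i)) = 0 \<Longrightarrow> \<forall>i<d. G i = 0"
proof (induction k arbitrary: G)
  case (0 G)
  have const: "G i = const2 (ev2 (G i) 0 0)" if "i < d" for i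
  proof (rule ev2_eqI)
    fix x y
    show "ev2 (G i) x y = ev2 (const2 (ev2 (G i) 0 0)) x y"
      using 0(1) that homogeneous2_scale[of 0 "G i" 0 x y] by simp
  qed
  define c where "c i = ev2 (G i) 0 0" for i
  define p where "p = (\<Sum>i<d. monom (c i) i)"
  have "poly p t = 0" for t
  proof -
    have "ev2 (G i) x y = c i" if "i < d" for i x y using const[OF that] by (metis c_def ev2_simps(8))
    then show ?thesis using arg_cong[OF 0(2), of "\<lambda>P. ev2 P t 1"] by (simp add: p_def poly_sum poly_monom)
  qed
  then have "p = 0" using poly_all_0_iff_0 by blast
  moreover have "coeff p i = c i" if "i < d" for i using that by (simp add: p_def coeff_sum)
  ultimately have "c i = 0" if "i < d" for i using that by (metis coeff_0)
  then show ?case using const by (metis c_def const2_def pCons_0_0)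
next
  case (Suc k G)
  define c where "c i = coeff (coeff (G i) 0) (Suc k)" for i
  define H where "H i = poly_shift 1 (G i)" for i
  have G: "G i = pCons (monom (c i) (Suc k)) (H i)" if "i < d" for i
  proof (rule poly_eqI)
    fix j show "coeff (G i) j = coeff (pCons (monom (c i) (Suc k)) (H i)) j"
    proof (cases j)
      case 0
      have "coeff (coeff (G i) 0) l = coeff (monom (c i) (Suc k)) l" for l
      proof (cases "l = Suc k")
        case False
        have "homogeneous2 (Suc k) (G i)" using Suc(2) that by blast
        then have "coeff (coeff (G i) 0) l = 0" using False unfolding homogeneous2_def by (metis add_0_right)
        then show ?thesis using False by simp
      qed (simp add: c_def)
      then show ?thesis using 0 by (simp add: poly_eq_iff)
    qed (simp add: H_def coeff_poly_shift)
  qed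
  have H: "homogeneous2 k (H i)" if "i < d" for i
    unfolding homogeneous2_def
  proof (intro allI impI)
    fix l j assume "coeff (coeff (H i) j) l \<noteq> 0"
    then have "coeff (coeff (G i) (Suc j)) l \<noteq> 0" by (simp add: H_def coeff_poly_shift)
    moreover have "homogeneous2 (Suc k) (G i)" using Suc(2) that by blast
    ultimately have "l + Suc j = Suc k" unfolding homogeneous2_def by blast
    then show "l + j = k" by simp
  qed
  define C where "C = (\<Sum>i<d. const2 (c i) * varx ^ i * vary ^ (d - 1 - i))"
  define R where "R = (\<Sum>i<d. subst2 (H i) B (- A) * varx ^ i * vary ^ (d - 1 - i))"
  have "(\<Sum>i<d. subst2 (G i) B (- A) * varx ^ i * vary ^ (d - 1 - i)) = B ^ Suc k * C - A * R"
  proof (rule ev2_eqI)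
    fix x y
    show "ev2 (\<Sum>i<d. subst2 (G i) B (- A) * varx ^ i * vary ^ (d - 1 - i)) x y = ev2 (B ^ Suc k * C - A * R) x y"
      by (simp add: C_def R_def G poly_monom sum_distrib_left sum_subtractf[symmetric] algebra_simps)
  qed
  then have eq: "B ^ Suc k * C = A * R" using Suc(3) by simp
  then have "A dvd B ^ Suc k * C" by simp
  moreover have "coprime A (B ^ Suc k)" using cop by simp
  ultimately have "A dvd C" by (simp add: coprime_dvd_mult_right_iff)
  moreover have "homogeneous2 (d - 1) C"
  proof -
    have "ev2 C (e * x) (e * y) = e ^ (d - 1) * ev2 C x y" for e x y
    proof -
      have "c i * (e * x) ^ i * (e * y) ^ (d - 1 - i) = e ^ (d - 1) * (c i * x ^ i * y ^ (d - 1 - i))"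
        if "i < d" for i
      proof -
        have "e ^ (d - 1) = e ^ i * e ^ (d - 1 - i)" using that by (simp flip: power_add)
        then show ?thesis by (simp only: power_mult_distrib mult_ac)
      qed
      then show ?thesis unfolding C_def ev2_sum ev2_simps sum_distrib_left by (intro sum.cong) auto
    qed
    then show ?thesis by (simp add: homogeneous2_iff)
  qed
  ultimately have C0: "C = 0"
    using form_dvd_lower_degree[OF A, of "d - 1" C] by (cases "d = 0") (auto simp: C_def)
  define p where "p = (\<Sum>i<d. monom (c i) i)"
  have "poly p t = 0" for t
    using arg_cong[OF C0, of "\<lambda>P. ev2 P t 1"] by (simp add: C_def p_def poly_sum poly_monom)
  then have "p = 0" using poly_all_0_iff_0 by blast
  moreover have "coeff p i = c i" if "i < d" for i using that by (simp add: p_def coeff_sum)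
  ultimately have c0: "c i = 0" if "i < d" for i using that by (metis coeff_0)
  have "R = 0" using eq C0 A0 by simp
  then have "\<forall>i<d. H i = 0" unfolding R_def by (intro Suc(1)) (use H in blast)
  then have "pCons (monom (c i) (Suc k)) (H i) = 0" if "i < d" for i using c0 that by simp
  then show ?case using G by metis
qed

section \<open>The field extension of the Gauss map\<close>

declare pullback_field.simps [simp del]

lemma to_fract_power: "to_fract (P ^ n) = to_fract P ^ n"
  by (induction n) auto

text \<open>Both fields of the extension have this form, for h the identity and for h the substitution of the
  components of the Gauss map.\<close>

lemma fraction_subfield:
  fixes h :: "cpoly3 \<Rightarrow> cpoly3"
  assumes h: "h 1 = 1" "\<And>P Q. h (P - Q) = h P - h Q" "\<And>P Q. h (P * Q) = h P * h Q"
  shows "is_subfield {Fract (h P) (h Q) | P Q n. homogeneous3 n P \<and> homogeneous3 n Q \<and> h Q \<noteq> 0}"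
    (is "is_subfield ?F")
proof -
  have h0: "h 0 = 0" using h(2)[of 0 0] by simp
  have one: "1 \<in> ?F"
  proof -
    have "1 = Fract (h 1) (h 1)" by (simp add: h One_fract_def)
    moreover have "homogeneous3 0 1" by (simp add: homogeneous3_iff)
    ultimately show ?thesis using h(1) by fastforce
  qed
  have "a - b \<in> ?F \<and> a * b \<in> ?F \<and> inverse a \<in> ?F" if "a \<in> ?F" "b \<in> ?F" for a b
  proof -
    from that(1) obtain P Q n where a: "a = Fract (h P) (h Q)" "homogeneous3 n P" "homogeneous3 n Q" "h Q \<noteq> 0" by blast
    from that(2) obtain R S m where b: "b = Fract (h R) (h S)" "homogeneous3 m R" "homogeneous3 m S" "h S \<noteq> 0" by blast
    have "a - b = Fract (h (P * S - R * Q)) (h (Q * S))" using a b h by simp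
    moreover have "a * b = Fract (h (P * R)) (h (Q * S))" using a b h by simp
    moreover have "homogeneous3 (n + m) (P * S - R * Q)" "homogeneous3 (n + m) (P * R)" "homogeneous3 (n + m) (Q * S)"
      using a b by (auto simp: homogeneous3_iff power_add algebra_simps)
    moreover have "h (Q * S) \<noteq> 0" using a b h by simp
    moreover have "inverse a \<in> ?F"
    proof (cases "h P = 0")
      case True
      then have "inverse a = Fract (h 0) (h 1)" by (simp add: a h h0 fract_collapse)
      moreover have "homogeneous3 0 1" "homogeneous3 0 0" by (auto simp: homogeneous3_iff)
      ultimately show ?thesis using h(1) by fastforce
    next
      case False
      then show ?thesis using a by auto
    qed
    ultimately show ?thesis by blast
  qed
  then show ?thesis using one by (auto simp: is_subfield_def)
qed

lemma subfield_function_field_P2: "is_subfield function_field_P2"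
  using fraction_subfield[of "\<lambda>P. P"] by (simp add: function_field_P2_def)

lemma cpoly3_as_sum:
  "P = (\<Sum>k\<le>degree P. \<Sum>j\<le>degree (coeff P k). \<Sum>i\<le>degree (coeff (coeff P k) j).
     const3 (coeff (coeff (coeff P k) j) i) * [:varx:] ^ i * [:vary:] ^ j * varz ^ k)"
proof (rule ev3_eqI)
  fix x y z :: complex
  have inner: "poly p x = (\<Sum>i\<le>degree p. coeff p i * x ^ i)" for p by (simp add: poly_altdef)
  have middle: "ev2 A x y = (\<Sum>j\<le>degree A. poly (coeff A j) x * y ^ j)" for A
    by (simp add: ev2_def poly_altdef[of A] poly_sum poly_power)
  have outer: "ev3 P x y z = (\<Sum>k\<le>degree P. ev2 (coeff P k) x y * z ^ k)"
    by (simp add: ev3_def poly_altdef[of P])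
  have "ev3 P x y z = (\<Sum>k\<le>degree P. \<Sum>j\<le>degree (coeff P k). \<Sum>i\<le>degree (coeff (coeff P k) j).
     coeff (coeff (coeff P k) j) i * x ^ i * y ^ j * z ^ k)"
    by (simp only: outer middle inner sum_distrib_right)
  then show "ev3 P x y z = ev3 (\<Sum>k\<le>degree P. \<Sum>j\<le>degree (coeff P k). \<Sum>i\<le>degree (coeff (coeff P k) j).
     const3 (coeff (coeff (coeff P k) j) i) * [:varx:] ^ i * [:vary:] ^ j * varz ^ k) x y z"
    by simp
qed

lemma ev3_as_sum:
  assumes "homogeneous3 n P"
  shows "ev3 P x y z = (\<Sum>k\<le>n. ev2 (coeff P k) x y * z ^ k)"
proof -
  have "ev3 P x y z = (\<Sum>k\<le>degree P. ev2 (coeff P k) x y * z ^ k)"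
    by (simp add: ev3_def poly_altdef[of P])
  also have "\<dots> = (\<Sum>k\<le>n. ev2 (coeff P k) x y * z ^ k)"
  proof (rule sum.mono_neutral_left)
    have "coeff P k = 0" if "k > n" for k
    proof (intro poly_eqI)
      fix j i
      have "i + j + k \<noteq> n" using that by simp
      then show "coeff (coeff (coeff P k) j) i = coeff (coeff 0 j) i"
        using assms unfolding homogeneous3_def by auto
    qed
    then show "{..degree P} \<subseteq> {..n}"
      by (meson atMost_subset_iff degree_le)
  qed (auto simp: coeff_eq_0)
  finally show ?thesis .
qed

lemma homogeneous3_coeff:
  assumes "homogeneous3 n P"
  shows "homogeneous2 (n - k) (coeff P k)"
  using assms unfolding homogeneous3_def homogeneous2_def by fastforce

lemma homogeneous3_unique:
  assumes "homogeneous3 m P" "homogeneous3 n P" "P \<noteq> 0"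
  shows "m = n"
proof -
  obtain x y z where xy: "ev3 P x y z \<noteq> 0" using ev3_nonzero[OF assms(3)] by blast
  have "2 ^ m * ev3 P x y z = 2 ^ n * ev3 P x y z"
    using assms(1,2) by (metis homogeneous3_scale)
  then show ?thesis using xy two_power_eq_iff by simp
qed

lemma homogeneous3_linear:
  assumes "homogeneous3 1 P"
  obtains \<alpha> \<beta> \<epsilon> where "\<And>x y z. ev3 P x y z = \<alpha> * x + \<beta> * y + \<epsilon> * z"
proof -
  have "ev3 P x y z = ev2 (coeff P 0) x y + ev2 (coeff P 1) x y * z" for x y z
    using ev3_as_sum[OF assms] by simp
  moreover have "ev2 (coeff P 0) x y = hom_eval 1 (dehom (coeff P 0)) x y" for x y
    by (rule ev2_dehom) (use homogeneous3_coeff[OF assms, of 0] in simp)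
  moreover have "ev2 (coeff P 1) x y = hom_eval 0 (dehom (coeff P 1)) x y" for x y
    by (rule ev2_dehom) (use homogeneous3_coeff[OF assms, of 1] in simp)
  ultimately have "ev3 P x y z = coeff (dehom (coeff P 0)) 1 * x + coeff (dehom (coeff P 0)) 0 * y
      + coeff (dehom (coeff P 1)) 0 * z" for x y z
    by (simp only: hom_eval_linear hom_eval_const) (simp add: algebra_simps)
  then show ?thesis using that by blast
qed

lemma is_unit_cpoly3: "is_unit P \<Longrightarrow> \<exists>c. c \<noteq> 0 \<and> P = const3 c"
  by (auto simp: is_unit_poly_iff const3_def const2_def)

text \<open>The last assumption excludes multiples of the radial field, whose Gauss map is constant along lines
  through the origin of the chart and has no field extension of finite degree.\<close>

locale homogeneous_pair =
  fixes d :: nat and A B :: cpoly2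
  assumes A: "homogeneous2 d A" and B: "homogeneous2 d B" and d: "d \<ge> 1"
    and nz: "no_common_zero (ev2 A) (ev2 B)" and D: "vary * A \<noteq> varx * B"
begin

abbreviation K :: "cpoly3 fract set" where "K \<equiv> pullback_field (projective_form (A, B))"
abbreviation L :: "cpoly3 fract set" where "L \<equiv> function_field_P2"

definition gauss_pullback :: "cpoly3 \<Rightarrow> cpoly3" where
  "gauss_pullback P = subst3 P (varz * [:B:]) (- (varz * [:A:])) [:vary * A - varx * B:]"

lemma ev3_gauss_pullback [simp]:
  "ev3 (gauss_pullback P) x y z = ev3 P (z * ev2 B x y) (- (z * ev2 A x y)) (y * ev2 A x y - x * ev2 B x y)"
  by (simp add: gauss_pullback_def mult.commute)

lemma gauss_pullback_hom: "gauss_pullback 1 = 1" "gauss_pullback (P - Q) = gauss_pullback P - gauss_pullback Q" "gauss_pullback (P * Q) = gauss_pullback P * gauss_pullback Q"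
  by (auto intro!: ev3_eqI)

lemma K_eq: "K = {Fract (gauss_pullback P) (gauss_pullback Q) | P Q n. homogeneous3 n P \<and> homogeneous3 n Q \<and> gauss_pullback Q \<noteq> 0}"
  by (simp add: gauss_pullback_def pullback_field.simps)

lemma subfield_K: "is_subfield K"
  unfolding K_eq by (rule fraction_subfield) (simp_all add: gauss_pullback_hom)

lemma homogeneous3_gauss_pullback: "homogeneous3 n P \<Longrightarrow> homogeneous3 ((d + 1) * n) (gauss_pullback P)"
  unfolding homogeneous3_iff
proof (intro allI)
  fix c x y z assume P: "\<forall>c x y z. ev3 P (c * x) (c * y) (c * z) = c ^ n * ev3 P x y z"
  have "ev3 (gauss_pullback P) (c * x) (c * y) (c * z) = ev3 P (c ^ (d + 1) * (z * ev2 B x y))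
      (c ^ (d + 1) * (- (z * ev2 A x y))) (c ^ (d + 1) * (y * ev2 A x y - x * ev2 B x y))"
  proof -
    have "c * z * ev2 B (c * x) (c * y) = c ^ (d + 1) * (z * ev2 B x y)"
      "- (c * z * ev2 A (c * x) (c * y)) = c ^ (d + 1) * (- (z * ev2 A x y))"
      "c * y * ev2 A (c * x) (c * y) - c * x * ev2 B (c * x) (c * y) = c ^ (d + 1) * (y * ev2 A x y - x * ev2 B x y)"
      by (simp_all add: homogeneous2_scale[OF A] homogeneous2_scale[OF B] algebra_simps)
    then show ?thesis by (simp only: ev3_gauss_pullback)
  qed
  then show "ev3 (gauss_pullback P) (c * x) (c * y) (c * z) = c ^ ((d + 1) * n) * ev3 (gauss_pullback P) x y z"
    using P by (simp only: power_mult ev3_gauss_pullback)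
qed

lemma K_subset_L: "K \<subseteq> L"
  unfolding K_eq function_field_P2_def using homogeneous3_gauss_pullback by blast

lemma A_nonzero: "A \<noteq> 0" and B_nonzero: "B \<noteq> 0"
proof -
  have "\<exists>x y. (x \<noteq> 0 \<or> y \<noteq> 0) \<and> ev2 A x y = 0" "\<exists>x y. (x \<noteq> 0 \<or> y \<noteq> 0) \<and> ev2 B x y = 0"
    using form_has_zero[OF A d] form_has_zero[OF B d] by auto
  then show "A \<noteq> 0" "B \<noteq> 0" using nz unfolding no_common_zero_def by (metis ev2_simps(1))+
qed

abbreviation cc :: "complex \<Rightarrow> cpoly3 fract" where "cc c \<equiv> to_fract (const3 c)"
abbreviation T :: "cpoly3 fract" where "T \<equiv> to_fract [:varx:] / to_fract [:vary:]"
abbreviation r :: "cpoly3 fract" where "r \<equiv> to_fract [:A:] / to_fract [:B:]"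

lemma var_nonzero [simp]: "varx \<noteq> 0" "vary \<noteq> 0" "varz \<noteq> 0"
  by (auto simp: varx_def vary_def varz_def)

lemma const3_hom: "const3 0 = 0" "const3 (a + b) = const3 a + const3 b" "const3 (a * b) = const3 a * const3 b"
  "const3 1 = 1"
  by (auto intro!: ev3_eqI)

lemma in_K: "homogeneous3 n P \<Longrightarrow> homogeneous3 n Q \<Longrightarrow> gauss_pullback Q \<noteq> 0 \<Longrightarrow> to_fract (gauss_pullback P) / to_fract (gauss_pullback Q) \<in> K"
  unfolding K_eq Fract_conv_to_fract by blast

lemma gauss_pullback_vars: "gauss_pullback [:varx:] = varz * [:B:]" "gauss_pullback [:vary:] = - (varz * [:A:])"
  "gauss_pullback varz = [:vary * A - varx * B:]" "gauss_pullback (const3 c) = const3 c"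
  by (auto intro!: ev3_eqI)

lemma homogeneous3_vars: "homogeneous3 1 [:varx:]" "homogeneous3 1 [:vary:]" "homogeneous3 1 varz"
  "homogeneous3 0 (const3 c)" "homogeneous3 0 1"
  by (auto simp: homogeneous3_iff)

lemma const_in_K: "cc c \<in> K"
  using in_K[of 0 "const3 c" 1] by (simp add: gauss_pullback_vars gauss_pullback_hom homogeneous3_vars)

lemma r_in_K: "r \<in> K"
proof -
  have "to_fract (gauss_pullback [:vary:]) / to_fract (gauss_pullback [:varx:]) \<in> K"
    by (rule in_K[of 1]) (auto simp: homogeneous3_vars[unfolded One_nat_def] gauss_pullback_vars B_nonzero)
  then have "- (to_fract (gauss_pullback [:vary:]) / to_fract (gauss_pullback [:varx:])) \<in> K"
    using subfield_closed[OF subfield_K] by blast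
  moreover have "- (to_fract (gauss_pullback [:vary:]) / to_fract (gauss_pullback [:varx:])) = r"
    unfolding gauss_pullback_vars to_fract_uminus to_fract_mult using B_nonzero by (simp del: to_fract_uminus to_fract_mult)
  ultimately show ?thesis by simp
qed

lemma T_in_L: "T \<in> L"
proof -
  have "T = Fract [:varx:] [:vary:]" by (simp add: Fract_conv_to_fract)
  moreover have "[:vary:] \<noteq> 0" by simp
  ultimately show ?thesis unfolding function_field_P2_def using homogeneous3_vars(1,2) by blast
qed

text \<open>The slope \<open>T = x/y\<close> generates L over K, and \<open>r = A/B\<close> is the quotient of two components of the Gauss
  map. So T is a root of \<open>A(t, 1) - r B(t, 1)\<close>, which turns out to have the least possible degree.\<close>

definition minpoly :: "cpoly3 fract poly" where
  "minpoly = map_poly cc (dehom A) - smult r (map_poly cc (dehom B))"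

lemma minpoly_over_K: "minpoly \<in> polys_over K"
  unfolding minpoly_def using const_in_K r_in_K
  by (intro polys_over_closed[OF subfield_K]) (auto simp: polys_over_def coeff_map_poly const3_hom)

text \<open>The third argument of the general substitution does not matter, since the form does not involve z.\<close>

definition subst23 :: "cpoly2 \<Rightarrow> cpoly3 \<Rightarrow> cpoly3 \<Rightarrow> cpoly3" where
  "subst23 P U V = subst3 [:P:] U V 0"

lemma ev3_subst23 [simp]: "ev3 (subst23 P U V) x y z = ev2 P (ev3 U x y z) (ev3 V x y z)"
  by (simp add: subst23_def)

lemma poly_const_fraction:
  assumes P: "homogeneous2 d P" and V: "V \<noteq> 0"
  shows "poly (map_poly cc (dehom P)) (to_fract U / to_fract V) * to_fract V ^ d = to_fract (subst23 P U V)"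
proof -
  have "subst23 P U V = (\<Sum>i\<le>d. const3 (coeff (dehom P) i) * U ^ i * V ^ (d - i))"
    by (rule ev3_eqI) (simp add: ev2_dehom[OF P] hom_eval_def)
  then have "to_fract (subst23 P U V) = (\<Sum>i\<le>d. cc (coeff (dehom P) i) * to_fract U ^ i * to_fract V ^ (d - i))"
    by (simp add: to_fract_power)
  also have "\<dots> = (\<Sum>i\<le>d. cc (coeff (dehom P) i) * (to_fract U / to_fract V) ^ i) * to_fract V ^ d"
    unfolding sum_distrib_right by (intro sum.cong refl) (use V in \<open>simp add: power_diff power_divide field_simps\<close>)
  also have "(\<Sum>i\<le>d. cc (coeff (dehom P) i) * (to_fract U / to_fract V) ^ i) = poly (map_poly cc (dehom P)) (to_fract U / to_fract V)"
  proof -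
    have "degree (map_poly cc (dehom P)) \<le> d"
      using degree_dehom[OF P] by (intro degree_le) (auto simp: coeff_map_poly const3_hom coeff_eq_0)
    then have "(\<Sum>i\<le>degree (map_poly cc (dehom P)). coeff (map_poly cc (dehom P)) i * t ^ i)
        = (\<Sum>i\<le>d. coeff (map_poly cc (dehom P)) i * t ^ i)" for t
      by (intro sum.mono_neutral_left) (auto simp: coeff_eq_0)
    then show ?thesis by (simp add: poly_altdef coeff_map_poly const3_hom)
  qed
  finally show ?thesis by simp
qed

text \<open>Multiplying by the power d of the denominator turns the values of the dehomogenizations into values of
  the forms.\<close>

lemma minpoly_root_iff:
  assumes "V \<noteq> 0"
  shows "poly minpoly (to_fract U / to_fract V) = 0 \<longleftrightarrow> [:B:] * subst23 A U V = [:A:] * subst23 B U V"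
proof -
  let ?t = "to_fract U / to_fract V"
  have "poly minpoly ?t = 0 \<longleftrightarrow> to_fract [:B:] * (poly minpoly ?t * to_fract V ^ d) = 0"
    using assms B_nonzero by simp
  also have "to_fract [:B:] * (poly minpoly ?t * to_fract V ^ d) =
      to_fract [:B:] * (poly (map_poly cc (dehom A)) ?t * to_fract V ^ d)
      - to_fract [:A:] * (poly (map_poly cc (dehom B)) ?t * to_fract V ^ d)"
    using B_nonzero by (simp add: minpoly_def algebra_simps)
  also have "\<dots> = to_fract ([:B:] * subst23 A U V - [:A:] * subst23 B U V)"
    unfolding poly_const_fraction[OF A assms] poly_const_fraction[OF B assms] to_fract_diff to_fract_mult ..
  finally show ?thesis by (simp only: to_fract_eq_0_iff right_minus_eq)
qed

lemma minpoly_T: "poly minpoly T = 0"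
proof -
  have "subst23 P [:varx:] [:vary:] = [:P:]" for P by (rule ev3_eqI) simp
  then show ?thesis using minpoly_root_iff[of "[:vary:]" "[:varx:]"] by (simp add: mult.commute)
qed

text \<open>If the leading coefficient vanished, A and B would be proportional, and then a zero of one of them would
  be a common zero.\<close>

lemma degree_minpoly: "degree minpoly = d"
proof (rule antisym)
  have "coeff minpoly i = 0" if "i > d" for i
    using that degree_dehom[OF A] degree_dehom[OF B]
    by (simp add: minpoly_def coeff_map_poly const3_hom coeff_eq_0)
  then show "degree minpoly \<le> d" using degree_le by blast
  let ?a = "coeff (dehom A) d" and ?b = "coeff (dehom B) d"
  have "coeff minpoly d \<noteq> 0"
  proof
    assume "coeff minpoly d = 0"
    then have "cc ?a * to_fract [:B:] = cc ?b * to_fract [:A:]"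
      using B_nonzero by (simp add: minpoly_def coeff_map_poly const3_hom field_simps)
    then have "to_fract (const3 ?a * [:B:]) = to_fract (const3 ?b * [:A:])"
      by (simp only: to_fract_mult)
    then have "const3 ?a * [:B:] = const3 ?b * [:A:]" by (simp only: to_fract_eq_iff)
    then have "ev3 (const3 ?a * [:B:]) x y 0 = ev3 (const3 ?b * [:A:]) x y 0" for x y by simp
    then have eq: "?a * ev2 B x y = ?b * ev2 A x y" for x y by (simp add: mult.commute)
    have "?a \<noteq> 0 \<or> ?b \<noteq> 0"
      using nz ev2_dehom[OF A, of 1 0] ev2_dehom[OF B, of 1 0] unfolding no_common_zero_def
      by (metis hom_eval_0 mult_zero_left one_neq_zero)
    moreover obtain x y where "x \<noteq> 0 \<or> y \<noteq> 0" "ev2 A x y = 0" using form_has_zero[OF A d] by blast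
    moreover obtain x' y' where "x' \<noteq> 0 \<or> y' \<noteq> 0" "ev2 B x' y' = 0" using form_has_zero[OF B d] by blast
    ultimately show False using nz eq unfolding no_common_zero_def by (metis mult_eq_0_iff mult_zero_right)
  qed
  then show "d \<le> degree minpoly" by (rule le_degree)
qed

lemma common_denominator:
  "(\<And>i. i < (n::nat) \<Longrightarrow> k i \<in> K) \<Longrightarrow> \<exists>N Q P. homogeneous3 N Q \<and> gauss_pullback Q \<noteq> 0 \<and>
    (\<forall>i<n. homogeneous3 N (P i) \<and> k i = to_fract (gauss_pullback (P i)) / to_fract (gauss_pullback Q))"
proof (induction n)
  case 0
  have "homogeneous3 0 1" "gauss_pullback 1 \<noteq> 0" by (simp_all add: gauss_pullback_hom homogeneous3_vars)
  then show ?case by blast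
next
  case (Suc n)
  then obtain N Q P where Q: "homogeneous3 N Q" "gauss_pullback Q \<noteq> 0"
    and P: "\<forall>i<n. homogeneous3 N (P i) \<and> k i = to_fract (gauss_pullback (P i)) / to_fract (gauss_pullback Q)"
    by (metis less_Suc_eq)
  obtain P' Q' N' where P': "k n = to_fract (gauss_pullback P') / to_fract (gauss_pullback Q')" "homogeneous3 N' P'"
      "homogeneous3 N' Q'" "gauss_pullback Q' \<noteq> 0"
    using Suc(2)[of n] unfolding K_eq Fract_conv_to_fract by blast
  define P2 where "P2 i = (if i = n then P' * Q else P i * Q')" for i
  have hm: "homogeneous3 (N + N') (U * V)" if "homogeneous3 N U" "homogeneous3 N' V" for U V
    using that by (simp add: homogeneous3_iff power_add)
  have "\<forall>i<Suc n. homogeneous3 (N + N') (P2 i) \<and> k i = to_fract (gauss_pullback (P2 i)) / to_fract (gauss_pullback (Q * Q'))"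
  proof (intro allI impI)
    fix i assume "i < Suc n"
    then consider "i = n" | "i < n" by linarith
    then show "homogeneous3 (N + N') (P2 i) \<and> k i = to_fract (gauss_pullback (P2 i)) / to_fract (gauss_pullback (Q * Q'))"
    proof cases
      case 1
      have "homogeneous3 (N + N') (P' * Q)" using hm[OF Q(1) P'(2)] by (simp add: mult.commute)
      then show ?thesis using 1 P' Q by (simp add: P2_def gauss_pullback_hom)
    next
      case 2
      then show ?thesis using P P' Q hm by (simp add: P2_def gauss_pullback_hom)
    qed
  qed
  moreover have "homogeneous3 (N + N') (Q * Q')" "gauss_pullback (Q * Q') \<noteq> 0"
    using Q P' hm by (auto simp: gauss_pullback_hom)
  ultimately show ?case by blast
qed

text \<open>Over a common denominator a relation between the powers of T becomes one between forms. The components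
  of the Gauss map are zB, -zA and a form without z; so the powers of z separate the powers of the third
  component, and what remains is the independence over the forms in A and B.\<close>

lemma minpoly_minimal:
  assumes p: "p \<in> polys_over K" "degree p < d" "poly p T = 0"
  shows "p = 0"
proof -
  obtain N Q P where Q: "homogeneous3 N Q" "gauss_pullback Q \<noteq> 0"
    and P: "\<And>i. i < d \<Longrightarrow> homogeneous3 N (P i)"
      "\<And>i. i < d \<Longrightarrow> coeff p i = to_fract (gauss_pullback (P i)) / to_fract (gauss_pullback Q)"
    using common_denominator[of d "coeff p"] polys_overD[OF p(1)] by blast
  let ?X = "to_fract [:varx:]" and ?Y = "to_fract [:vary:]"
  have "poly p T = (\<Sum>i<d. coeff p i * T ^ i)"
    unfolding poly_altdef by (rule sum.mono_neutral_left) (use p(2) in \<open>auto simp: coeff_eq_0\<close>)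
  then have "(\<Sum>i<d. to_fract (gauss_pullback (P i)) / to_fract (gauss_pullback Q) * T ^ i) = 0"
    using p(3) P(2) by simp
  then have e1: "(\<Sum>i<d. to_fract (gauss_pullback (P i)) / to_fract (gauss_pullback Q) * T ^ i) * (to_fract (gauss_pullback Q) * ?Y ^ (d - 1)) = 0"
    by (simp only: mult_zero_left)
  have e2: "(\<Sum>i<d. to_fract (gauss_pullback (P i)) / to_fract (gauss_pullback Q) * T ^ i) * (to_fract (gauss_pullback Q) * ?Y ^ (d - 1))
     = (\<Sum>i<d. to_fract (gauss_pullback (P i)) * ?X ^ i * ?Y ^ (d - 1 - i))"
    unfolding sum_distrib_right by (intro sum.cong refl) (use Q(2) in \<open>simp add: power_diff power_divide field_simps\<close>)
  have "to_fract (\<Sum>i<d. gauss_pullback (P i) * [:varx:] ^ i * [:vary:] ^ (d - 1 - i)) = 0"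
    using e1 unfolding e2 to_fract_sum to_fract_mult to_fract_power .
  then have sum0: "(\<Sum>i<d. gauss_pullback (P i) * [:varx:] ^ i * [:vary:] ^ (d - 1 - i)) = 0"
    by (simp only: to_fract_eq_0_iff)
  define H where "H k = (\<Sum>i<d. subst2 (coeff (P i) k) B (- A) * varx ^ i * vary ^ (d - 1 - i))" for k
  have "(vary * A - varx * B) ^ k * H k = 0" if "k \<le> N" for k
  proof (rule ev2_eqI)
    fix x y
    define D' where "D' = y * ev2 A x y - x * ev2 B x y"
    define q where "q = (\<Sum>k\<le>N. monom (D' ^ k * ev2 (H k) x y) (N - k))"
    have "poly q z = 0" for z
    proof -
      have "ev3 (gauss_pullback (P i)) x y z = (\<Sum>k\<le>N. z ^ (N - k) * D' ^ k * ev2 (coeff (P i) k) (ev2 B x y) (- ev2 A x y))"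
        if "i < d" for i
        unfolding ev3_gauss_pullback ev3_as_sum[OF P(1)[OF that]] D'_def[symmetric]
        using homogeneous2_scale[OF homogeneous3_coeff[OF P(1)[OF that]], where c = z and x = "ev2 B x y" and y = "- ev2 A x y"]
        by (intro sum.cong) (auto simp: mult_ac)
      then have "ev3 (\<Sum>i<d. gauss_pullback (P i) * [:varx:] ^ i * [:vary:] ^ (d - 1 - i)) x y z
          = (\<Sum>i<d. (\<Sum>k\<le>N. z ^ (N - k) * D' ^ k * ev2 (coeff (P i) k) (ev2 B x y) (- ev2 A x y)) * x ^ i * y ^ (d - 1 - i))"
        by simp
      also have "\<dots> = (\<Sum>k\<le>N. z ^ (N - k) * D' ^ k * ev2 (H k) x y)"
        unfolding sum_distrib_right by (subst sum.swap) (simp add: H_def sum_distrib_left mult_ac)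
      also have "\<dots> = poly q z" by (simp add: q_def poly_sum poly_monom mult_ac)
      finally have "ev3 0 x y z = poly q z" unfolding sum0 .
      then show ?thesis by simp
    qed
    then have "q = 0" using poly_all_0_iff_0 by blast
    then have "coeff q (N - k) = 0" by simp
    moreover have "coeff q (N - k) = D' ^ k * ev2 (H k) x y"
    proof -
      have "coeff q (N - k) = (\<Sum>l\<le>N. if l = k then D' ^ k * ev2 (H k) x y else 0)"
        unfolding q_def coeff_sum by (intro sum.cong) (use that in auto)
      then show ?thesis using that by simp
    qed
    ultimately show "ev2 ((vary * A - varx * B) ^ k * H k) x y = ev2 0 x y"
      by (simp add: D'_def)
  qed
  then have H0: "H k = 0" if "k \<le> N" for k using that D by auto
  have "coprime A B" by (rule no_common_zero_imp_coprime[OF A B nz])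
  then have "coeff (P i) k = 0" if "i < d" "k \<le> N" for i k
    using forms_independent[OF A _ A_nonzero, of B "N - k" "\<lambda>i. coeff (P i) k"] H0[OF that(2)]
      homogeneous3_coeff[OF P(1), of _ k] that by (auto simp: H_def)
  then have "ev3 (P i) x y z = 0" if "i < d" for i x y z using ev3_as_sum[OF P(1)[OF that]] that by simp
  then have "P i = 0" if "i < d" for i using that by (intro ev3_eqI) simp
  then have "coeff p i = 0" if "i < d" for i using P(2)[OF that] that gauss_pullback_hom(2)[of 0 0] by simp
  then show ?thesis using p(2) by (metis leading_coeff_0_iff)
qed

text \<open>The values of polynomials at T are a field because T is algebraic. It contains \<open>x/y\<close>, and also \<open>z/y\<close>,
  which is the quotient of \<open>r - T\<close> by the quotient of the third and the first component of the Gauss map. Every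
  quotient of forms of the same degree is a rational function of these two.\<close>

lemma L_generated:
  assumes a: "a \<in> L"
  shows "\<exists>p\<in>polys_over K. a = poly p T"
proof -
  define KT where "KT = {poly p T | p. p \<in> polys_over K}"
  note pK = polys_over_closed[OF subfield_K]
  have KT: "is_subfield KT"
    unfolding is_subfield_def
  proof (intro conjI ballI)
    show "1 \<in> KT" unfolding KT_def using pK(2) by (metis (mono_tags, lifting) mem_Collect_eq poly_1)
    fix a b assume "a \<in> KT" "b \<in> KT"
    then obtain p q where p: "p \<in> polys_over K" "a = poly p T" and q: "q \<in> polys_over K" "b = poly q T"
      by (auto simp: KT_def)
    have "a - b = poly (p - q) T" "a * b = poly (p * q) T" using p q by auto
    then show "a - b \<in> KT" "a * b \<in> KT" unfolding KT_def using pK(4,6)[OF p(1) q(1)] by blast+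
    show "inverse a \<in> KT"
    proof (cases "a = 0")
      case True then show ?thesis using pK(1) by (auto simp: KT_def intro!: exI[of _ 0])
    next
      case False
      have "minpoly \<noteq> 0" using degree_minpoly d by auto
      then have "\<exists>q\<in>polys_over K. poly q T = inverse (poly p T)"
        using False p minpoly_minimal degree_minpoly
        by (intro inverse_in_simple_extension[OF subfield_K minpoly_over_K minpoly_T]) auto
      then obtain q where "q \<in> polys_over K" "poly q T = inverse a" unfolding p(2) by blast
      then show ?thesis unfolding KT_def by (metis (mono_tags, lifting) mem_Collect_eq)
    qed
  qed
  note KTc = subfield_closed[OF KT]
  have K_KT: "c \<in> KT" if "c \<in> K" for c
    unfolding KT_def using that pK(1) by (intro CollectI exI[of _ "[:c:]"]) (simp add: pCons_polys_over)
  have T_KT: "T \<in> KT"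
    unfolding KT_def using subfield_closed(1,2)[OF subfield_K] pK(1)
    by (intro CollectI exI[of _ "[:0, 1:]"]) (simp add: pCons_polys_over)
  let ?y = "to_fract [:vary:]" and ?z = "to_fract varz" and ?D = "to_fract [:vary * A - varx * B:]"
  have s_KT: "?z / ?y \<in> KT"
  proof -
    have w: "to_fract (gauss_pullback varz) / to_fract (gauss_pullback [:varx:]) \<in> K"
      by (rule in_K[of 1]) (auto simp: homogeneous3_vars[unfolded One_nat_def] gauss_pullback_vars B_nonzero)
    have "(r - T) / (to_fract (gauss_pullback varz) / to_fract (gauss_pullback [:varx:])) \<in> KT"
      by (rule KTc(8)[OF KTc(5)[OF K_KT[OF r_in_K] T_KT] K_KT[OF w]])
    moreover have "(r - T) / (to_fract (gauss_pullback varz) / to_fract (gauss_pullback [:varx:])) = ?z / ?y"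
    proof -
      have D0: "?D \<noteq> 0" using D by simp
      have "[:vary * A - varx * B:] = [:vary:] * [:A:] - [:varx:] * [:B:]" by simp
      then have D_eq: "?D = ?y * to_fract [:A:] - to_fract [:varx:] * to_fract [:B:]"
        by (metis to_fract_diff to_fract_mult)
      have "r - T = ?D / (?y * to_fract [:B:])"
        unfolding D_eq using B_nonzero by (simp add: field_simps)
      then show ?thesis unfolding gauss_pullback_vars to_fract_mult using D0 B_nonzero by (simp add: field_simps)
    qed
    ultimately show ?thesis by simp
  qed
  have sum_KT: "(\<Sum>i\<in>I. f i) \<in> KT" if "\<And>i. i \<in> I \<Longrightarrow> f i \<in> KT" for I :: "nat set" and f
    using that by (induction I rule: infinite_finite_induct) (auto simp: KTc)
  have form_KT: "to_fract P / ?y ^ n \<in> KT" if P: "homogeneous3 n P" for P n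
  proof -
    have term_KT: "cc (coeff (coeff (coeff P k) j) i) * to_fract [:varx:] ^ i * ?y ^ j * ?z ^ k / ?y ^ n \<in> KT" for i j k
    proof (cases "coeff (coeff (coeff P k) j) i = 0")
      case True then show ?thesis using KTc(2) by (simp add: const3_hom)
    next
      case False
      then have n: "n = i + j + k" using P by (auto simp: homogeneous3_def)
      have "cc (coeff (coeff (coeff P k) j) i) * to_fract [:varx:] ^ i * ?y ^ j * ?z ^ k / ?y ^ n
          = cc (coeff (coeff (coeff P k) j) i) * T ^ i * (?z / ?y) ^ k"
        unfolding n by (simp add: power_add field_simps)
      also have "\<dots> \<in> KT" by (intro KTc(6,9) K_KT[OF const_in_K] T_KT s_KT)
      finally show ?thesis .
    qed
    have "to_fract P = (\<Sum>k\<le>degree P. \<Sum>j\<le>degree (coeff P k). \<Sum>i\<le>degree (coeff (coeff P k) j).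
       cc (coeff (coeff (coeff P k) j) i) * to_fract [:varx:] ^ i * ?y ^ j * ?z ^ k)"
      by (subst cpoly3_as_sum) (simp only: to_fract_sum to_fract_mult to_fract_power)
    then have "to_fract P / ?y ^ n = (\<Sum>k\<le>degree P. \<Sum>j\<le>degree (coeff P k). \<Sum>i\<le>degree (coeff (coeff P k) j).
       cc (coeff (coeff (coeff P k) j) i) * to_fract [:varx:] ^ i * ?y ^ j * ?z ^ k / ?y ^ n)"
      by (simp only: sum_divide_distrib)
    also have "\<dots> \<in> KT" by (intro sum_KT term_KT)
    finally show ?thesis .
  qed
  obtain P Q n where PQ: "a = Fract P Q" "homogeneous3 n P" "homogeneous3 n Q" "Q \<noteq> 0"
    using a by (auto simp: function_field_P2_def)
  have "a = (to_fract P / ?y ^ n) / (to_fract Q / ?y ^ n)" by (simp add: PQ Fract_conv_to_fract)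
  also have "\<dots> \<in> KT" by (rule KTc(8)[OF form_KT[OF PQ(2)] form_KT[OF PQ(3)]])
  finally show ?thesis by (auto simp: KT_def)
qed

end

section \<open>Conjugates of the generator and deck transformations\<close>

text \<open>A matrix \<open>(\<alpha>, \<beta>; \<gamma>, \<delta>)\<close>, listed by rows.\<close>

type_synonym moebius = "complex \<times> complex \<times> complex \<times> complex"

text \<open>The matrices of the Moebius transformations g with \<open>r \<circ> g = r\<close> for the rational function r = F/G: on the
  level of forms both members of the pair are multiplied by the same factor.\<close>

definition deck :: "(complex \<Rightarrow> complex \<Rightarrow> complex) \<Rightarrow> (complex \<Rightarrow> complex \<Rightarrow> complex) \<Rightarrow> moebius set" where
  "deck F G = {(\<alpha>, \<beta>, \<gamma>, \<delta>). \<alpha> * \<delta> - \<beta> * \<gamma> \<noteq> 0 \<and>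
     (\<exists>u. \<forall>x y. F (\<alpha> * x + \<beta> * y) (\<gamma> * x + \<delta> * y) = u * F x y \<and>
               G (\<alpha> * x + \<beta> * y) (\<gamma> * x + \<delta> * y) = u * G x y)}"

fun same_moebius :: "moebius \<Rightarrow> moebius \<Rightarrow> bool" where
  "same_moebius (\<alpha>, \<beta>, \<gamma>, \<delta>) (\<alpha>', \<beta>', \<gamma>', \<delta>') \<longleftrightarrow>
     (\<forall>x y. (\<alpha> * x + \<beta> * y) * (\<gamma>' * x + \<delta>' * y) = (\<gamma> * x + \<delta> * y) * (\<alpha>' * x + \<beta>' * y))"

text \<open>Scalar multiples of a matrix give the same Moebius transformation, so that transformations are counted by
  representatives.\<close>

definition many_deck :: "nat \<Rightarrow> (complex \<Rightarrow> complex \<Rightarrow> complex) \<Rightarrow> (complex \<Rightarrow> complex \<Rightarrow> complex) \<Rightarrow> bool" where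
  "many_deck d F G \<longleftrightarrow> (\<exists>S\<subseteq>deck F G. finite S \<and> card S = d \<and> (\<forall>g\<in>S. \<forall>h\<in>S. same_moebius g h \<longrightarrow> g = h))"

lemma scale3_mult: "scale3 c (P * Q) = scale3 c P * scale3 c Q"
  by (rule ev3_eqI) (simp add: ev3_scale3)

lemma scale3_inverse: "scale3 (1/2) (scale3 2 P) = P" "scale3 2 (scale3 (1/2) P) = P"
  by (rule ev3_eqI, simp add: ev3_scale3)+

lemma scale3_dvd: "P dvd Q \<Longrightarrow> scale3 c P dvd scale3 c Q"
  by (auto simp: scale3_mult elim!: dvdE)

lemma coprime_scale3:
  assumes "coprime P Q"
  shows "coprime (scale3 2 P) (scale3 2 Q)"
proof (rule coprimeI)
  fix h assume "h dvd scale3 2 P" "h dvd scale3 2 Q"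
  then have "scale3 (1/2) h dvd P" "scale3 (1/2) h dvd Q" using scale3_dvd scale3_inverse(1) by metis+
  then have "scale3 (1/2) h dvd 1" using assms by (auto simp: coprime_def)
  then have "scale3 2 (scale3 (1/2) h) dvd scale3 2 1" by (rule scale3_dvd)
  moreover have "scale3 2 1 = 1" by (rule ev3_eqI) (simp add: ev3_scale3)
  ultimately show "is_unit h" by (simp add: scale3_inverse)
qed

lemma scale3_eq_multiple_imp_homogeneous:
  assumes "scale3 2 P = const3 k * P" "P \<noteq> 0"
  shows "\<exists>n. k = 2 ^ n \<and> homogeneous3 n P"
proof -
  have c: "2 ^ (i + j + l) * coeff (coeff (coeff P l) j) i = k * coeff (coeff (coeff P l) j) i" for i j l
    using arg_cong[OF assms(1), of "\<lambda>P. coeff (coeff (coeff P l) j) i"]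
    by (simp add: coeff_scale3 const3_def const2_def)
  obtain i j l where "coeff (coeff (coeff P l) j) i \<noteq> 0" using assms(2) by (metis leading_coeff_neq_0)
  then have "k = 2 ^ (i + j + l)" using c by (metis mult_right_cancel)
  moreover from this have "homogeneous3 (i + j + l) P"
    unfolding homogeneous3_def using c by (metis mult_right_cancel two_power_eq_iff)
  ultimately show ?thesis by blast
qed

lemma homogeneous3_if_scale:
  assumes "scale3 2 P = const3 (2 ^ n) * P"
  shows "homogeneous3 n P"
proof -
  have c: "2 ^ (i + j + l) * coeff (coeff (coeff P l) j) i = 2 ^ n * coeff (coeff (coeff P l) j) i" for i j l
    using arg_cong[OF assms(1), of "\<lambda>P. coeff (coeff (coeff P l) j) i"]
    by (simp add: coeff_scale3 const3_def const2_def)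
  then show ?thesis unfolding homogeneous3_def by (metis mult_right_cancel two_power_eq_iff)
qed

text \<open>In lowest terms the numerator and the denominator of a quotient of forms are again forms: scaling the
  variables by 2 gives another reduced fraction for the same quotient, so it multiplies both by a unit.\<close>

lemma coprime_homogeneous_fraction:
  assumes "a \<in> function_field_P2"
  obtains U V n where "coprime U V" "V \<noteq> 0" "homogeneous3 n U" "homogeneous3 n V" "a = to_fract U / to_fract V"
proof -
  obtain P Q n where PQ: "a = Fract P Q" "homogeneous3 n P" "homogeneous3 n Q" "Q \<noteq> 0"
    using assms by (auto simp: function_field_P2_def)
  define U V where "U = P div gcd P Q" and "V = Q div gcd P Q"
  have UV: "P = gcd P Q * U" "Q = gcd P Q * V" by (simp_all add: U_def V_def)
  have cop: "coprime U V" unfolding U_def V_def using PQ(4) by (intro div_gcd_coprime) auto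
  have g0: "gcd P Q \<noteq> 0" using PQ(4) by simp
  have V0: "V \<noteq> 0" using UV PQ(4) by auto
  have a: "a = to_fract U / to_fract V"
  proof -
    have "to_fract P = to_fract (gcd P Q) * to_fract U" "to_fract Q = to_fract (gcd P Q) * to_fract V"
      using UV by (metis to_fract_mult)+
    moreover have "to_fract (gcd P Q) \<noteq> 0" using g0 by (simp only: to_fract_eq_0_iff not_False_eq_True)
    ultimately show ?thesis unfolding PQ(1) Fract_conv_to_fract by (metis nonzero_mult_divide_mult_cancel_left)
  qed
  have PV: "P * V = U * Q" using UV by (metis mult.assoc mult.commute)
  have "scale3 2 P * V = U * scale3 2 Q"
  proof -
    have "scale3 2 P = const3 (2 ^ n) * P" "scale3 2 Q = const3 (2 ^ n) * Q"
      using PQ(2,3) by (auto intro!: ev3_eqI simp: ev3_scale3 homogeneous3_scale)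
    then show ?thesis using PV by (metis mult.assoc mult.left_commute)
  qed
  moreover have "scale3 2 P * scale3 2 V = scale3 2 U * scale3 2 Q" using PV by (metis scale3_mult)
  moreover have "scale3 2 Q \<noteq> 0"
    using PQ(4) scale3_inverse(1)[of Q] ev3_eqI[of "scale3 (1/2) 0" 0] by (auto simp: ev3_scale3)
  ultimately have Q0: "scale3 2 Q \<noteq> 0" and e: "scale3 2 P * V = U * scale3 2 Q"
      "scale3 2 P * scale3 2 V = scale3 2 U * scale3 2 Q" by auto
  have "scale3 2 Q * (scale3 2 U * V) = (scale3 2 U * scale3 2 Q) * V" by (simp only: mult_ac)
  also have "\<dots> = (scale3 2 P * V) * scale3 2 V" unfolding e(2)[symmetric] by (simp only: mult_ac)
  also have "\<dots> = scale3 2 Q * (U * scale3 2 V)" unfolding e(1) by (simp only: mult_ac)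
  finally have eq: "scale3 2 U * V = U * scale3 2 V" using Q0 by (metis mult_left_cancel)
  have "V dvd U * scale3 2 V" by (simp flip: eq)
  moreover have "coprime V U" using cop by (simp add: coprime_commute)
  ultimately have 1: "V dvd scale3 2 V" by (simp add: coprime_dvd_mult_right_iff)
  have "scale3 2 V dvd scale3 2 U * V" by (simp add: eq)
  moreover have "coprime (scale3 2 V) (scale3 2 U)" using coprime_scale3[OF cop] by (simp add: coprime_commute)
  ultimately have "scale3 2 V dvd V" by (simp add: coprime_dvd_mult_right_iff)
  with 1 obtain e where "is_unit e" "scale3 2 V = e * V"
    by (metis associated_unit dvdE dvd_mult_cancel_right mult_1 V0 mult.commute dvd_times_right_cancel_iff)
  then obtain k where k: "scale3 2 V = const3 k * V" using is_unit_cpoly3 by blast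
  then obtain m where m: "k = 2 ^ m" "homogeneous3 m V" using scale3_eq_multiple_imp_homogeneous[OF k V0] by blast
  have "scale3 2 U * V = const3 k * U * V" using eq k by (simp add: mult_ac)
  then have "scale3 2 U = const3 (2 ^ m) * U" using V0 m by simp
  then have "homogeneous3 m U" by (rule homogeneous3_if_scale)
  then show ?thesis using that cop V0 m a by blast
qed

context homogeneous_pair
begin

definition linform :: "complex \<Rightarrow> complex \<Rightarrow> cpoly3" where
  "linform \<alpha> \<beta> = [:const2 \<alpha> * varx + const2 \<beta> * vary:]"

lemma ev3_linform [simp]: "ev3 (linform \<alpha> \<beta>) x y z = \<alpha> * x + \<beta> * y"
  by (simp add: linform_def)

text \<open>A conjugate of the generator is U/V with U and V coprime forms of the same degree. The forms A and B
  generate powers of x and y, so that A(U,V) and B(U,V) are coprime as well, and being proportional to A and B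
  they are constant multiples of them; comparing degrees makes U and V linear.\<close>

lemma root_in_L:
  assumes \<theta>: "\<theta> \<in> L" "poly minpoly \<theta> = 0"
  shows "\<exists>\<alpha> \<beta> \<gamma> \<delta>. (\<alpha>, \<beta>, \<gamma>, \<delta>) \<in> deck (ev2 A) (ev2 B) \<and>
    linform \<gamma> \<delta> \<noteq> 0 \<and> \<theta> = to_fract (linform \<alpha> \<beta>) / to_fract (linform \<gamma> \<delta>)"
proof -
  obtain U V n where UV: "coprime U V" "V \<noteq> 0" "homogeneous3 n U" "homogeneous3 n V"
    and \<theta>UV: "\<theta> = to_fract U / to_fract V"
    using coprime_homogeneous_fraction[OF \<theta>(1)] by blast
  define A' B' where "A' = subst23 A U V" and "B' = subst23 B U V"
  have eq: "[:B:] * A' = [:A:] * B'"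
    using minpoly_root_iff[OF UV(2), of U] \<theta>(2) by (simp add: \<theta>UV A'_def B'_def)
  obtain N u v N' u' v' where bez: "vary ^ N = u * A + v * B" "varx ^ N' = u' * A + v' * B"
    by (rule powers_in_ideal[OF A B nz])
  have "V ^ N = subst23 u U V * A' + subst23 v U V * B'"
    by (rule ev3_eqI) (use arg_cong[OF bez(1), of "\<lambda>P. ev2 P _ _"] in \<open>simp add: A'_def B'_def\<close>)
  moreover have "U ^ N' = subst23 u' U V * A' + subst23 v' U V * B'"
    by (rule ev3_eqI) (use arg_cong[OF bez(2), of "\<lambda>P. ev2 P _ _"] in \<open>simp add: A'_def B'_def\<close>)
  ultimately have dvds: "h dvd V ^ N" "h dvd U ^ N'" if "h dvd A'" "h dvd B'" for h using that by auto
  have cop': "coprime A' B'"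
  proof (rule coprimeI)
    fix h assume "h dvd A'" "h dvd B'"
    moreover have "coprime (U ^ N') (V ^ N)" using UV(1) by simp
    ultimately show "is_unit h" using dvds by (auto simp: coprime_def)
  qed
  have cop: "coprime [:A:] [:B:]"
  proof (rule coprimeI)
    fix h assume h: "h dvd [:A:]" "h dvd [:B:]"
    have "degree h \<le> degree [:A:]" by (rule dvd_imp_degree_le[OF h(1)]) (simp add: A_nonzero)
    then obtain p where p: "h = [:p:]" by (auto elim: degree_eq_zeroE)
    then have "p dvd A" "p dvd B" using h by (simp_all add: const_poly_dvd_const_poly_iff)
    then show "is_unit h"
      using no_common_zero_imp_coprime[OF A B nz] by (simp add: p is_unit_const_poly_iff coprime_def)
  qed
  have "A' dvd [:A:] * B'" using eq by (metis dvd_triv_right)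
  then have 1: "A' dvd [:A:]" using coprime_dvd_mult_left_iff[OF cop'] by blast
  have "[:A:] dvd [:B:] * A'" using eq by (metis dvd_triv_left)
  then have 2: "[:A:] dvd A'" using coprime_dvd_mult_right_iff[OF cop] by blast
  obtain e where "is_unit e" "A' = e * [:A:]"
    using 1 2 A_nonzero by (metis dvdE dvd_times_right_cancel_iff mult.commute mult_1 pCons_eq_0_iff)
  then obtain c where c: "A' = const3 c * [:A:]" "c \<noteq> 0" using is_unit_cpoly3 by blast
  have "[:A:] * B' = [:A:] * (const3 c * [:B:])" using eq c(1) by (simp only: mult_ac)
  moreover have "[:A:] \<noteq> 0" using A_nonzero by simp
  ultimately have B': "B' = const3 c * [:B:]" using mult_left_cancel by blast
  have inv: "ev2 A (ev3 U x y z) (ev3 V x y z) = c * ev2 A x y"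
    "ev2 B (ev3 U x y z) (ev3 V x y z) = c * ev2 B x y" for x y z
    using arg_cong[OF c(1), of "\<lambda>P. ev3 P x y z"] arg_cong[OF B', of "\<lambda>P. ev3 P x y z"]
    by (simp_all add: A'_def B'_def mult.commute)
  have "n = 1"
  proof -
    have "homogeneous3 (n * d) A'"
      using UV(3,4) by (simp add: homogeneous3_iff A'_def homogeneous2_scale[OF A] power_mult)
    moreover have "homogeneous3 d A'"
      unfolding c by (simp add: homogeneous3_iff homogeneous2_scale[OF A])
    moreover have "A' \<noteq> 0" using c A_nonzero const3_hom by (simp add: const3_def const2_def)
    ultimately have "n * d = d" by (rule homogeneous3_unique)
    then show ?thesis using d by simp
  qed
  obtain \<alpha> \<beta> \<epsilon> where U: "\<And>x y z. ev3 U x y z = \<alpha> * x + \<beta> * y + \<epsilon> * z"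
    using homogeneous3_linear UV(3) unfolding \<open>n = 1\<close> by blast
  obtain \<gamma> \<delta> \<zeta> where V: "\<And>x y z. ev3 V x y z = \<gamma> * x + \<delta> * y + \<zeta> * z"
    using homogeneous3_linear UV(4) unfolding \<open>n = 1\<close> by blast
  have A00: "ev2 A 0 0 = 0" "ev2 B 0 0 = 0"
    using homogeneous2_scale[OF A, of 0 0 0] homogeneous2_scale[OF B, of 0 0 0] d
    by (simp_all add: zero_power)
  have "\<epsilon> = 0 \<and> \<zeta> = 0"
  proof -
    have "ev2 A \<epsilon> \<zeta> = 0" "ev2 B \<epsilon> \<zeta> = 0" using inv[of 0 0 1] A00 by (simp_all add: U V)
    then show ?thesis using nz unfolding no_common_zero_def by blast
  qed
  then have UV': "U = linform \<alpha> \<beta>" "V = linform \<gamma> \<delta>" using U V by (auto intro!: ev3_eqI)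
  have "\<alpha> * \<delta> - \<beta> * \<gamma> \<noteq> 0"
  proof
    assume det: "\<alpha> * \<delta> - \<beta> * \<gamma> = 0"
    have "c * ev2 A x y = 0 \<and> c * ev2 B x y = 0" if "\<alpha> * x + \<beta> * y = 0" "\<gamma> * x + \<delta> * y = 0" for x y
      using inv[of x y 0] that A00 by (simp add: UV')
    then have z: "x = 0 \<and> y = 0" if "\<alpha> * x + \<beta> * y = 0" "\<gamma> * x + \<delta> * y = 0" for x y
      using that c(2) nz unfolding no_common_zero_def by (metis mult_eq_0_iff)
    have "\<beta> = 0 \<and> \<alpha> = 0" using z[of \<beta> "- \<alpha>"] det by (simp add: algebra_simps)
    moreover have "\<delta> = 0 \<and> \<gamma> = 0" using z[of \<delta> "- \<gamma>"] det by (simp add: algebra_simps)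
    ultimately show False using z[of 1 1] by simp
  qed
  then have "(\<alpha>, \<beta>, \<gamma>, \<delta>) \<in> deck (ev2 A) (ev2 B)"
    using inv by (auto simp: deck_def UV')
  then show ?thesis using UV(2) \<theta>UV UV' by blast
qed

lemma linform_same_moebius:
  assumes "linform \<gamma> \<delta> \<noteq> 0" "linform \<gamma>' \<delta>' \<noteq> 0"
  shows "to_fract (linform \<alpha> \<beta>) / to_fract (linform \<gamma> \<delta>) = to_fract (linform \<alpha>' \<beta>') / to_fract (linform \<gamma>' \<delta>')
    \<longleftrightarrow> same_moebius (\<alpha>, \<beta>, \<gamma>, \<delta>) (\<alpha>', \<beta>', \<gamma>', \<delta>')"
proof -
  have "to_fract (linform \<alpha> \<beta>) / to_fract (linform \<gamma> \<delta>) = to_fract (linform \<alpha>' \<beta>') / to_fract (linform \<gamma>' \<delta>')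
    \<longleftrightarrow> to_fract (linform \<alpha> \<beta> * linform \<gamma>' \<delta>') = to_fract (linform \<gamma> \<delta> * linform \<alpha>' \<beta>')"
    using assms by (simp add: frac_eq_eq mult.commute)
  also have "\<dots> \<longleftrightarrow> linform \<alpha> \<beta> * linform \<gamma>' \<delta>' = linform \<gamma> \<delta> * linform \<alpha>' \<beta>'"
    by (rule to_fract_eq_iff)
  also have "\<dots> \<longleftrightarrow> (\<forall>x y z. ev3 (linform \<alpha> \<beta> * linform \<gamma>' \<delta>') x y z = ev3 (linform \<gamma> \<delta> * linform \<alpha>' \<beta>') x y z)"
    using ev3_eqI by metis
  finally show ?thesis by simp
qed

lemma linform_nonzero: "\<alpha> * \<delta> - \<beta> * \<gamma> \<noteq> 0 \<Longrightarrow> linform \<gamma> \<delta> \<noteq> 0"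
proof
  assume det: "\<alpha> * \<delta> - \<beta> * \<gamma> \<noteq> 0" and "linform \<gamma> \<delta> = 0"
  then have "ev3 (linform \<gamma> \<delta>) x y 0 = 0" for x y by simp
  from this[of 1 0] this[of 0 1] show False using det by simp
qed

text \<open>The conjugates of T in L are the fractions \<open>(\<alpha> x + \<beta> y)/(\<gamma> x + \<delta> y)\<close> that belong to the deck
  transformations, and the extension has degree d.\<close>

theorem galois_iff_many_deck:
  "galois_foliation (projective_form (A, B)) \<longleftrightarrow> many_deck d (ev2 A) (ev2 B)"
proof
  assume "galois_foliation (projective_form (A, B))"
  then have gal: "galois_extension K L" by (simp add: galois_foliation_def)
  have mp0: "minpoly \<noteq> 0" using degree_minpoly d by auto
  let ?R = "(\<lambda>\<sigma>. \<sigma> T) ` field_automorphisms K L"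
  note conj = galois_imp_many_conjugates[OF subfield_function_field_P2 T_in_L minpoly_over_K mp0 minpoly_T minpoly_minimal gal]
  have root: "\<theta> \<in> L \<and> poly minpoly \<theta> = 0" if "\<theta> \<in> ?R" for \<theta>
  proof -
    from that obtain \<sigma> where \<sigma>: "\<sigma> \<in> field_automorphisms K L" "\<theta> = \<sigma> T" by (rule imageE)
    have "poly minpoly (\<sigma> T) = \<sigma> (poly minpoly T)"
      by (rule poly_automorphism[OF \<sigma>(1) subfield_function_field_P2 K_subset_L minpoly_over_K T_in_L, symmetric])
    also have "\<dots> = 0" unfolding minpoly_T by (rule automorphism_zero[OF \<sigma>(1) subfield_function_field_P2])
    finally show ?thesis unfolding \<sigma>(2) using field_automorphismD(2)[OF \<sigma>(1) T_in_L] by blast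
  qed
  define Q where "Q \<theta> g \<longleftrightarrow> g \<in> deck (ev2 A) (ev2 B) \<and>
      (case g of (\<alpha>, \<beta>, \<gamma>, \<delta>) \<Rightarrow> linform \<gamma> \<delta> \<noteq> 0 \<and> \<theta> = to_fract (linform \<alpha> \<beta>) / to_fract (linform \<gamma> \<delta>))"
    for \<theta> g
  have "\<exists>g. Q \<theta> g" if "\<theta> \<in> ?R" for \<theta>
    using root_in_L[of \<theta>] root[OF that] unfolding Q_def by auto
  then obtain f where f: "\<And>\<theta>. \<theta> \<in> ?R \<Longrightarrow> Q \<theta> (f \<theta>)"
    using bchoice[of ?R Q] by blast
  obtain R where R: "R \<subseteq> ?R" "card R = d" "finite R"
    using conj(2) obtain_subset_with_card_n[of d ?R] by metis
  have fR: "Q \<theta> (f \<theta>)" if "\<theta> \<in> R" for \<theta> using f R(1) that by blast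
  have inj: "\<theta> = \<theta>'" if "\<theta> \<in> R" "\<theta>' \<in> R" "same_moebius (f \<theta>) (f \<theta>')" for \<theta> \<theta>'
    using fR[OF that(1)] fR[OF that(2)] that(3) linform_same_moebius unfolding Q_def
    by (cases "f \<theta>", cases "f \<theta>'") (auto simp del: same_moebius.simps)
  have refl: "same_moebius g g" for g by (cases g) (simp add: mult.commute)
  have "inj_on f R" using inj refl by (metis inj_onI)
  then show "many_deck d (ev2 A) (ev2 B)"
    unfolding many_deck_def using fR[unfolded Q_def] R(2,3) inj
    by (intro exI[of _ "f ` R"]) (auto simp: card_image)
next
  assume "many_deck d (ev2 A) (ev2 B)"
  then obtain S where S: "S \<subseteq> deck (ev2 A) (ev2 B)" "finite S" "card S = d"
      "\<And>g h. g \<in> S \<Longrightarrow> h \<in> S \<Longrightarrow> same_moebius g h \<Longrightarrow> g = h"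
    unfolding many_deck_def by blast
  define f where "f = (\<lambda>(\<alpha>, \<beta>, \<gamma>, \<delta>). to_fract (linform \<alpha> \<beta>) / to_fract (linform \<gamma> \<delta>))"
  have inj: "inj_on f S"
  proof (rule inj_onI)
    fix g h assume gh: "g \<in> S" "h \<in> S" "f g = f h"
    obtain \<alpha> \<beta> \<gamma> \<delta> \<alpha>' \<beta>' \<gamma>' \<delta>' where g: "g = (\<alpha>, \<beta>, \<gamma>, \<delta>)" and h: "h = (\<alpha>', \<beta>', \<gamma>', \<delta>')"
      by (metis prod_cases4)
    have "\<alpha> * \<delta> - \<beta> * \<gamma> \<noteq> 0" "\<alpha>' * \<delta>' - \<beta>' * \<gamma>' \<noteq> 0" using S(1) gh unfolding g h by (auto simp: deck_def)
    then have "same_moebius g h"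
      using linform_same_moebius[OF linform_nonzero linform_nonzero] gh(3) unfolding g h f_def split_conv by blast
    then show "g = h" using S(4) gh by blast
  qed
  have root: "f g \<in> L \<and> poly minpoly (f g) = 0" if "g \<in> S" for g
  proof -
    obtain \<alpha> \<beta> \<gamma> \<delta> where g: "g = (\<alpha>, \<beta>, \<gamma>, \<delta>)" by (metis prod_cases4)
    have gd: "(\<alpha>, \<beta>, \<gamma>, \<delta>) \<in> deck (ev2 A) (ev2 B)" using S(1) that unfolding g by blast
    then have det: "\<alpha> * \<delta> - \<beta> * \<gamma> \<noteq> 0" by (simp add: deck_def)
    obtain u where u: "\<And>x y. ev2 A (\<alpha> * x + \<beta> * y) (\<gamma> * x + \<delta> * y) = u * ev2 A x y"
      "\<And>x y. ev2 B (\<alpha> * x + \<beta> * y) (\<gamma> * x + \<delta> * y) = u * ev2 B x y"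
      using gd by (auto simp: deck_def)
    have fg: "f g = to_fract (linform \<alpha> \<beta>) / to_fract (linform \<gamma> \<delta>)" by (simp add: f_def g)
    have hl: "homogeneous3 1 (linform a b)" for a b by (simp add: homogeneous3_iff algebra_simps)
    have "f g = Fract (linform \<alpha> \<beta>) (linform \<gamma> \<delta>)" by (simp add: fg Fract_conv_to_fract)
    then have "f g \<in> L" unfolding function_field_P2_def using hl linform_nonzero[OF det] by blast
    moreover have "poly minpoly (f g) = 0"
      unfolding fg minpoly_root_iff[OF linform_nonzero[OF det]]
    proof (rule ev3_eqI)
      fix x y z
      have "ev2 B x y * (u * ev2 A x y) = ev2 A x y * (u * ev2 B x y)" by simp
      then show "ev3 ([:B:] * subst23 A (linform \<alpha> \<beta>) (linform \<gamma> \<delta>)) x y z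
          = ev3 ([:A:] * subst23 B (linform \<alpha> \<beta>) (linform \<gamma> \<delta>)) x y z"
        by (simp add: u)
    qed
    ultimately show ?thesis by blast
  qed
  have "galois_extension K L"
  proof (rule galois_if_many_conjugates[OF subfield_K subfield_function_field_P2 K_subset_L T_in_L minpoly_over_K minpoly_T])
    show "degree minpoly > 0" using degree_minpoly d by simp
    show "p = 0" if "p \<in> polys_over K" "degree p < degree minpoly" "poly p T = 0" for p
      using minpoly_minimal that unfolding degree_minpoly by blast
    show "\<exists>p\<in>polys_over K. a = poly p T" if "a \<in> L" for a by (rule L_generated[OF that])
    show "f ` S \<subseteq> L" using root by blast
    show "poly minpoly \<rho> = 0" if "\<rho> \<in> f ` S" for \<rho> using root that by blast
    show "degree minpoly \<le> card (f ` S)" using card_image[OF inj] S(3) degree_minpoly by simp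
  qed
  then show "galois_foliation (projective_form (A, B))" by (simp add: galois_foliation_def)
qed

end

section \<open>Moebius transformations and the left-right action\<close>

text \<open>The two homogeneous coordinates of the image of the point (x : y).\<close>

fun m1 :: "moebius \<Rightarrow> complex \<Rightarrow> complex \<Rightarrow> complex" where
  "m1 (\<alpha>, \<beta>, \<gamma>, \<delta>) x y = \<alpha> * x + \<beta> * y"

fun m2 :: "moebius \<Rightarrow> complex \<Rightarrow> complex \<Rightarrow> complex" where
  "m2 (\<alpha>, \<beta>, \<gamma>, \<delta>) x y = \<gamma> * x + \<delta> * y"

fun mdet :: "moebius \<Rightarrow> complex" where
  "mdet (\<alpha>, \<beta>, \<gamma>, \<delta>) = \<alpha> * \<delta> - \<beta> * \<gamma>"

fun mmult :: "moebius \<Rightarrow> moebius \<Rightarrow> moebius" where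
  "mmult (\<alpha>, \<beta>, \<gamma>, \<delta>) (\<alpha>', \<beta>', \<gamma>', \<delta>') =
     (\<alpha> * \<alpha>' + \<beta> * \<gamma>', \<alpha> * \<beta>' + \<beta> * \<delta>', \<gamma> * \<alpha>' + \<delta> * \<gamma>', \<gamma> * \<beta>' + \<delta> * \<delta>')"

fun minv :: "moebius \<Rightarrow> moebius" where
  "minv (\<alpha>, \<beta>, \<gamma>, \<delta>) = (let D = \<alpha> * \<delta> - \<beta> * \<gamma> in (\<delta> / D, - \<beta> / D, - \<gamma> / D, \<alpha> / D))"

lemma mmult_apply: "m1 (mmult g h) x y = m1 g (m1 h x y) (m2 h x y)"
  "m2 (mmult g h) x y = m2 g (m1 h x y) (m2 h x y)"
  by (cases g; cases h; simp add: algebra_simps)+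

lemma mdet_mmult: "mdet (mmult g h) = mdet g * mdet h"
  by (cases g; cases h; simp add: algebra_simps)

lemma minv_apply:
  assumes "mdet g \<noteq> 0"
  shows "m1 g (m1 (minv g) x y) (m2 (minv g) x y) = x" "m2 g (m1 (minv g) x y) (m2 (minv g) x y) = y"
    "m1 (minv g) (m1 g x y) (m2 g x y) = x" "m2 (minv g) (m1 g x y) (m2 g x y) = y"
proof -
  obtain a b c e where g: "g = (a, b, c, e)" by (metis prod_cases4)
  define D where "D = a * e - b * c"
  have D: "D \<noteq> 0" using assms by (simp add: g D_def)
  have "a * (e * x / D - b * y / D) + b * (a * y / D - c * x / D) = (a * e - b * c) * x / D"
    "c * (e * x / D - b * y / D) + e * (a * y / D - c * x / D) = (a * e - b * c) * y / D"
    "e * (a * x + b * y) / D - b * (c * x + e * y) / D = (a * e - b * c) * x / D"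
    "a * (c * x + e * y) / D - c * (a * x + b * y) / D = (a * e - b * c) * y / D"
    using D by (simp_all add: field_simps)
  then show "m1 g (m1 (minv g) x y) (m2 (minv g) x y) = x" "m2 g (m1 (minv g) x y) (m2 (minv g) x y) = y"
    "m1 (minv g) (m1 g x y) (m2 g x y) = x" "m2 (minv g) (m1 g x y) (m2 g x y) = y"
    using D by (simp_all add: g Let_def flip: D_def)
qed

lemma mdet_minv: "mdet g \<noteq> 0 \<Longrightarrow> mdet (minv g) \<noteq> 0"
proof -
  assume "mdet g \<noteq> 0"
  moreover obtain a b c e where g: "g = (a, b, c, e)" by (metis prod_cases4)
  ultimately have D: "a * e - b * c \<noteq> 0" by simp
  have "mdet (minv g) = (a * e - b * c) / ((a * e - b * c) * (a * e - b * c))"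
    by (simp add: g Let_def diff_divide_distrib mult.commute)
  then show ?thesis using D by simp
qed

lemma m_linear: "m1 g (c * x) (c * y) = c * m1 g x y" "m2 g (c * x) (c * y) = c * m2 g x y"
  by (cases g; simp add: algebra_simps)+

lemma m_zero: "mdet g \<noteq> 0 \<Longrightarrow> m1 g x y = 0 \<Longrightarrow> m2 g x y = 0 \<Longrightarrow> x = 0 \<and> y = 0"
proof -
  assume g: "mdet g \<noteq> 0" and z: "m1 g x y = 0" "m2 g x y = 0"
  have "m1 (minv g) 0 0 = 0" "m2 (minv g) 0 0 = 0" using m_linear[of "minv g" 0 0 0] by simp_all
  then show ?thesis using minv_apply(3,4)[OF g, of x y] unfolding z by metis
qed

lemma same_moebius_iff: "same_moebius g h \<longleftrightarrow> (\<forall>x y. m1 g x y * m2 h x y = m2 g x y * m1 h x y)"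
  by (cases g; cases h) simp

lemma deck_iff: "g \<in> deck F G \<longleftrightarrow> mdet g \<noteq> 0 \<and>
    (\<exists>u. \<forall>x y. F (m1 g x y) (m2 g x y) = u * F x y \<and> G (m1 g x y) (m2 g x y) = u * G x y)"
  by (cases g) (simp add: deck_def)

lemma deck_mmult: "g \<in> deck F G \<Longrightarrow> h \<in> deck F G \<Longrightarrow> mmult g h \<in> deck F G"
proof -
  assume g: "g \<in> deck F G" and h: "h \<in> deck F G"
  obtain u where u: "\<And>x y. F (m1 g x y) (m2 g x y) = u * F x y" "\<And>x y. G (m1 g x y) (m2 g x y) = u * G x y"
    using g unfolding deck_iff by blast
  obtain v where v: "\<And>x y. F (m1 h x y) (m2 h x y) = v * F x y" "\<And>x y. G (m1 h x y) (m2 h x y) = v * G x y"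
    using h unfolding deck_iff by blast
  show ?thesis
    using g h unfolding deck_iff
    by (intro conjI exI[of _ "u * v"] allI) (auto simp: mmult_apply mdet_mmult u v simp del: mmult.simps)
qed

subsection \<open>Left-right equivalence\<close>

text \<open>The left-right action with invertible matrices instead of matrices of determinant 1, and on functions
  instead of polynomials.\<close>

definition lr_equiv where
  "lr_equiv F G F' G' \<longleftrightarrow> (\<exists>a b. mdet a \<noteq> 0 \<and> mdet b \<noteq> 0 \<and>
     (\<forall>x y. F' x y = m1 b (F (m1 a x y) (m2 a x y)) (G (m1 a x y) (m2 a x y)) \<and>
            G' x y = m2 b (F (m1 a x y) (m2 a x y)) (G (m1 a x y) (m2 a x y))))"

lemma lr_equivI:
  assumes "mdet a \<noteq> 0" "mdet b \<noteq> 0"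
    "\<And>x y. F' x y = m1 b (F (m1 a x y) (m2 a x y)) (G (m1 a x y) (m2 a x y))"
    "\<And>x y. G' x y = m2 b (F (m1 a x y) (m2 a x y)) (G (m1 a x y) (m2 a x y))"
  shows "lr_equiv F G F' G'"
  using assms unfolding lr_equiv_def by blast

lemma lr_equiv_trans:
  assumes "lr_equiv F G F' G'" "lr_equiv F' G' F'' G''"
  shows "lr_equiv F G F'' G''"
proof -
  from assms(1) obtain a b where ab: "mdet a \<noteq> 0" "mdet b \<noteq> 0"
    "\<And>x y. F' x y = m1 b (F (m1 a x y) (m2 a x y)) (G (m1 a x y) (m2 a x y))"
    "\<And>x y. G' x y = m2 b (F (m1 a x y) (m2 a x y)) (G (m1 a x y) (m2 a x y))"
    unfolding lr_equiv_def by blast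
  from assms(2) obtain a' b' where ab': "mdet a' \<noteq> 0" "mdet b' \<noteq> 0"
    "\<And>x y. F'' x y = m1 b' (F' (m1 a' x y) (m2 a' x y)) (G' (m1 a' x y) (m2 a' x y))"
    "\<And>x y. G'' x y = m2 b' (F' (m1 a' x y) (m2 a' x y)) (G' (m1 a' x y) (m2 a' x y))"
    unfolding lr_equiv_def by blast
  show ?thesis
    by (rule lr_equivI[of "mmult a a'" "mmult b' b"])
       (simp_all add: ab ab' mdet_mmult mmult_apply del: mmult.simps)
qed

lemma lr_equiv_sym:
  assumes "lr_equiv F G F' G'"
  shows "lr_equiv F' G' F G"
proof -
  from assms obtain a b where ab: "mdet a \<noteq> 0" "mdet b \<noteq> 0"
    "\<And>x y. F' x y = m1 b (F (m1 a x y) (m2 a x y)) (G (m1 a x y) (m2 a x y))"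
    "\<And>x y. G' x y = m2 b (F (m1 a x y) (m2 a x y)) (G (m1 a x y) (m2 a x y))"
    unfolding lr_equiv_def by blast
  show ?thesis
    by (rule lr_equivI[of "minv a" "minv b"]) (simp_all add: ab mdet_minv minv_apply)
qed

lemma lr_equiv_no_common_zero:
  assumes "lr_equiv F G F' G'" "no_common_zero F G"
  shows "no_common_zero F' G'"
  using assms m_zero unfolding lr_equiv_def no_common_zero_def by metis

lemma lr_equiv_many_deck:
  assumes "lr_equiv F G F' G'" "many_deck d F G"
  shows "many_deck d F' G'"
proof -
  from assms(1) obtain a b where ab: "mdet a \<noteq> 0" "mdet b \<noteq> 0"
    "\<And>x y. F' x y = m1 b (F (m1 a x y) (m2 a x y)) (G (m1 a x y) (m2 a x y))"
    "\<And>x y. G' x y = m2 b (F (m1 a x y) (m2 a x y)) (G (m1 a x y) (m2 a x y))"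
    unfolding lr_equiv_def by blast
  from assms(2) obtain S where S: "S \<subseteq> deck F G" "finite S" "card S = d"
    "\<And>g h. g \<in> S \<Longrightarrow> h \<in> S \<Longrightarrow> same_moebius g h \<Longrightarrow> g = h"
    unfolding many_deck_def by blast
  define f where "f g = mmult (minv a) (mmult g a)" for g
  have same: "same_moebius g h" if "same_moebius (f g) (f h)" for g h
  proof -
    have "m1 g x y * m2 h x y = m2 g x y * m1 h x y" for x y
    proof -
      obtain p q r s where a': "minv a = (p, q, r, s)" by (metis prod_cases4)
      let ?x = "m1 (minv a) x y" and ?y = "m2 (minv a) x y"
      have "m1 (f g) ?x ?y * m2 (f h) ?x ?y = m2 (f g) ?x ?y * m1 (f h) ?x ?y"
        using that unfolding same_moebius_iff by blast
      then have "m1 (minv a) (m1 g x y) (m2 g x y) * m2 (minv a) (m1 h x y) (m2 h x y)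
          = m2 (minv a) (m1 g x y) (m2 g x y) * m1 (minv a) (m1 h x y) (m2 h x y)"
        by (simp add: f_def mmult_apply minv_apply[OF ab(1)] del: minv.simps)
      then have "(p * s - q * r) * (m1 g x y * m2 h x y - m2 g x y * m1 h x y) = 0"
        unfolding a' by (simp add: algebra_simps)
      moreover have "p * s - q * r \<noteq> 0" using mdet_minv[OF ab(1)] by (simp add: a')
      ultimately show ?thesis by simp
    qed
    then show ?thesis unfolding same_moebius_iff by blast
  qed
  have refl: "same_moebius g g" for g by (simp add: same_moebius_iff mult.commute)
  have inj: "inj_on f S" using same S(4) refl by (metis inj_onI)
  have "f ` S \<subseteq> deck F' G'"
  proof (rule image_subsetI)
    fix g assume "g \<in> S"
    then have g: "g \<in> deck F G" using S(1) by blast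
    then obtain u where u: "\<And>x y. F (m1 g x y) (m2 g x y) = u * F x y" "\<And>x y. G (m1 g x y) (m2 g x y) = u * G x y"
      and g0: "mdet g \<noteq> 0"
      unfolding deck_iff by blast
    show "f g \<in> deck F' G'" unfolding deck_iff
      by (intro conjI exI[of _ u] allI)
         (simp_all add: f_def mdet_mmult mmult_apply ab mdet_minv g0 minv_apply u m_linear del: minv.simps mmult.simps)
  qed
  moreover have "\<forall>g\<in>f ` S. \<forall>h\<in>f ` S. same_moebius g h \<longrightarrow> g = h" using same S(4) by blast
  ultimately show ?thesis
    unfolding many_deck_def using S(2,3) card_image[OF inj] by blast
qed

definition mat2 :: "moebius \<Rightarrow> complex^2^2" where
  "mat2 g = (case g of (\<alpha>, \<beta>, \<gamma>, \<delta>) \<Rightarrow> vector [vector [\<alpha>, \<beta>], vector [\<gamma>, \<delta>]])"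

definition entries :: "complex^2^2 \<Rightarrow> moebius" where
  "entries M = (M$1$1, M$1$2, M$2$1, M$2$2)"

lemma entries_mat2: "entries (mat2 g) = g"
  by (cases g) (simp add: entries_def mat2_def)

lemma mdet_entries: "mdet (entries M) = det M"
  by (simp add: entries_def det_2)

lemma ev2_left_right_act:
  assumes "left_right_act \<alpha> \<beta> (A, B) = (A', B')"
  shows "ev2 A' x y = m1 (entries \<beta>) (ev2 A (m1 (entries \<alpha>) x y) (m2 (entries \<alpha>) x y))
      (ev2 B (m1 (entries \<alpha>) x y) (m2 (entries \<alpha>) x y))"
    "ev2 B' x y = m2 (entries \<beta>) (ev2 A (m1 (entries \<alpha>) x y) (m2 (entries \<alpha>) x y))
      (ev2 B (m1 (entries \<alpha>) x y) (m2 (entries \<alpha>) x y))"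
  using assms by (auto simp: entries_def)

fun mscale :: "complex \<Rightarrow> moebius \<Rightarrow> moebius" where
  "mscale c (\<alpha>, \<beta>, \<gamma>, \<delta>) = (c * \<alpha>, c * \<beta>, c * \<gamma>, c * \<delta>)"

lemma mscale_apply: "m1 (mscale c g) x y = c * m1 g x y" "m2 (mscale c g) x y = c * m2 g x y"
  "mdet (mscale c g) = c\<^sup>2 * mdet g"
  by (cases g; simp add: algebra_simps power2_eq_square)+

lemma square_root_scaling:
  assumes "mdet g \<noteq> 0"
  obtains s h where "s \<noteq> 0" "mdet h = 1" "g = mscale s h"
proof -
  define s where "s = csqrt (mdet g)"
  have s: "s\<^sup>2 = mdet g" "s \<noteq> 0" using assms by (auto simp: s_def)
  have "mdet (mscale (1 / s) g) = 1" using s assms by (simp add: mscale_apply power_divide)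
  moreover have "g = mscale s (mscale (1 / s) g)" using s by (cases g) simp
  ultimately show ?thesis using that s by blast
qed

text \<open>The square root of the determinant normalizes a matrix. The scalar that is split off multiplies both
  forms by a constant, on the right because they have the same degree, and this is absorbed in the class of the pair.\<close>

lemma orbit_iff_lr_equiv:
  assumes A0: "homogeneous2 d A0" and B0: "homogeneous2 d B0"
  shows "(A, B) \<in> left_right_orbit (A0, B0) \<longleftrightarrow> lr_equiv (ev2 A0) (ev2 B0) (ev2 A) (ev2 B)"
proof
  assume "(A, B) \<in> left_right_orbit (A0, B0)"
  then obtain \<alpha> \<beta> where SL: "\<alpha> \<in> SL2" "\<beta> \<in> SL2"
      and cls: "same_class (left_right_act \<alpha> \<beta> (A0, B0)) (A, B)"
    unfolding left_right_orbit_def by blast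
  obtain A1 B1 where act: "left_right_act \<alpha> \<beta> (A0, B0) = (A1, B1)" by (metis surj_pair)
  note \<alpha>\<beta> = SL act
  obtain c where c: "c \<noteq> 0" "A = const2 c * A1" "B = const2 c * B1" using cls unfolding act by auto
  note ev = ev2_left_right_act[OF \<alpha>\<beta>(3)]
  show "lr_equiv (ev2 A0) (ev2 B0) (ev2 A) (ev2 B)"
  proof (rule lr_equivI[of "entries \<alpha>" "mscale c (entries \<beta>)"])
    show "mdet (entries \<alpha>) \<noteq> 0" "mdet (mscale c (entries \<beta>)) \<noteq> 0"
      using \<alpha>\<beta>(1,2) c(1) by (simp_all add: SL2_def mdet_entries mscale_apply)
  qed (simp_all add: c ev mscale_apply)
next
  assume "lr_equiv (ev2 A0) (ev2 B0) (ev2 A) (ev2 B)"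
  then obtain a b where ab: "mdet a \<noteq> 0" "mdet b \<noteq> 0"
    "\<And>x y. ev2 A x y = m1 b (ev2 A0 (m1 a x y) (m2 a x y)) (ev2 B0 (m1 a x y) (m2 a x y))"
    "\<And>x y. ev2 B x y = m2 b (ev2 A0 (m1 a x y) (m2 a x y)) (ev2 B0 (m1 a x y) (m2 a x y))"
    unfolding lr_equiv_def by blast
  obtain s a' where s: "s \<noteq> 0" "mdet a' = 1" "a = mscale s a'" by (rule square_root_scaling[OF ab(1)])
  obtain t b' where t: "t \<noteq> 0" "mdet b' = 1" "b = mscale t b'" by (rule square_root_scaling[OF ab(2)])
  define \<alpha> \<beta> where "\<alpha> = mat2 a'" and "\<beta> = mat2 b'"
  have \<alpha>\<beta>: "entries \<alpha> = a'" "entries \<beta> = b'" by (simp_all add: \<alpha>_def \<beta>_def entries_mat2)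
  then have SL: "\<alpha> \<in> SL2" "\<beta> \<in> SL2" using s(2) t(2) by (simp_all add: SL2_def flip: mdet_entries)
  obtain A1 B1 where act: "left_right_act \<alpha> \<beta> (A0, B0) = (A1, B1)" by (metis surj_pair)
  note ev = ev2_left_right_act[OF act, unfolded \<alpha>\<beta>]
  have "A = const2 (t * s ^ d) * A1" "B = const2 (t * s ^ d) * B1"
    by (rule ev2_eqI, simp add: ab(3,4) s(3) t(3) mscale_apply homogeneous2_scale[OF A0] homogeneous2_scale[OF B0] m_linear ev)+
  then have "same_class (left_right_act \<alpha> \<beta> (A0, B0)) (A, B)"
    unfolding act using s(1) t(1) by (auto intro!: exI[of _ "t * s ^ d"])
  then show "(A, B) \<in> left_right_orbit (A0, B0)" unfolding left_right_orbit_def using SL by blast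
qed

lemma homogeneous_if_lr_equiv:
  assumes "homogeneous2 d A0" "homogeneous2 d B0" "lr_equiv (ev2 A0) (ev2 B0) (ev2 A) (ev2 B)"
  shows "homogeneous2 d A" "homogeneous2 d B"
proof -
  from assms(3) obtain a b where ab: "mdet a \<noteq> 0" "mdet b \<noteq> 0"
    "\<And>x y. ev2 A x y = m1 b (ev2 A0 (m1 a x y) (m2 a x y)) (ev2 B0 (m1 a x y) (m2 a x y))"
    "\<And>x y. ev2 B x y = m2 b (ev2 A0 (m1 a x y) (m2 a x y)) (ev2 B0 (m1 a x y) (m2 a x y))"
    unfolding lr_equiv_def by blast
  show "homogeneous2 d A" "homogeneous2 d B"
    by (simp_all add: homogeneous2_iff ab m_linear homogeneous2_scale[OF assms(1)] homogeneous2_scale[OF assms(2)])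
qed

text \<open>A common factor of the three coefficients does not involve z, because it divides the nonzero form
  yA - xB; so it divides A and B. If yA = xB, the common factor is z.\<close>

lemma homogeneous_foliation_iff:
  assumes d: "d \<ge> 1"
  shows "homogeneous_foliation d (A, B) \<longleftrightarrow>
    homogeneous2 d A \<and> homogeneous2 d B \<and> no_common_zero (ev2 A) (ev2 B) \<and> vary * A \<noteq> varx * B"
proof
  assume h: "homogeneous_foliation d (A, B)"
  then have AB: "homogeneous2 d A" "homogeneous2 d B" "coprime A B" by auto
  have "vary * A \<noteq> varx * B"
  proof
    assume "vary * A = varx * B"
    then have "varz dvd [:vary * A - varx * B:]" by simp
    moreover have "varz dvd varz * [:B:]" "varz dvd - (varz * [:A:])" by (rule dvd_triv_left, simp only: dvd_minus_iff dvd_triv_left)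
    ultimately have "is_unit varz" using h by auto
    then show False by (auto simp: varz_def is_unit_poly_iff)
  qed
  then show "homogeneous2 d A \<and> homogeneous2 d B \<and> no_common_zero (ev2 A) (ev2 B) \<and> vary * A \<noteq> varx * B"
    using AB coprime_imp_no_common_zero[OF AB(1,2) d AB(3)] by blast
next
  assume h: "homogeneous2 d A \<and> homogeneous2 d B \<and> no_common_zero (ev2 A) (ev2 B) \<and> vary * A \<noteq> varx * B"
  then have A: "homogeneous2 d A" and B: "homogeneous2 d B" and cop: "coprime A B"
    using no_common_zero_imp_coprime by blast+
  have "homogeneous3 (d + 1) (varz * [:B:])" "homogeneous3 (d + 1) (- (varz * [:A:]))"
    "homogeneous3 (d + 1) [:vary * A - varx * B:]"
    unfolding homogeneous3_iff ev3_simps ev2_simps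
    by (simp_all add: homogeneous2_scale[OF A] homogeneous2_scale[OF B] algebra_simps)
  moreover have "[:varx:] * (varz * [:B:]) + [:vary:] * - (varz * [:A:]) + varz * [:vary * A - varx * B:] = 0"
    by (rule ev3_eqI) (simp only: ev3_simps ev2_simps, simp add: algebra_simps)
  moreover have "is_unit p" if p: "p dvd varz * [:B:]" "p dvd - (varz * [:A:])" "p dvd [:vary * A - varx * B:]" for p
  proof -
    have "degree p \<le> degree [:vary * A - varx * B:]" by (rule dvd_imp_degree_le[OF p(3)]) (use h in simp)
    then obtain q where q: "p = [:q:]" by (auto elim: degree_eq_zeroE)
    have "q dvd coeff (varz * [:B:]) 1" "q dvd coeff (varz * [:A:]) 1"
      using p(1,2) unfolding q by (simp_all add: const_poly_dvd_iff del: mult_pCons_right)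
    then have "q dvd B" "q dvd A" by (simp_all add: varz_def)
    then show ?thesis using cop by (simp add: q is_unit_const_poly_iff coprime_def)
  qed
  ultimately show "homogeneous_foliation d (A, B)" using A B cop
    unfolding homogeneous_foliation.simps projective_form.simps P2_foliation.simps by blast
qed

theorem foliation_galois_iff:
  assumes d: "d \<ge> 1"
  shows "homogeneous_foliation d (A, B) \<and> galois_foliation (projective_form (A, B)) \<longleftrightarrow>
    vary * A \<noteq> varx * B \<and> homogeneous2 d A \<and> homogeneous2 d B \<and> no_common_zero (ev2 A) (ev2 B) \<and>
    many_deck d (ev2 A) (ev2 B)"
proof -
  have "galois_foliation (projective_form (A, B)) \<longleftrightarrow> many_deck d (ev2 A) (ev2 B)"
    if "homogeneous2 d A" "homogeneous2 d B" "no_common_zero (ev2 A) (ev2 B)" "vary * A \<noteq> varx * B"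
  proof -
    interpret homogeneous_pair d A B by unfold_locales (use that d in auto)
    show ?thesis by (rule galois_iff_many_deck)
  qed
  then show ?thesis using homogeneous_foliation_iff[OF d] by blast
qed

section \<open>Normalization and ramification\<close>

definition is_form :: "nat \<Rightarrow> (complex \<Rightarrow> complex \<Rightarrow> complex) \<Rightarrow> bool" where
  "is_form n F \<longleftrightarrow> (\<exists>p. degree p \<le> n \<and> F = hom_eval n p)"

lemma is_form_ev2: "homogeneous2 n A \<Longrightarrow> is_form n (ev2 A)"
  unfolding is_form_def using degree_dehom ev2_dehom by (metis ext)

lemma is_formE:
  assumes "is_form n F"
  obtains A where "homogeneous2 n A" "F = ev2 A"
  using assms homogeneous2_homogenize ev2_homogenize unfolding is_form_def by (metis ext)

lemma is_form_linear_change: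
  assumes F: "is_form n F" and G: "is_form n G"
  shows "is_form n (\<lambda>x y. m1 b (F (m1 a x y) (m2 a x y)) (G (m1 a x y) (m2 a x y)))" (is "is_form n ?F'")
    "is_form n (\<lambda>x y. m2 b (F (m1 a x y) (m2 a x y)) (G (m1 a x y) (m2 a x y)))" (is "is_form n ?G'")
proof -
  obtain A B where AB: "homogeneous2 n A" "F = ev2 A" "homogeneous2 n B" "G = ev2 B"
    using is_formE F G by metis
  obtain a1 a2 a3 a4 where a: "a = (a1, a2, a3, a4)" by (metis prod_cases4)
  obtain b1 b2 b3 b4 where b: "b = (b1, b2, b3, b4)" by (metis prod_cases4)
  let ?s = "\<lambda>P. subst2 P (const2 a1 * varx + const2 a2 * vary) (const2 a3 * varx + const2 a4 * vary)"
  have ev: "?F' = ev2 (const2 b1 * ?s A + const2 b2 * ?s B)" "?G' = ev2 (const2 b3 * ?s A + const2 b4 * ?s B)"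
    by (intro ext, simp add: AB a b)+
  have lin: "a1 * (c * x) + a2 * (c * y) = c * (a1 * x + a2 * y)"
    "a3 * (c * x) + a4 * (c * y) = c * (a3 * x + a4 * y)" for c x y by (simp_all add: algebra_simps)
  have "homogeneous2 n (const2 c * ?s A + const2 e * ?s B)" for c e
    unfolding homogeneous2_iff ev2_simps ev2_subst2 lin homogeneous2_scale[OF AB(1)] homogeneous2_scale[OF AB(3)]
    by (simp add: algebra_simps)
  then show "is_form n ?F'" "is_form n ?G'" unfolding ev using is_form_ev2 by blast+
qed

subsection \<open>Generic points\<close>

lemma finite_same_value:
  assumes "\<not> same_moebius g h"
  shows "finite {t. m1 g t 1 * m2 h t 1 = m2 g t 1 * m1 h t 1}"
proof -
  obtain a b c e where g: "g = (a, b, c, e)" by (metis prod_cases4)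
  obtain a' b' c' e' where h: "h = (a', b', c', e')" by (metis prod_cases4)
  let ?p = "[:b * e' - e * b', a * e' + b * c' - c * b' - e * a', a * c' - c * a':]"
  have "?p \<noteq> 0"
  proof
    assume "?p = 0"
    then have z: "b * e' - e * b' = 0" "a * e' + b * c' - c * b' - e * a' = 0" "a * c' - c * a' = 0" by auto
    have "(a * x + b * y) * (c' * x + e' * y) - (c * x + e * y) * (a' * x + b' * y)
        = (a * c' - c * a') * x\<^sup>2 + (a * e' + b * c' - c * b' - e * a') * x * y + (b * e' - e * b') * y\<^sup>2" for x y
      by (simp add: algebra_simps power2_eq_square)
    then have "same_moebius g h" unfolding g h same_moebius.simps using z by (metis add_0 eq_iff_diff_eq_0 mult_zero_left)
    then show False using assms by blast
  qed
  then have "finite {t. poly ?p t = 0}" by (rule poly_roots_finite)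
  moreover have "{t. m1 g t 1 * m2 h t 1 = m2 g t 1 * m1 h t 1} \<subseteq> {t. poly ?p t = 0}"
    by (auto simp: g h algebra_simps)
  ultimately show ?thesis by (rule finite_subset[rotated])
qed

lemma finite_pole:
  assumes "mdet g \<noteq> 0"
  shows "finite {t. m2 g t 1 = 0}"
proof -
  obtain a b c e where g: "g = (a, b, c, e)" by (metis prod_cases4)
  have "[:e, c:] \<noteq> 0" using assms by (auto simp: g)
  then have "finite {t. poly [:e, c:] t = 0}" by (rule poly_roots_finite)
  then show ?thesis by (simp add: g add.commute mult.commute)
qed

lemma finite_bad_points:
  assumes "finite S" "\<And>g. g \<in> S \<Longrightarrow> mdet g \<noteq> 0"
    "\<And>g h. g \<in> S \<Longrightarrow> h \<in> S \<Longrightarrow> same_moebius g h \<Longrightarrow> g = h"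
  shows "finite {t. (\<exists>g\<in>S. m2 g t 1 = 0) \<or> (\<exists>g\<in>S. \<exists>h\<in>S. g \<noteq> h \<and> m1 g t 1 * m2 h t 1 = m2 g t 1 * m1 h t 1)}"
    (is "finite ?B")
proof -
  have "finite (\<Union>g\<in>S. {t. m2 g t 1 = 0})" using assms finite_pole by blast
  moreover have "finite (\<Union>g\<in>S. \<Union>h\<in>S - {g}. {t. m1 g t 1 * m2 h t 1 = m2 g t 1 * m1 h t 1})"
  proof (intro finite_UN_I finite_same_value)
    show "\<not> same_moebius g h" if "g \<in> S" "h \<in> S - {g}" for g h using assms(3)[of g h] that by blast
  qed (use assms(1) in auto)
  moreover have "?B \<subseteq> (\<Union>g\<in>S. {t. m2 g t 1 = 0}) \<union> (\<Union>g\<in>S. \<Union>h\<in>S - {g}. {t. m1 g t 1 * m2 h t 1 = m2 g t 1 * m1 h t 1})"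
    by blast
  ultimately show ?thesis by (meson finite_UnI finite_subset)
qed

text \<open>A point with d distinct conjugates is moved to infinity, and so is its value. Then r = a/b is unramified
  over infinity, all ramification is visible in the affine line, and b has d - 1 simple roots.\<close>

locale normalized_pair =
  fixes d :: nat and a b :: "complex poly"
  assumes d: "d \<ge> 1" and a: "degree a = d" "coeff a d = 1" and b: "b \<noteq> 0" "degree b = d - 1"
    and simple: "\<And>p. poly b p = 0 \<Longrightarrow> poly (pderiv b) p \<noteq> 0"
    and common: "\<And>p. poly b p = 0 \<Longrightarrow> poly a p \<noteq> 0"
    and deck: "many_deck d (hom_eval d a) (hom_eval d b)"

lemma order_one_if_many_roots:
  fixes b :: "complex poly"
  assumes "b \<noteq> 0" "card {p. poly b p = 0} \<ge> degree b" "poly b p = 0"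
  shows "poly (pderiv b) p \<noteq> 0"
proof
  assume p': "poly (pderiv b) p = 0"
  have "pderiv b \<noteq> 0"
  proof
    assume "pderiv b = 0"
    then have "degree b = 0" by (simp add: pderiv_eq_0_iff)
    then obtain k where "b = [:k:]" by (rule degree_eq_zeroE)
    then show False using assms(1,3) by auto
  qed
  then have "order p b \<ge> 2"
    using order_pderiv[of b p] p' assms by (simp add: order_root)
  let ?R = "{p. poly b p = 0}"
  have fin: "finite ?R" using assms(1) by (rule poly_roots_finite)
  have "degree b = (\<Sum>q\<in>?R. order q b)"
    using size_proots_complex[of b] assms(1) by (simp add: size_multiset_overloaded_eq)
  also have "\<dots> > (\<Sum>q\<in>?R. 1)"
  proof (rule sum_strict_mono_ex1[OF fin])
    show "\<forall>q\<in>?R. 1 \<le> order q b" using assms(1) by (auto simp: order_gt_0_iff Suc_le_eq)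
    show "\<exists>q\<in>?R. 1 < order q b" using assms(3) \<open>order p b \<ge> 2\<close> by force
  qed
  finally show False using assms(2) by simp
qed

text \<open>For all but finitely many points the images under d deck transformations are distinct.\<close>

lemma exists_normalized_pair:
  assumes d: "d \<ge> 1" and F: "is_form d F" and G: "is_form d G" and nz: "no_common_zero F G"
    and deck: "many_deck d F G"
  shows "\<exists>a b. normalized_pair d a b \<and> lr_equiv F G (hom_eval d a) (hom_eval d b)"
proof -
  obtain S where S: "S \<subseteq> deck F G" "finite S" "card S = d"
    "\<And>g h. g \<in> S \<Longrightarrow> h \<in> S \<Longrightarrow> same_moebius g h \<Longrightarrow> g = h"
    using deck unfolding many_deck_def by blast
  have Sdet: "mdet g \<noteq> 0" if "g \<in> S" for g using S(1) that deck_iff by blast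
  from ex_new_if_finite[OF infinite_UNIV_char_0 finite_bad_points[OF S(2) Sdet S(4)]]
  obtain t where t: "\<And>g h. g \<in> S \<Longrightarrow> h \<in> S \<Longrightarrow> g \<noteq> h \<Longrightarrow> m1 g t 1 * m2 h t 1 \<noteq> m2 g t 1 * m1 h t 1"
    by blast
  \<comment> \<open>M moves infinity to t, and N moves the value at t to infinity.\<close>
  define M :: moebius where "M = (t, -1, 1, 0)"
  have M: "mdet M \<noteq> 0" "m1 M 1 0 = t" "m2 M 1 0 = 1" by (simp_all add: M_def)
  have "F t 1 \<noteq> 0 \<or> G t 1 \<noteq> 0" using nz unfolding no_common_zero_def by (metis one_neq_zero)
  then obtain N where N: "mdet N \<noteq> 0" "m1 N (F t 1) (G t 1) = 1" "m2 N (F t 1) (G t 1) = 0"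
  proof (cases "F t 1 = 0")
    case True
    with \<open>F t 1 \<noteq> 0 \<or> G t 1 \<noteq> 0\<close> show ?thesis by (intro that[of "(0, 1 / G t 1, 1, 0)"]) auto
  next
    case False
    then show ?thesis by (intro that[of "(1 / F t 1, 0, - G t 1 / F t 1, 1)"]) auto
  qed
  define F' where "F' = (\<lambda>x y. m1 N (F (m1 M x y) (m2 M x y)) (G (m1 M x y) (m2 M x y)))"
  define G' where "G' = (\<lambda>x y. m2 N (F (m1 M x y) (m2 M x y)) (G (m1 M x y) (m2 M x y)))"
  have lr: "lr_equiv F G F' G'" by (rule lr_equivI[OF M(1) N(1)]) (simp_all add: F'_def G'_def)
  have "is_form d F'" "is_form d G'" unfolding F'_def G'_def by (rule is_form_linear_change[OF F G])+
  then obtain a b where a: "degree a \<le> d" "F' = hom_eval d a" and b: "degree b \<le> d" "G' = hom_eval d b"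
    unfolding is_form_def by blast
  have nz': "no_common_zero F' G'" by (rule lr_equiv_no_common_zero[OF lr nz])
  have "F' 1 0 = 1" "G' 1 0 = 0" by (simp_all add: F'_def G'_def M N)
  then have ad: "coeff a d = 1" and bd: "coeff b d = 0" by (simp_all add: a b hom_eval_0)
  have "degree a = d" using a(1) ad by (metis le_antisym le_degree one_neq_zero)
  have bdeg: "degree b \<le> d - 1"
  proof (rule degree_le, safe)
    fix i assume "d - 1 < i"
    then show "coeff b i = 0" using bd b(1) d by (cases "i = d") (auto intro: coeff_eq_0)
  qed
  have ev: "F' x 1 = poly a x" "G' x 1 = poly b x" for x by (simp_all add: a b hom_eval_1)
  have b0: "b \<noteq> 0"
  proof
    assume "b = 0"
    obtain x where "poly a x = 0"
      using fundamental_theorem_of_algebra[of a] \<open>degree a = d\<close> d by (auto simp: constant_degree)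
    then show False using nz' ev[of x] \<open>b = 0\<close> unfolding no_common_zero_def by (metis one_neq_zero poly_0)
  qed
  define v1 v2 where "v1 g = m1 (minv M) (m1 g t 1) (m2 g t 1)" and "v2 g = m2 (minv M) (m1 g t 1) (m2 g t 1)" for g
  have zero: "G' (v1 g) (v2 g) = 0" if "g \<in> S" for g
  proof -
    have "g \<in> deck F G" using S(1) that by blast
    then obtain u where "\<And>x y. F (m1 g x y) (m2 g x y) = u * F x y" "\<And>x y. G (m1 g x y) (m2 g x y) = u * G x y"
      unfolding deck_iff by blast
    then have "G' (v1 g) (v2 g) = u * m2 N (F t 1) (G t 1)"
      by (simp add: G'_def v1_def v2_def minv_apply[OF M(1)] m_linear del: minv.simps)
    then show ?thesis using N by simp
  qed
  have cross: "v1 g * v2 h \<noteq> v2 g * v1 h" if "g \<in> S" "h \<in> S" "g \<noteq> h" for g h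
    using t[OF that] by (auto simp: v1_def v2_def M_def algebra_simps)
  define S' where "S' = {g \<in> S. v2 g \<noteq> 0}"
  have "card S' \<ge> d - 1"
  proof -
    have "g = h" if "g \<in> S - S'" "h \<in> S - S'" for g h
      by (rule ccontr) (use cross[of g h] that in \<open>simp add: S'_def\<close>)
    then have "card (S - S') \<le> 1" using S(2) by (simp add: card_le_Suc0_iff_eq)
    moreover have "card S = card S' + card (S - S')"
      using S(2) by (subst card_Un_disjoint[symmetric]) (auto simp: S'_def intro!: arg_cong[of _ _ card])
    ultimately show ?thesis using S(3) by linarith
  qed
  moreover have "inj_on (\<lambda>g. v1 g / v2 g) S'"
    by (rule inj_onI, rule ccontr) (use cross in \<open>auto simp: S'_def field_simps\<close>)
  moreover have "poly b (v1 g / v2 g) = 0" if "g \<in> S'" for g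
    using zero[of g] that hom_eval_eq[OF b(1), of "v2 g" "v1 g"] by (auto simp: S'_def b)
  ultimately have card: "card {p. poly b p = 0} \<ge> d - 1"
  proof -
    assume 1: "d - 1 \<le> card S'" "inj_on (\<lambda>g. v1 g / v2 g) S'" and 2: "\<And>g. g \<in> S' \<Longrightarrow> poly b (v1 g / v2 g) = 0"
    have "card S' = card ((\<lambda>g. v1 g / v2 g) ` S')" using card_image[OF 1(2)] by simp
    also have "\<dots> \<le> card {p. poly b p = 0}"
      by (rule card_mono) (use 2 poly_roots_finite[OF b0] in auto)
    finally show ?thesis using 1(1) by linarith
  qed
  then have bdeg': "degree b = d - 1" using bdeg card_poly_roots_bound[OF b0] by linarith
  have "normalized_pair d a b"
  proof
    show "poly (pderiv b) p \<noteq> 0" if "poly b p = 0" for p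
      by (rule order_one_if_many_roots) (use b0 card bdeg' that in auto)
    show "poly a p \<noteq> 0" if "poly b p = 0" for p
      using nz' that ev[of p] unfolding no_common_zero_def by (metis one_neq_zero)
    show "many_deck d (hom_eval d a) (hom_eval d b)"
      using lr_equiv_many_deck[OF lr deck] by (simp add: a b)
  qed (use d \<open>degree a = d\<close> ad b0 bdeg' in auto)
  then show ?thesis using lr a b by blast
qed

context normalized_pair
begin

text \<open>For generic t the fibre through t consists of the d points g(t), so that the numerator of r(X) - r(t) is,
  up to a factor, the product of the X - g(t). This identity is polynomial in t and therefore also holds at
  the points with a smaller fibre.\<close>

lemma deck_transitive:
  assumes p: "poly (a - smult c b) p = 0" and q: "poly (a - smult c b) q = 0"
  shows "\<exists>g\<in>deck (hom_eval d a) (hom_eval d b). m1 g p 1 = q * m2 g p 1"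
proof -
  obtain S where S: "S \<subseteq> deck (hom_eval d a) (hom_eval d b)" "finite S" "card S = d"
    "\<And>g h. g \<in> S \<Longrightarrow> h \<in> S \<Longrightarrow> same_moebius g h \<Longrightarrow> g = h"
    using deck unfolding many_deck_def by blast
  have Sdet: "mdet g \<noteq> 0" if "g \<in> S" for g using S(1) that deck_iff by blast
  define good where "good = - {t. (\<exists>g\<in>S. m2 g t 1 = 0) \<or> (\<exists>g\<in>S. \<exists>h\<in>S. g \<noteq> h \<and> m1 g t 1 * m2 h t 1 = m2 g t 1 * m1 h t 1)}"
  have inf: "infinite good"
    unfolding good_def using finite_bad_points[OF S(2) Sdet S(4)] infinite_UNIV_char_0
    by (metis (no_types, lifting) Compl_eq_Diff_UNIV Diff_infinite_finite)
  have da: "degree a \<le> d" and db: "degree b \<le> d" using a b by auto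
  define N1 N2 where "N1 g = [:m1 g 0 1, m1 g 1 0:]" and "N2 g = [:m2 g 0 1, m2 g 1 0:]" for g
  have N: "poly (N1 g) t = m1 g t 1" "poly (N2 g) t = m2 g t 1" for g t
    by (cases g; simp add: N1_def N2_def algebra_simps)+
  have generic: "(poly a X * poly b t - poly b X * poly a t) * (\<Prod>g\<in>S. m2 g t 1)
      = poly b t * (\<Prod>g\<in>S. X * m2 g t 1 - m1 g t 1)" if "t \<in> good" for t X
  proof -
    let ?P = "smult (\<Prod>g\<in>S. m2 g t 1) (smult (poly b t) a - smult (poly a t) b)"
    let ?Q = "smult (poly b t) (\<Prod>g\<in>S. [:- m1 g t 1, m2 g t 1:])"
    have m2: "m2 g t 1 \<noteq> 0" if "g \<in> S" for g using \<open>t \<in> good\<close> that by (auto simp: good_def)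
    have degQ: "degree (\<Prod>g\<in>S. [:- m1 g t 1, m2 g t 1:]) = d"
      by (subst degree_prod_sum_eq) (use m2 S(3) in auto)
    have "?P = ?Q"
    proof (rule poly_eqI_degree_lead_coeff)
      show "d \<le> card ((\<lambda>g. m1 g t 1 / m2 g t 1) ` S)"
      proof (subst card_image)
        show "inj_on (\<lambda>g. m1 g t 1 / m2 g t 1) S"
          by (rule inj_onI, rule ccontr) (use \<open>t \<in> good\<close> in \<open>auto simp: good_def field_simps\<close>)
      qed (simp add: S(3))
      show "degree ?P \<le> d"
        by (rule degree_le) (use da db in \<open>auto simp: coeff_eq_0\<close>)
      show "degree ?Q \<le> d" using degQ degree_smult_le[of "poly b t" "\<Prod>g\<in>S. [:- m1 g t 1, m2 g t 1:]"] by linarith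
      have "coeff (\<Prod>g\<in>S. [:- m1 g t 1, m2 g t 1:]) d = lead_coeff (\<Prod>g\<in>S. [:- m1 g t 1, m2 g t 1:])"
        by (simp add: degQ)
      also have "\<dots> = (\<Prod>g\<in>S. m2 g t 1)"
        by (simp add: lead_coeff_prod) (intro prod.cong, use m2 in auto)
      finally show "coeff ?P d = coeff ?Q d" using a b d by (simp add: coeff_eq_0)
    next
      fix z assume "z \<in> (\<lambda>g. m1 g t 1 / m2 g t 1) ` S"
      then obtain g where g: "g \<in> S" "z = m1 g t 1 / m2 g t 1" by blast
      have "g \<in> deck (hom_eval d a) (hom_eval d b)" using S(1) g(1) by blast
      then obtain u where u: "\<And>x y. hom_eval d a (m1 g x y) (m2 g x y) = u * hom_eval d a x y"
        "\<And>x y. hom_eval d b (m1 g x y) (m2 g x y) = u * hom_eval d b x y"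
        unfolding deck_iff by blast
      have "m2 g t 1 ^ d * poly a z = u * poly a t" "m2 g t 1 ^ d * poly b z = u * poly b t"
        using u[of t 1] by (simp_all add: g(2) hom_eval_eq[OF da m2[OF g(1)]] hom_eval_eq[OF db m2[OF g(1)]] hom_eval_1[OF da] hom_eval_1[OF db])
      then have "m2 g t 1 ^ d * (poly b t * poly a z - poly a t * poly b z) = 0"
        by (simp add: algebra_simps)
      then have P0: "poly ?P z = 0" using m2[OF g(1)] by simp
      have "\<exists>h\<in>S. poly [:- m1 h t 1, m2 h t 1:] z = 0"
        using g m2 by (intro bexI[of _ g]) auto
      then have "poly ?Q z = 0" using S(2) by (simp add: poly_prod)
      with P0 show "poly ?P z = poly ?Q z" by (simp only:)
    qed
    from arg_cong[OF this, of "\<lambda>P. poly P X"] show ?thesis by (simp add: poly_prod mult_ac)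
  qed
  have "(smult (poly a q) b - smult (poly b q) a) * (\<Prod>g\<in>S. N2 g) = b * (\<Prod>g\<in>S. smult q (N2 g) - N1 g)"
    by (rule poly_eqI_infinite[OF inf]) (use generic in \<open>simp add: poly_prod N\<close>)
  from arg_cong[OF this, of "\<lambda>P. poly P p"]
  have "(poly a q * poly b p - poly b q * poly a p) * (\<Prod>g\<in>S. m2 g p 1) = poly b p * (\<Prod>g\<in>S. q * m2 g p 1 - m1 g p 1)"
    by (simp add: poly_prod N)
  moreover have "poly a q * poly b p - poly b q * poly a p = 0" using p q by simp
  moreover have "poly b p \<noteq> 0" using p common by auto
  ultimately have "\<exists>g\<in>S. q * m2 g p 1 - m1 g p 1 = 0" using S(2) by auto
  then obtain g where "g \<in> S" "q * m2 g p 1 - m1 g p 1 = 0" by blast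
  then show ?thesis using S(1) by (intro bexI[of _ g]) (simp, blast)
qed

lemma deck_multiplier_nonzero:
  assumes "mdet g \<noteq> 0" "\<And>x y. hom_eval d a (m1 g x y) (m2 g x y) = u * hom_eval d a x y"
    "\<And>x y. hom_eval d b (m1 g x y) (m2 g x y) = u * hom_eval d b x y"
  shows "u \<noteq> 0"
proof
  assume "u = 0"
  then have "hom_eval d a x y = 0" for x y
    using assms(2)[of "m1 (minv g) x y" "m2 (minv g) x y"] by (simp add: minv_apply[OF assms(1)])
  then have "coeff a d * 1 ^ d = 0" using hom_eval_0 by metis
  then show False using a by simp
qed

text \<open>An invertible linear substitution carries p to q and multiplies the form of their fibre by a constant.\<close>

lemma order_le_of_deck:
  assumes p: "poly (a - smult c b) p = 0" and q: "poly (a - smult c b) q = 0"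
  shows "order q (a - smult c b) \<le> order p (a - smult c b)"
proof -
  let ?\<phi> = "a - smult c b"
  obtain g where g: "g \<in> deck (hom_eval d a) (hom_eval d b)" "m1 g p 1 = q * m2 g p 1"
    using deck_transitive[OF p q] by blast
  obtain u where u: "\<And>x y. hom_eval d a (m1 g x y) (m2 g x y) = u * hom_eval d a x y"
    "\<And>x y. hom_eval d b (m1 g x y) (m2 g x y) = u * hom_eval d b x y" and det: "mdet g \<noteq> 0"
    using g(1) unfolding deck_iff by blast
  note u0 = deck_multiplier_nonzero[OF det u]
  have deg: "degree ?\<phi> \<le> d" by (rule degree_le) (use a b in \<open>auto simp: coeff_eq_0\<close>)
  have "coeff ?\<phi> d = 1" using a b d by (simp add: coeff_eq_0)
  then have \<phi>0: "?\<phi> \<noteq> 0" by auto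
  define e where "e = order q ?\<phi>"
  obtain \<psi> where \<psi>: "?\<phi> = [:- q, 1:] ^ e * \<psi>" using order_1[of q ?\<phi>] by (auto simp: e_def elim: dvdE)
  have \<psi>0: "\<psi> \<noteq> 0" using \<psi> \<phi>0 by auto
  have "degree ?\<phi> = e + degree \<psi>"
    unfolding \<psi> using \<psi>0 by (subst degree_mult_eq) (auto simp: degree_linear_power)
  then have e: "degree \<psi> \<le> d - e" "e \<le> d" using deg by auto
  have hom: "hom_eval d ?\<phi> x y = (x - q * y) ^ e * hom_eval (d - e) \<psi> x y" for x y
  proof -
    have "hom_eval (e * 1 + (d - e)) ([:- q, 1:] ^ e * \<psi>) x y = hom_eval (e * 1) ([:- q, 1:] ^ e) x y * hom_eval (d - e) \<psi> x y"
      by (rule hom_eval_mult) (use e in \<open>auto simp: degree_linear_power\<close>)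
    also have "hom_eval (e * 1) ([:- q, 1:] ^ e) x y = hom_eval 1 [:- q, 1:] x y ^ e" by (rule hom_eval_power) simp
    also have "hom_eval 1 [:- q, 1:] x y = x - q * y" by (simp only: hom_eval_linear) simp
    finally show ?thesis using e(2) \<psi> by simp
  qed
  obtain \<alpha> \<beta> \<gamma> \<delta> where g4: "g = (\<alpha>, \<beta>, \<gamma>, \<delta>)" by (metis prod_cases4)
  define \<kappa> where "\<kappa> = \<alpha> - q * \<gamma>"
  have lin: "m1 g x 1 - q * m2 g x 1 = \<kappa> * (x - p)" for x
    using g(2) by (simp add: g4 \<kappa>_def algebra_simps)
  define R where "R = (\<Sum>i\<le>d - e. smult (coeff \<psi> i) ([:\<beta>, \<alpha>:] ^ i * [:\<delta>, \<gamma>:] ^ (d - e - i)))"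
  have R: "poly R x = hom_eval (d - e) \<psi> (m1 g x 1) (m2 g x 1)" for x
    by (simp add: R_def poly_sum hom_eval_def g4 algebra_simps)
  have "smult u ?\<phi> = [:- p, 1:] ^ e * smult (\<kappa> ^ e) R"
  proof (rule poly_eqI_infinite[OF infinite_UNIV_char_0])
    fix x
    have "u * poly ?\<phi> x = hom_eval d ?\<phi> (m1 g x 1) (m2 g x 1)"
      using u[of x 1] hom_eval_1[of a d x] hom_eval_1[of b d x] a b
      by (simp add: hom_eval_diff hom_eval_smult algebra_simps)
    also have "\<dots> = (\<kappa> * (x - p)) ^ e * poly R x" by (simp add: hom lin R)
    finally show "poly (smult u ?\<phi>) x = poly ([:- p, 1:] ^ e * smult (\<kappa> ^ e) R) x"
      by (simp add: power_mult_distrib mult_ac)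
  qed
  then have "[:- p, 1:] ^ e dvd smult u ?\<phi>" by (metis dvd_triv_left)
  then have "[:- p, 1:] ^ e dvd ?\<phi>" using u0 by (simp add: dvd_smult_iff)
  then show ?thesis using \<phi>0 by (simp add: order_divides e_def)
qed

lemma fibre_degree: "degree (a - smult c b) = d" "lead_coeff (a - smult c b) = 1" "a - smult c b \<noteq> 0"
proof -
  have c: "coeff (a - smult c b) d = 1" using a b d by (simp add: coeff_eq_0)
  moreover have "degree (a - smult c b) \<le> d"
    by (rule degree_le) (use a b in \<open>auto simp: coeff_eq_0\<close>)
  ultimately show deg: "degree (a - smult c b) = d" by (metis le_antisym le_degree one_neq_zero)
  show "lead_coeff (a - smult c b) = 1" unfolding deg by (rule c)
  show "a - smult c b \<noteq> 0" using c by auto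
qed

text \<open>Since conjugate points have equal multiplicity, every finite fibre is a power of a squarefree polynomial.\<close>

lemma fibre_power:
  assumes p: "poly (a - smult c b) p = 0"
  defines "R \<equiv> {q. poly (a - smult c b) q = 0}" and "e \<equiv> order p (a - smult c b)"
  shows "a - smult c b = (\<Prod>q\<in>R. [:- q, 1:]) ^ e" "card R * e = d"
    "\<And>q. q \<in> R \<Longrightarrow> order q (a - smult c b) = e"
proof -
  show ord: "order q (a - smult c b) = e" if "q \<in> R" for q
    using order_le_of_deck[OF p, of q] order_le_of_deck[OF _ p, of q] that by (auto simp: R_def e_def)
  have "smult (lead_coeff (a - smult c b)) (\<Prod>z\<in>R. [:- z, 1:] ^ order z (a - smult c b)) = a - smult c b"
    unfolding R_def by (rule complex_poly_decompose)
  then have "a - smult c b = (\<Prod>z\<in>R. [:- z, 1:] ^ order z (a - smult c b))"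
    unfolding fibre_degree(2) by simp
  also have "\<dots> = (\<Prod>z\<in>R. [:- z, 1:] ^ e)" by (rule prod.cong) (simp_all add: ord)
  finally show eq: "a - smult c b = (\<Prod>q\<in>R. [:- q, 1:]) ^ e" by (simp add: prod_power_distrib)
  have "d = degree ((\<Prod>q\<in>R. [:- q, 1:]) ^ e)" using fibre_degree(1)[of c] unfolding eq by simp
  also have "\<dots> = e * card R"
  proof -
    have "finite R" unfolding R_def by (rule poly_roots_finite[OF fibre_degree(3)])
    then have "(\<Prod>q\<in>R. [:- q, 1:]) \<noteq> 0" by simp
    moreover have "degree (\<Prod>q\<in>R. [:- q, 1:]) = card R" by (subst degree_prod_sum_eq) auto
    ultimately show ?thesis by (simp add: degree_power_eq)
  qed
  finally show "card R * e = d" by (simp add: mult.commute)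
qed

text \<open>The numerator of the derivative of a/b, whose zeros are the ramification points.\<close>

definition W :: "complex poly" where "W = pderiv a * b - a * pderiv b"

text \<open>The leading terms do not cancel, because \<open>d - (d - 1) = 1\<close>.\<close>

lemma degree_W: "degree W = 2 * d - 2" and W_nonzero: "W \<noteq> 0"
proof -
  have le: "degree W \<le> 2 * d - 2"
    unfolding W_def
  proof (rule degree_diff_le)
    show "degree (pderiv a * b) \<le> 2 * d - 2"
      using degree_mult_le[of "pderiv a" b] a b d by (simp add: degree_pderiv)
    show "degree (a * pderiv b) \<le> 2 * d - 2"
    proof (cases "d = 1")
      case True
      then have "pderiv b = 0" using b by (simp add: pderiv_eq_0_iff)
      then show ?thesis by simp
    next
      case False
      then show ?thesis using degree_mult_le[of a "pderiv b"] a b d by (simp add: degree_pderiv)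
    qed
  qed
  have "coeff (pderiv a * b) (2 * d - 2) = of_nat d * coeff b (d - 1)"
  proof -
    have "degree (pderiv a) = d - 1" using a by (simp add: degree_pderiv)
    then have "coeff (pderiv a * b) (2 * d - 2) = lead_coeff (pderiv a) * lead_coeff b"
      using coeff_mult_degree_sum[of "pderiv a" b] b d by (simp add: numeral_2_eq_2)
    then show ?thesis using a b d \<open>degree (pderiv a) = d - 1\<close> by (simp add: coeff_pderiv)
  qed
  moreover have "coeff (a * pderiv b) (2 * d - 2) = of_nat (d - 1) * coeff b (d - 1)"
  proof (cases "d = 1")
    case True
    then have "pderiv b = 0" using b by (simp add: pderiv_eq_0_iff)
    then show ?thesis using True by simp
  next
    case False
    have "degree (pderiv b) = d - 2" using b by (simp add: degree_pderiv)
    moreover have "degree a + (d - 2) = 2 * d - 2" using a d False by simp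
    ultimately have "coeff (a * pderiv b) (2 * d - 2) = lead_coeff a * lead_coeff (pderiv b)"
      using coeff_mult_degree_sum[of a "pderiv b"] by simp
    moreover have "Suc (d - 2) = d - 1" using False d by simp
    ultimately show ?thesis using a \<open>degree (pderiv b) = d - 2\<close> by (simp add: coeff_pderiv)
  qed
  ultimately have "coeff W (2 * d - 2) = coeff b (d - 1)"
    using d by (simp add: W_def of_nat_diff algebra_simps)
  moreover have "coeff b (d - 1) \<noteq> 0" using b by (metis leading_coeff_0_iff)
  ultimately have nz: "coeff W (2 * d - 2) \<noteq> 0" by simp
  then show "degree W = 2 * d - 2" using le le_degree by (metis le_antisym)
  show "W \<noteq> 0" using nz by auto
qed

text \<open>W is also the Wronskian of a - cb and b, and b does not vanish at p.\<close>

lemma order_W: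
  assumes p: "poly (a - smult c b) p = 0"
  shows "order p W = order p (a - smult c b) - 1"
proof -
  let ?\<phi> = "a - smult c b"
  define e where "e = order p ?\<phi>"
  have e: "e > 0" using p fibre_degree(3)[of c] by (simp add: e_def order_gt_0_iff)
  define l where "l = [:- p, 1:]"
  have l: "pderiv l = 1" "poly l p = 0" "l \<noteq> 0" by (simp_all add: l_def pderiv_pCons one_pCons)
  obtain \<psi> where \<psi>: "?\<phi> = l ^ e * \<psi>" "poly \<psi> p \<noteq> 0"
    using order_decomp[OF fibre_degree(3), of c p] by (auto simp: e_def l_def poly_eq_0_iff_dvd)
  obtain k where k: "e = Suc k" using e by (cases e) auto
  have "W = pderiv ?\<phi> * b - ?\<phi> * pderiv b"
    by (simp add: W_def pderiv_diff pderiv_smult algebra_simps)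
  also have "\<dots> = l ^ k * ((smult (of_nat e) \<psi> + l * pderiv \<psi>) * b - l * \<psi> * pderiv b)" (is "_ = _ * ?w")
    unfolding \<psi>(1) k pderiv_mult pderiv_power_Suc l(1) by (simp add: algebra_simps)
  finally have W: "W = l ^ k * ?w" .
  have "poly b p \<noteq> 0" using common p by auto
  then have "poly ?w p \<noteq> 0" using e \<psi>(2) l(2) by simp
  then have "order p ?w = 0" by (rule order_0I)
  moreover have "?w \<noteq> 0" using \<open>poly ?w p \<noteq> 0\<close> by (metis poly_0)
  moreover have "order p (l ^ k) = k" unfolding l_def by (rule order_power_n_n)
  ultimately have "order p W = k" unfolding W using l(3) by (subst order_mult) auto
  then show ?thesis using k e_def by simp
qed

text \<open>The \<open>2d - 2\<close> zeros of W are counted fibre by fibre. All points of a fibre have the same multiplicity e, and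
  at each of them W vanishes to the order e - 1.\<close>

lemma riemann_hurwitz:
  obtains Br :: "complex set" and m :: "complex \<Rightarrow> complex poly" and e :: "complex \<Rightarrow> nat"
  where "finite Br" "\<And>c. c \<in> Br \<Longrightarrow> a - smult c b = m c ^ e c" "\<And>c. c \<in> Br \<Longrightarrow> e c \<ge> 2"
    "\<And>c. c \<in> Br \<Longrightarrow> degree (m c) * e c = d" "\<And>c. c \<in> Br \<Longrightarrow> lead_coeff (m c) = 1"
    "\<And>c. c \<in> Br \<Longrightarrow> card {p. poly (m c) p = 0} = degree (m c)"
    "(\<Sum>c\<in>Br. degree (m c) * (e c - 1)) = 2 * d - 2"
proof -
  define Z where "Z = {p. poly W p = 0}"
  have finZ: "finite Z" unfolding Z_def by (rule poly_roots_finite[OF W_nonzero])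
  define r where "r p = poly a p / poly b p" for p
  have bZ: "poly b p \<noteq> 0" if "p \<in> Z" for p
    using that common[of p] simple[of p] by (auto simp: Z_def W_def)
  define R where "R c = {q. poly (a - smult c b) q = 0}" for c
  have rZ: "p \<in> R (r p)" if "p \<in> Z" for p using bZ[OF that] by (simp add: R_def r_def)
  define e where "e c = order (SOME q. q \<in> R c) (a - smult c b)" for c
  define m where "m c = (\<Prod>q\<in>R c. [:- q, 1:])" for c
  have some: "poly (a - smult c b) (SOME q. q \<in> R c) = 0" if "c \<in> r ` Z" for c
    using that rZ someI_ex[of "\<lambda>q. q \<in> R c"] by (auto simp: R_def)
  note fib = fibre_power[OF some, folded R_def e_def m_def]
  have finR: "finite (R c)" for c unfolding R_def by (rule poly_roots_finite[OF fibre_degree(3)])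
  have degm: "degree (m c) = card (R c)" for c
    unfolding m_def by (subst degree_prod_sum_eq) auto
  have rootm: "{p. poly (m c) p = 0} = R c" for c
    using finR[of c] by (auto simp: m_def poly_prod)
  have ordW: "order p W = e c - 1" if "p \<in> R c" "c \<in> r ` Z" for p c
    using order_W[of c p] fib(3)[OF that(2,1)] that(1) by (simp add: R_def)
  have e2: "e c \<ge> 2" if "c \<in> r ` Z" for c
  proof -
    from that obtain p where p: "p \<in> Z" "c = r p" by blast
    then have "order p W > 0" using W_nonzero by (simp add: order_gt_0_iff Z_def)
    then show ?thesis using ordW[OF _ that, of p] rZ[OF p(1)] p(2) by simp
  qed
  have RZ: "R c = {p \<in> Z. r p = c}" if "c \<in> r ` Z" for c
  proof (intro equalityI subsetI)
    fix p assume p: "p \<in> R c"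
    then have "poly W p = 0" using ordW[OF p that] e2[OF that] by (intro order_root[THEN iffD2]) auto
    moreover have "poly b p \<noteq> 0" using p common[of p] by (auto simp: R_def)
    ultimately show "p \<in> {p \<in> Z. r p = c}" using p by (simp add: Z_def R_def r_def)
  qed (use rZ in auto)
  have "2 * d - 2 = (\<Sum>p\<in>Z. order p W)"
    using size_proots_complex[of W] W_nonzero by (simp add: size_multiset_overloaded_eq degree_W Z_def)
  also have "\<dots> = (\<Sum>c\<in>r ` Z. \<Sum>p\<in>{p \<in> Z. r p = c}. order p W)"
    by (rule sum.image_gen[OF finZ])
  also have "\<dots> = (\<Sum>c\<in>r ` Z. degree (m c) * (e c - 1))"
    by (rule sum.cong) (auto simp: ordW degm simp flip: RZ)
  finally have "(\<Sum>c\<in>r ` Z. degree (m c) * (e c - 1)) = 2 * d - 2" by simp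
  moreover have "lead_coeff (m c) = 1" for c by (simp add: m_def lead_coeff_prod)
  ultimately show ?thesis
    using that[of "r ` Z" m e] finZ fib(1,2) e2 degm rootm by simp
qed

end

section \<open>Signatures and descent\<close>

text \<open>The equation \<open>1/e\<^sub>1 + 1/e\<^sub>2 + 1/e\<^sub>3 = 1 + 2/d\<close> of the platonic triples, cleared of denominators.\<close>

lemma signature_of_three:
  fixes d n1 n2 n3 e1 e2 e3 :: nat
  assumes ne: "n1 * e1 = d" "n2 * e2 = d" "n3 * e3 = d" and e: "2 \<le> e1" "e1 \<le> e2" "e2 \<le> e3"
    and sum: "n1 + n2 + n3 = d + 2"
  shows "e1 = 2 \<and> (e2 = 2 \<and> n3 = 2 \<or> e2 = 3 \<and> e3 = 3 \<and> d = 12 \<or> e2 = 3 \<and> e3 = 4 \<and> d = 24 \<or>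
    e2 = 3 \<and> e3 = 5 \<and> d = 60)"
proof -
  have le: "k * n \<le> d" if "n * e = d" "k \<le> e" for k n e :: nat
    using that by (metis mult.commute mult_le_mono2)
  have e1: "e1 = 2"
  proof (rule ccontr)
    assume "e1 \<noteq> 2"
    then have "3 \<le> e1" "3 \<le> e2" "3 \<le> e3" using e by auto
    then have "3 * n1 \<le> d" "3 * n2 \<le> d" "3 * n3 \<le> d" using le[OF ne(1)] le[OF ne(2)] le[OF ne(3)] by auto
    then show False using sum by linarith
  qed
  then have n1: "2 * n1 = d" using ne by simp
  have "e2 < 4"
  proof (rule ccontr)
    assume "\<not> e2 < 4"
    then have "4 * n2 \<le> d" "4 * n3 \<le> d" using le[OF ne(2), of 4] le[OF ne(3), of 4] e by auto
    then show False using sum n1 by linarith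
  qed
  then consider "e2 = 2" | "e2 = 3" using e e1 by linarith
  then show ?thesis
  proof cases
    case 1
    then have "2 * n2 = d" using ne by simp
    then have "n3 = 2" using sum n1 by linarith
    then show ?thesis using 1 e1 by blast
  next
    case 2
    then have n2: "3 * n2 = d" using ne by simp
    then have n3: "6 * n3 = d + 12" using sum n1 by linarith
    have "e3 < 6"
    proof (rule ccontr)
      assume "\<not> e3 < 6"
      then have "6 * n3 \<le> d" using le[OF ne(3), of 6] by simp
      then show False using n3 by linarith
    qed
    then consider "e3 = 3" | "e3 = 4" | "e3 = 5" using e 2 by linarith
    then show ?thesis
    proof cases
      case 1 then have "3 * n3 = d" using ne by simp
      then show ?thesis using n3 e1 2 1 by auto
    next
      case 2 then have "4 * n3 = d" using ne by simp
      then show ?thesis using n3 e1 \<open>e2 = 3\<close> 2 by auto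
    next
      case 3 then have "5 * n3 = d" using ne by simp
      then show ?thesis using n3 e1 2 3 by auto
    qed
  qed
qed

text \<open>A ramified fibre has at most d/2 points, and this leaves at most three of them. In the platonic cases the
  two fibres of larger multiplicity come first; they are the two members of the model pair.\<close>

lemma signature:
  fixes n e :: "'c \<Rightarrow> nat"
  assumes fin: "finite Br" and e: "\<And>c. c \<in> Br \<Longrightarrow> e c \<ge> 2" and ne: "\<And>c. c \<in> Br \<Longrightarrow> n c * e c = d"
    and sum: "(\<Sum>c\<in>Br. n c * (e c - 1)) = 2 * d - 2" and d: "d \<ge> 1"
  obtains "d = 1"
    | c1 c2 where "c1 \<in> Br" "c2 \<in> Br" "c1 \<noteq> c2" "n c1 = 1" "n c2 = 1"
    | c1 c2 c3 where "c1 \<in> Br" "c2 \<in> Br" "c3 \<in> Br" "c1 \<noteq> c2" "c1 \<noteq> c3" "c2 \<noteq> c3"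
      "e c1 = 2 \<and> e c2 = 2 \<and> n c3 = 2 \<or> e c1 = 3 \<and> e c2 = 3 \<and> e c3 = 2 \<and> d = 12 \<or>
       e c1 = 3 \<and> e c2 = 4 \<and> e c3 = 2 \<and> d = 24 \<or> e c1 = 3 \<and> e c2 = 5 \<and> e c3 = 2 \<and> d = 60"
proof -
  have "n c * (e c - 1) + n c = d" if "c \<in> Br" for c
  proof -
    have "e c - 1 + 1 = e c" using e[OF that] by simp
    then have "n c * (e c - 1) + n c = n c * e c" by (metis mult.right_neutral distrib_left)
    then show ?thesis using ne[OF that] by simp
  qed
  then have "(\<Sum>c\<in>Br. n c * (e c - 1) + n c) = card Br * d" by simp
  then have S: "(\<Sum>c\<in>Br. n c) + (2 * d - 2) = card Br * d" using sum by (simp add: sum.distrib)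
  have half: "2 * n c \<le> d" if "c \<in> Br" for c
    using ne[OF that] e[OF that] by (metis mult.commute mult_le_mono2)
  have "(\<Sum>c\<in>Br. 2 * n c) \<le> (\<Sum>c\<in>Br. d)" by (rule sum_mono) (rule half)
  then have "2 * (\<Sum>c\<in>Br. n c) \<le> card Br * d" by (simp add: sum_distrib_left)
  then have "card Br * d < 4 * d" using S d by linarith
  then have "card Br < 4" using d by simp
  then consider "card Br = 0" | "card Br = 1" | "card Br = 2" | "card Br = 3" by linarith
  then show ?thesis
  proof cases
    case 1
    then have "Br = {}" using fin by simp
    then have "d = 1" using S d by simp
    then show ?thesis by (rule that(1))
  next
    case 2
    then obtain c where c: "Br = {c}" by (rule card_1_singletonE)
    then have "n c + (2 * d - 2) = d" using S by simp
    moreover have "n c \<noteq> 0" using ne[of c] d c by (metis insertI1 mult_zero_left not_one_le_zero)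
    then have "n c \<ge> 1" by simp
    ultimately have "d = 1" using d by linarith
    then show ?thesis by (rule that(1))
  next
    case 3
    then obtain c1 c2 where c: "Br = {c1, c2}" "c1 \<noteq> c2" unfolding card_2_iff by blast
    then have "n c1 + n c2 = 2" using S d by simp
    moreover have "n c \<noteq> 0" if "c \<in> Br" for c using ne[OF that] d by (metis mult_zero_left not_one_le_zero)
    then have "n c1 \<noteq> 0" "n c2 \<noteq> 0" using c by blast+
    then have "n c1 \<ge> 1" "n c2 \<ge> 1" by simp_all
    ultimately have "n c1 = 1" "n c2 = 1" by auto
    then show ?thesis using that(2) c by blast
  next
    case 4
    then obtain x y z where c: "Br = {x, y, z}" "x \<noteq> y" "y \<noteq> z" "x \<noteq> z" unfolding card_3_iff by blast
    have "\<exists>x y z. Br = {x, y, z} \<and> x \<noteq> y \<and> y \<noteq> z \<and> x \<noteq> z \<and> e x \<le> e y \<and> e y \<le> e z"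
    proof -
      consider "e x \<le> e y \<and> e y \<le> e z" | "e x \<le> e z \<and> e z \<le> e y" | "e y \<le> e x \<and> e x \<le> e z"
        | "e y \<le> e z \<and> e z \<le> e x" | "e z \<le> e x \<and> e x \<le> e y" | "e z \<le> e y \<and> e y \<le> e x" by linarith
      then show ?thesis
      proof cases
        case 1 show ?thesis by (rule exI[of _ x], rule exI[of _ y], rule exI[of _ z]) (use c 1 in auto)
      next case 2 show ?thesis by (rule exI[of _ x], rule exI[of _ z], rule exI[of _ y]) (use c 2 in auto)
      next case 3 show ?thesis by (rule exI[of _ y], rule exI[of _ x], rule exI[of _ z]) (use c 3 in auto)
      next case 4 show ?thesis by (rule exI[of _ y], rule exI[of _ z], rule exI[of _ x]) (use c 4 in auto)
      next case 5 show ?thesis by (rule exI[of _ z], rule exI[of _ x], rule exI[of _ y]) (use c 5 in auto)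
      next case 6 show ?thesis by (rule exI[of _ z], rule exI[of _ y], rule exI[of _ x]) (use c 6 in auto)
      qed
    qed
    then obtain x y z where c: "Br = {x, y, z}" "x \<noteq> y" "y \<noteq> z" "x \<noteq> z" "e x \<le> e y" "e y \<le> e z" by blast
    have "n x + n y + n z = d + 2" using S d c by simp
    then have "e x = 2 \<and> (e y = 2 \<and> n z = 2 \<or> e y = 3 \<and> e z = 3 \<and> d = 12 \<or> e y = 3 \<and> e z = 4 \<and> d = 24 \<or>
        e y = 3 \<and> e z = 5 \<and> d = 60)"
      using signature_of_three[of "n x" "e x" d "n y" "e y" "n z" "e z"] ne e c by simp
    then show ?thesis
    proof (elim conjE disjE)
      assume "e x = 2" "e y = 2" "n z = 2"
      then show ?thesis using that(3)[of x y z] c by auto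
    next
      assume "e x = 2" "e y = 3" "e z = 3" "d = 12"
      then show ?thesis using that(3)[of y z x] c by auto
    next
      assume "e x = 2" "e y = 3" "e z = 4" "d = 24"
      then show ?thesis using that(3)[of y z x] c by auto
    next
      assume "e x = 2" "e y = 3" "e z = 5" "d = 60"
      then show ?thesis using that(3)[of y z x] c by auto
    qed
  qed
qed

subsection \<open>Coprime factors of a perfect power\<close>

lemma complex_root_exists:
  fixes c :: complex
  assumes "k \<ge> 1"
  obtains z where "z ^ k = c" "c \<noteq> 0 \<Longrightarrow> z \<noteq> 0"
proof (cases "c = 0")
  case True
  then show ?thesis using assms that[of 0] by (simp add: zero_power)
next
  case False
  have "exp (Ln c / of_nat k) ^ k = exp (of_nat k * (Ln c / of_nat k))" by (rule exp_of_nat_mult[symmetric])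
  also have "\<dots> = c" using assms False by simp
  finally show ?thesis using that[of "exp (Ln c / of_nat k)"] by simp
qed

lemma perfect_power_if_orders:
  fixes p :: "complex poly"
  assumes "k \<ge> 1" "\<And>z. k dvd order z p" "p \<noteq> 0"
  obtains s where "p = s ^ k" "degree p = k * degree s"
proof -
  obtain c where c: "c ^ k = lead_coeff p" by (rule complex_root_exists[OF assms(1)])
  define s where "s = smult c (\<Prod>z|poly p z = 0. [:- z, 1:] ^ (order z p div k))"
  have "(\<Prod>z|poly p z = 0. [:- z, 1:] ^ (order z p div k)) ^ k = (\<Prod>z|poly p z = 0. [:- z, 1:] ^ order z p)"
    unfolding prod_power_distrib power_mult[symmetric] using assms(2) by simp
  then have "s ^ k = p" unfolding s_def smult_power c by (simp add: complex_poly_decompose)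
  moreover have "s \<noteq> 0" using calculation assms by (auto simp: zero_power)
  ultimately show ?thesis using that[of s] by (metis degree_power_eq)
qed

text \<open>Multiplicities of roots of the product are divisible by k, and the two factors do not share roots.\<close>

lemma coprime_factor_of_power:
  fixes p q r :: "complex poly"
  assumes k: "k \<ge> 1" and eq: "p * q = smult c (r ^ k)" and c: "c \<noteq> 0" and r: "r \<noteq> 0"
    and cop: "\<And>z. poly p z = 0 \<Longrightarrow> poly q z \<noteq> 0"
  obtains s where "p = s ^ k" "degree p = k * degree s"
proof -
  have pq: "p * q \<noteq> 0" unfolding eq using c r by simp
  have "k dvd order z p" for z
  proof (cases "poly p z = 0")
    case True
    then have "order z q = 0" using cop by (intro order_0I)
    then have "order z p = order z (p * q)" using order_mult[OF pq] by simp
    also have "\<dots> = order z (r ^ k)" unfolding eq using c by (simp add: order_smult)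
    also have "\<dots> = k * order z r" using r by (induction k) (auto simp: order_mult)
    finally show ?thesis by simp
  qed (simp add: order_0I)
  then show ?thesis using perfect_power_if_orders[OF k] pq that by (metis mult_zero_left)
qed

subsection \<open>Changing coordinates by two linear polynomials\<close>

text \<open>The two polynomials, as linear forms, are the coordinates of an invertible linear change.\<close>

definition independent_linear :: "complex poly \<Rightarrow> complex poly \<Rightarrow> bool" where
  "independent_linear u v \<longleftrightarrow> degree u \<le> 1 \<and> degree v \<le> 1 \<and> coeff u 1 * coeff v 0 \<noteq> coeff u 0 * coeff v 1"

lemma lr_equiv_of_linear:
  assumes "independent_linear u v"
  shows "lr_equiv F G (\<lambda>x y. F (hom_eval 1 u x y) (hom_eval 1 v x y)) (\<lambda>x y. G (hom_eval 1 u x y) (hom_eval 1 v x y))"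
  using assms unfolding independent_linear_def
  by (intro lr_equivI[of "(coeff u 1, coeff u 0, coeff v 1, coeff v 0)" "(1, 0, 0, 1)"])
     (simp_all add: hom_eval_linear[unfolded One_nat_def] algebra_simps)

lemma independent_if_no_common_root:
  fixes u v p q :: "complex poly"
  assumes deg: "degree u \<le> 1" "degree v \<le> 1"
    and cop: "\<And>z. poly u z = 0 \<Longrightarrow> poly v z \<noteq> 0" and nonconst: "degree u = 1 \<or> degree v = 1"
  shows "independent_linear u v"
  unfolding independent_linear_def
proof (intro conjI deg notI)
  assume det: "coeff u 1 * coeff v 0 = coeff u 0 * coeff v 1"
  have u: "poly u z = coeff u 0 + coeff u 1 * z" and v: "poly v z = coeff v 0 + coeff v 1 * z" for z
    using hom_eval_1[OF deg(1), of z] hom_eval_1[OF deg(2), of z] by (simp_all only: hom_eval_linear) simp_all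
  show False
  proof (cases "coeff u 1 = 0")
    case False
    then show False using cop[of "- coeff u 0 / coeff u 1"] det by (simp add: u v field_simps)
  next
    case True
    then have "coeff v 1 \<noteq> 0" using nonconst by (metis leading_coeff_0_iff degree_0 zero_neq_one)
    then show False using cop[of "- coeff v 0 / coeff v 1"] det True by (simp add: u v field_simps)
  qed
qed

text \<open>The factors p - q and p + q are coprime, hence both are n-th powers, and comparing degrees the roots u and
  v are linear.\<close>

lemma dihedral_equation:
  fixes p q r :: "complex poly"
  assumes n: "n \<ge> 1" and deg: "degree p \<le> n" "degree q \<le> n" "degree p = n \<or> degree q = n"
    and cop: "\<And>z. poly p z = 0 \<Longrightarrow> poly q z \<noteq> 0"
    and eq: "p\<^sup>2 - q\<^sup>2 = smult c (r ^ n)" "c \<noteq> 0" "r \<noteq> 0"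
  obtains u v where "independent_linear u v" "smult 2 p = u ^ n + v ^ n" "smult 2 q = v ^ n - u ^ n"
proof -
  have prod: "(p - q) * (p + q) = smult c (r ^ n)" using eq(1) by (simp add: power2_eq_square algebra_simps)
  have c1: "poly (p + q) z \<noteq> 0" if "poly (p - q) z = 0" for z
  proof
    assume "poly (p + q) z = 0"
    then have "poly p z = 0" "poly q z = 0" using that by (auto simp: add_eq_0_iff)
    then show False using cop by blast
  qed
  obtain u where u: "p - q = u ^ n" "degree (p - q) = n * degree u"
    using coprime_factor_of_power[OF n prod eq(2,3) c1] by blast
  have prod': "(p + q) * (p - q) = smult c (r ^ n)" using prod by (simp add: mult.commute)
  obtain v where v: "p + q = v ^ n" "degree (p + q) = n * degree v"
    using coprime_factor_of_power[OF n prod' eq(2,3)] c1 by blast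
  have "n * degree u \<le> n * 1" "n * degree v \<le> n * 1"
    using u(2) v(2) degree_diff_le[OF deg(1,2)] degree_add_le[OF deg(1,2)] by simp_all
  then have uv1: "degree u \<le> 1" "degree v \<le> 1" using n by auto
  have p2: "smult 2 p = u ^ n + v ^ n" and q2: "smult 2 q = v ^ n - u ^ n"
    by (rule poly_eqI_infinite[OF infinite_UNIV_char_0], simp flip: u(1) v(1))+
  have "independent_linear u v"
  proof (rule independent_if_no_common_root[OF uv1])
    show "poly v z \<noteq> 0" if "poly u z = 0" for z
      using c1[of z] that n by (auto simp: u v zero_power)
    show "degree u = 1 \<or> degree v = 1"
    proof (rule ccontr)
      assume "\<not> ?thesis"
      then have "degree (p - q) = 0" "degree (p + q) = 0" using uv1 u(2) v(2) by auto
      then have "degree ((p - q) + (p + q)) \<le> 0" "degree ((p + q) - (p - q)) \<le> 0"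
        using degree_add_le[of "p - q" 0 "p + q"] degree_diff_le[of "p + q" 0 "p - q"] by auto
      moreover have "(p - q) + (p + q) = smult 2 p" "(p + q) - (p - q) = smult 2 q"
        by (rule poly_eqI_infinite[OF infinite_UNIV_char_0], simp)+
      ultimately show False using deg n by auto
    qed
  qed
  then show ?thesis using that p2 q2 by blast
qed

definition omega3 :: complex where "omega3 = (- 1 + \<i> * complex_of_real (sqrt 3)) / 2"

definition tet :: complex where "tet = 2 * \<i> * complex_of_real (sqrt 3)"

lemma tet_square: "tet * tet = -12"
proof -
  have "complex_of_real (sqrt 3) * complex_of_real (sqrt 3) = 3" by (simp flip: of_real_mult)
  then show ?thesis unfolding tet_def by (simp add: algebra_simps)
qed

lemma omega3_tet: "omega3 = (- 2 + tet) / 4"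
  by (simp add: omega3_def tet_def field_simps)

lemma omega3: "omega3 * omega3 + omega3 + 1 = 0" "omega3 ^ 3 = 1" "2 * (omega3 - omega3 * omega3) = tet" "omega3 \<noteq> 1"
proof -
  have sq: "omega3 * omega3 = (- 2 - tet) / 4"
    unfolding omega3_tet using tet_square by (simp add: field_simps)
  show 1: "omega3 * omega3 + omega3 + 1 = 0" unfolding sq unfolding omega3_tet by (simp add: field_simps)
  show "2 * (omega3 - omega3 * omega3) = tet" unfolding sq unfolding omega3_tet by (simp add: field_simps)
  have "omega3 ^ 3 - 1 = (omega3 - 1) * (omega3 * omega3 + omega3 + 1)" by (simp add: power3_eq_cube algebra_simps)
  then show "omega3 ^ 3 = 1" using 1 by simp
  show "omega3 \<noteq> 1" using 1 by auto
qed

definition tet_plus :: "'a::comm_ring_1 \<Rightarrow> 'a \<Rightarrow> 'a \<Rightarrow> 'a" where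
  "tet_plus k u v = u ^ 4 + k * u\<^sup>2 * v\<^sup>2 + v ^ 4"

text \<open>The three factors \<open>p - \<omega>\<^sup>i q\<close> are coprime, hence squares \<open>s\<^sub>i\<^sup>2\<close>. Being combinations of p and q they
  satisfy a linear relation, which is a conic in the \<open>s\<^sub>i\<close>; factoring it again exhibits two more squares,
  of linear polynomials u and v, and all other polynomials can be expressed by them.\<close>

lemma tetrahedral_equation:
  fixes p q r :: "complex poly"
  assumes deg: "degree p \<le> 4" "degree q \<le> 4" "degree p = 4 \<or> degree q = 4"
    and cop: "\<And>z. poly p z = 0 \<Longrightarrow> poly q z \<noteq> 0"
    and eq: "p ^ 3 - q ^ 3 = r\<^sup>2" "r \<noteq> 0"
  obtains u v where "independent_linear u v"
    "smult (4 * (1 - omega3)) p = tet_plus [:- tet:] u v" "smult (4 * (1 - omega3)) q = smult omega3 (tet_plus [:tet:] u v)"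
proof -
  let ?w = omega3
  have w: "?w * ?w + ?w + 1 = 0" by (rule omega3)
  define f0 f1 f2 where "f0 = p - q" and "f1 = p - smult ?w q" and "f2 = p - smult (?w * ?w) q"
  have fprod: "f0 * f1 * f2 = r\<^sup>2"
  proof (rule poly_eqI_infinite[OF infinite_UNIV_char_0])
    fix x
    have "(P - Q) * (P - ?w * Q) * (P - ?w * ?w * Q) = P ^ 3 - Q ^ 3" for P Q :: complex using w by algebra
    then show "poly (f0 * f1 * f2) x = poly (r\<^sup>2) x" by (simp add: f0_def f1_def f2_def flip: eq(1))
  qed
  have w1: "?w \<noteq> 1" "?w * ?w \<noteq> 1" "?w \<noteq> ?w * ?w" "?w \<noteq> 0"
  proof -
    show "?w \<noteq> 1" by (rule omega3)
    show "?w * ?w \<noteq> 1" using w omega3(2) \<open>?w \<noteq> 1\<close> by (metis mult_1 power3_eq_cube)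
    show "?w \<noteq> 0" using omega3(2) by auto
    then show "?w \<noteq> ?w * ?w" using \<open>?w \<noteq> 1\<close> by simp
  qed
  have pair: "poly p z = 0 \<and> poly q z = 0" if "poly p z - a * poly q z = 0" "poly p z - b * poly q z = 0" "a \<noteq> b" for a b z
  proof -
    have "(a - b) * poly q z = 0" using that by (simp add: algebra_simps)
    then show ?thesis using that by auto
  qed
  have no_two: "\<not> (poly f0 z = 0 \<and> poly f1 z = 0)" "\<not> (poly f0 z = 0 \<and> poly f2 z = 0)" "\<not> (poly f1 z = 0 \<and> poly f2 z = 0)" for z
  proof -
    have n: "\<not> (poly p z - a * poly q z = 0 \<and> poly p z - b * poly q z = 0)" if "a \<noteq> b" for a b
      using pair[of z a b] cop[of z] that by blast
    show "\<not> (poly f0 z = 0 \<and> poly f1 z = 0)" using n[of 1 ?w] w1(1) by (simp add: f0_def f1_def)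
    show "\<not> (poly f0 z = 0 \<and> poly f2 z = 0)" using n[of 1 "?w * ?w"] w1(2) by (simp add: f0_def f2_def)
    show "\<not> (poly f1 z = 0 \<and> poly f2 z = 0)" using n[of ?w "?w * ?w"] w1(3) by (simp add: f1_def f2_def)
  qed
  have e: "f0 * (f1 * f2) = smult 1 (r\<^sup>2)" "f1 * (f0 * f2) = smult 1 (r\<^sup>2)" "f2 * (f0 * f1) = smult 1 (r\<^sup>2)"
    using fprod by (simp_all add: mult_ac)
  obtain s0 where s0: "f0 = s0\<^sup>2" "degree f0 = 2 * degree s0"
    by (rule coprime_factor_of_power[OF _ e(1) _ eq(2)]) (use no_two in auto)
  obtain s1 where s1: "f1 = s1\<^sup>2" "degree f1 = 2 * degree s1"
    by (rule coprime_factor_of_power[OF _ e(2) _ eq(2)]) (use no_two in auto)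
  obtain s2 where s2: "f2 = s2\<^sup>2" "degree f2 = 2 * degree s2"
    by (rule coprime_factor_of_power[OF _ e(3) _ eq(2)]) (use no_two in auto)
  have degf: "degree f0 \<le> 4" "degree f1 \<le> 4"
    unfolding f0_def f1_def by (rule degree_le, use deg in \<open>auto simp: coeff_eq_0\<close>)+
  then have degs: "degree s0 \<le> 2" "degree s1 \<le> 2" using s0(2) s1(2) by auto
  \<comment> \<open>With this k the combination \<open>s\<^sub>0\<^sup>2 - k\<^sup>2 s\<^sub>1\<^sup>2\<close> is the multiple of \<open>s\<^sub>2\<^sup>2\<close> in the linear relation.\<close>
  define k where "k = \<i> * (?w * ?w)"
  have k2: "k * k = - ?w"
  proof -
    have "?w * ?w * (?w * ?w) = ?w" using omega3(2) by (simp add: power3_eq_cube mult_ac)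
    moreover have "k * k = - (?w * ?w * (?w * ?w))" by (simp add: k_def algebra_simps)
    ultimately show ?thesis by simp
  qed
  define A1 A2 where "A1 = s0 + smult k s1" and "A2 = s0 - smult k s1"
  have Aprod: "A1 * A2 = smult (- (?w * ?w)) (s2\<^sup>2)"
  proof (rule poly_eqI_infinite[OF infinite_UNIV_char_0])
    fix x
    have sq: "(poly s0 x)\<^sup>2 = poly p x - poly q x" "(poly s1 x)\<^sup>2 = poly p x - ?w * poly q x" "(poly s2 x)\<^sup>2 = poly p x - ?w * ?w * poly q x"
      by (simp_all flip: poly_power s0(1) s1(1) s2(1) add: f0_def f1_def f2_def)
    have "poly (A1 * A2) x = (poly s0 x)\<^sup>2 - (k * k) * (poly s1 x)\<^sup>2"
      by (simp add: A1_def A2_def algebra_simps power2_eq_square)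
    also have "\<dots> = - (?w * ?w) * (poly s2 x)\<^sup>2" unfolding k2 sq using w by algebra
    finally show "poly (A1 * A2) x = poly (smult (- (?w * ?w)) (s2\<^sup>2)) x" by simp
  qed
  have "s2 \<noteq> 0" using fprod eq(2) by (auto simp: s2(1))
  have Acop: "poly A2 z \<noteq> 0" if "poly A1 z = 0" for z
  proof
    assume "poly A2 z = 0"
    then have "poly s0 z = 0" "k * poly s1 z = 0" using that by (auto simp: A1_def A2_def add_eq_0_iff)
    moreover have "k \<noteq> 0" using w1 by (simp add: k_def)
    ultimately have "poly f0 z = 0" "poly f1 z = 0" by (simp_all add: s0(1) s1(1))
    then show False using no_two by blast
  qed
  have cne: "- (?w * ?w) \<noteq> 0" using w1 by simp
  obtain u where u: "A1 = u\<^sup>2" "degree A1 = 2 * degree u"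
    using coprime_factor_of_power[OF _ Aprod cne \<open>s2 \<noteq> 0\<close> Acop] by auto
  have Aprod': "A2 * A1 = smult (- (?w * ?w)) (s2\<^sup>2)" using Aprod by (simp add: mult.commute)
  obtain v where v: "A2 = v\<^sup>2" "degree A2 = 2 * degree v"
    using coprime_factor_of_power[OF _ Aprod' cne \<open>s2 \<noteq> 0\<close>] Acop by auto
  have "degree A1 \<le> 2" "degree A2 \<le> 2"
    unfolding A1_def A2_def by (rule degree_le, use degs in \<open>auto simp: coeff_eq_0\<close>)+
  then have uv1: "degree u \<le> 1" "degree v \<le> 1" using u(2) v(2) by auto
  have pq: "smult (4 * (1 - ?w)) p = tet_plus [:- tet:] u v" "smult (4 * (1 - ?w)) q = smult ?w (tet_plus [:tet:] u v)"
  proof -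
    have pt: "4 * (1 - ?w) * poly p x = poly u x ^ 4 - tet * (poly u x)\<^sup>2 * (poly v x)\<^sup>2 + poly v x ^ 4 \<and>
      4 * (1 - ?w) * poly q x = ?w * (poly u x ^ 4 + tet * (poly u x)\<^sup>2 * (poly v x)\<^sup>2 + poly v x ^ 4)" for x
    proof -
      define P Q U V S0 S1 where "P = poly p x" "Q = poly q x" "U = poly u x" "V = poly v x" "S0 = poly s0 x" "S1 = poly s1 x"
      have h: "S0\<^sup>2 = P - Q" "S1\<^sup>2 = P - ?w * Q"
        unfolding P_Q_U_V_S0_S1_def by (simp_all flip: poly_power s0(1) s1(1) add: f0_def f1_def)
      have h2: "S0 + k * S1 = U\<^sup>2" "S0 - k * S1 = V\<^sup>2"
        unfolding P_Q_U_V_S0_S1_def by (simp_all flip: poly_power u(1) v(1) add: A1_def A2_def)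
      have "2 * S0 = U\<^sup>2 + V\<^sup>2" "2 * (k * S1) = U\<^sup>2 - V\<^sup>2" by (simp_all flip: h2)
      moreover have "4 * S0\<^sup>2 = (2 * S0)\<^sup>2" "4 * (k * k) * S1\<^sup>2 = (2 * (k * S1))\<^sup>2"
        by (simp_all add: power_mult_distrib power2_eq_square)
      ultimately have "4 * S0\<^sup>2 = (U\<^sup>2 + V\<^sup>2)\<^sup>2" "4 * (k * k) * S1\<^sup>2 = (U\<^sup>2 - V\<^sup>2)\<^sup>2"
        by (simp_all only:)
      then have a: "4 * (P - Q) = (U\<^sup>2 + V\<^sup>2)\<^sup>2" "- 4 * ?w * (P - ?w * Q) = (U\<^sup>2 - V\<^sup>2)\<^sup>2"
        unfolding h k2 by simp_all
      have "4 * (1 - ?w) * P = U ^ 4 - 2 * (?w - ?w * ?w) * U\<^sup>2 * V\<^sup>2 + V ^ 4"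
        using a w by algebra
      moreover have "4 * (1 - ?w) * Q = ?w * (U ^ 4 + 2 * (?w - ?w * ?w) * U\<^sup>2 * V\<^sup>2 + V ^ 4)"
        using a w by algebra
      ultimately show ?thesis unfolding P_Q_U_V_S0_S1_def omega3(3) by blast
    qed
    show "smult (4 * (1 - ?w)) p = tet_plus [:- tet:] u v"
      by (rule poly_eqI_infinite[OF infinite_UNIV_char_0]) (use pt in \<open>simp add: tet_plus_def\<close>)
    show "smult (4 * (1 - ?w)) q = smult ?w (tet_plus [:tet:] u v)"
      by (rule poly_eqI_infinite[OF infinite_UNIV_char_0]) (use pt in \<open>simp add: tet_plus_def\<close>)
  qed
  have "independent_linear u v"
  proof (rule independent_if_no_common_root[OF uv1])
    show "poly v z \<noteq> 0" if "poly u z = 0" for z using Acop[of z] that by (auto simp: u v)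
    show "degree u = 1 \<or> degree v = 1"
    proof (rule ccontr)
      assume "\<not> ?thesis"
      then have "degree u = 0" "degree v = 0" using uv1 by auto
      then obtain cu cv where "u = [:cu:]" "v = [:cv:]" by (metis degree_eq_zeroE)
      then have "\<exists>c e. smult (4 * (1 - ?w)) p = [:c:] \<and> smult (4 * (1 - ?w)) q = [:e:]"
        unfolding pq by (simp add: tet_plus_def poly_const_pow)
      then obtain c e where ce: "smult (4 * (1 - ?w)) p = [:c:]" "smult (4 * (1 - ?w)) q = [:e:]" by blast
      have "4 * (1 - ?w) \<noteq> 0" using w1(1) by simp
      then have "degree p = degree [:c:]" "degree q = degree [:e:]" unfolding ce[symmetric] by simp_all
      then show False using deg(3) by auto
    qed
  qed
  then show ?thesis using that pq by blast
qed

section \<open>The icosahedral equation\<close>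

text \<open>Up to a factor, the Hessian of the form of degree n with dehomogenization f.\<close>

definition hess :: "nat \<Rightarrow> complex poly \<Rightarrow> complex poly" where
  "hess n f = smult (of_nat n) (f * pderiv (pderiv f)) - smult (of_nat n - 1) ((pderiv f)\<^sup>2)"

text \<open>Up to a factor, the fourth transvectant of f with itself, for f of formal degree 12.\<close>

definition transvectant4 :: "complex poly \<Rightarrow> complex poly" where
  "transvectant4 f = smult 22 (f * pderiv (pderiv (pderiv (pderiv f)))) - smult 66 (pderiv f * pderiv (pderiv (pderiv f)))
     + smult 45 ((pderiv (pderiv f))\<^sup>2)"

lemma numeral_mult_smult: "numeral k * p = smult (numeral k) (p :: complex poly)"
  by (simp add: numeral_poly)

lemma coprime_if_no_common_root:
  fixes p q :: "complex poly"
  assumes "\<And>z. poly p z = 0 \<Longrightarrow> poly q z \<noteq> 0"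
  shows "coprime p q"
proof (rule coprimeI)
  fix c assume c: "c dvd p" "c dvd q"
  show "is_unit c"
  proof (rule ccontr)
    assume "\<not> is_unit c"
    moreover have "c \<noteq> 0"
    proof
      assume "c = 0"
      then have "p = 0" "q = 0" using c by auto
      then show False using assms[of 0] by simp
    qed
    ultimately have "degree c \<noteq> 0" by (simp add: is_unit_iff_degree)
    then obtain t where "poly c t = 0"
      using fundamental_theorem_of_algebra[of c] by (auto simp: constant_degree)
    then have "poly p t = 0" "poly q t = 0" using c by (auto elim!: dvdE)
    then show False using assms by blast
  qed
qed

text \<open>The weights are chosen to cancel the leading terms.\<close>

lemma degree_jacobian:
  fixes p q :: "complex poly"
  assumes "\<alpha> * of_nat (degree p) = \<beta> * of_nat (degree q)" "degree p \<ge> 1" "degree q \<ge> 1"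
  shows "degree (smult \<alpha> (pderiv p * q) - smult \<beta> (p * pderiv q)) \<le> degree p + degree q - 2"
proof -
  let ?m = "degree p" and ?n = "degree q" and ?X = "smult \<alpha> (pderiv p * q) - smult \<beta> (p * pderiv q)"
  have dp: "degree (pderiv p) = ?m - 1" "degree (pderiv q) = ?n - 1" by (simp_all add: degree_pderiv)
  have "coeff (pderiv p * q) (?m - 1 + ?n) = of_nat ?m * lead_coeff p * lead_coeff q"
    using coeff_mult_degree_sum[of "pderiv p" q] assms(2) by (simp add: dp coeff_pderiv)
  moreover have "coeff (p * pderiv q) (?m - 1 + ?n) = lead_coeff p * (of_nat ?n * lead_coeff q)"
  proof -
    have "?m - 1 + ?n = ?m + (?n - 1)" using assms by simp
    then show ?thesis using coeff_mult_degree_sum[of p "pderiv q"] assms(3) by (simp add: dp coeff_pderiv)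
  qed
  ultimately have "coeff ?X (?m - 1 + ?n) = (\<alpha> * of_nat ?m - \<beta> * of_nat ?n) * (lead_coeff p * lead_coeff q)"
    by (simp add: algebra_simps)
  then have top: "coeff ?X (?m - 1 + ?n) = 0" using assms(1) by simp
  show ?thesis
  proof (rule degree_le, safe)
    fix i assume i: "i > ?m + ?n - 2"
    show "coeff ?X i = 0"
    proof (cases "i = ?m - 1 + ?n")
      case False
      then have "i > ?m - 1 + ?n" "i > ?m + (?n - 1)" using i assms by auto
      then have "coeff (pderiv p * q) i = 0" "coeff (p * pderiv q) i = 0"
        using degree_mult_le[of "pderiv p" q] degree_mult_le[of p "pderiv q"] dp
        by (metis coeff_eq_0 le_less_trans)+
      then show ?thesis by simp
    qed (use top in simp)
  qed
qed

text \<open>Coprimality and comparison of degrees show that the Jacobian of P and Q is a constant multiple of R, and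
  then the other Jacobians of two of P, Q, R are multiples of powers of the third. Eliminating R, a certain
  combination Z of P and the Hessian of Q is divisible by the square of Q, and its degree is too small. So P is
  a multiple of the Hessian, and what is left of the equations says that a covariant of degree 2 of Q vanishes.\<close>

lemma icosahedral_equation:
  fixes P Q R :: "complex poly"
  assumes deg: "degree P = 20" "degree Q = 12" "degree R = 30" and eq: "P ^ 3 + Q ^ 5 = R\<^sup>2"
    and cop: "\<And>z. poly P z = 0 \<Longrightarrow> poly Q z \<noteq> 0"
  shows "\<exists>k. k \<noteq> 0 \<and> P = smult k (hess 12 Q)" "transvectant4 Q = 0"
proof -
  define P1 P2 Q1 Q2 R1 where D: "P1 = pderiv P" "P2 = pderiv P1" "Q1 = pderiv Q" "Q2 = pderiv Q1" "R1 = pderiv R"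
  have nz: "P \<noteq> 0" "Q \<noteq> 0" "R \<noteq> 0" using deg by auto
  have "pderiv (P ^ 3 + Q ^ 5) = pderiv (R\<^sup>2)" using eq by simp
  then have "smult 3 (P\<^sup>2 * P1) + smult 5 (Q ^ 4 * Q1) = smult 2 (R * R1)"
    by (simp add: D pderiv_add pderiv_power)
  then have d: "3 * P\<^sup>2 * P1 + 5 * Q ^ 4 * Q1 = 2 * R * R1" by (simp add: numeral_mult_smult)
  \<comment> \<open>X is the Jacobian of P and Q.\<close>
  define X where "X = 3 * P1 * Q - 5 * P * Q1"
  have X_smult: "X = smult 3 (pderiv P * Q) - smult 5 (P * pderiv Q)"
    by (simp add: X_def D numeral_mult_smult)
  have a1: "P\<^sup>2 * X = R * (2 * R1 * Q - 5 * R * Q1)" using d eq unfolding X_def by algebra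
  have a2: "Q ^ 4 * (- X) = R * (2 * R1 * P - 3 * P1 * R)" using d eq unfolding X_def by algebra
  have copPQ: "coprime P Q" by (rule coprime_if_no_common_root[OF cop])
  have "coprime R P"
  proof (rule coprime_if_no_common_root)
    fix z assume "poly R z = 0"
    then have "poly P z ^ 3 + poly Q z ^ 5 = 0" using arg_cong[OF eq, of "\<lambda>p. poly p z"] by simp
    then show "poly P z \<noteq> 0" using cop[of z] by auto
  qed
  then have "R dvd X" using a1 by (metis coprime_dvd_mult_right_iff coprime_power_right_iff dvd_triv_left)
  then obtain S where S: "X = R * S" by (rule dvdE)
  have degX: "degree X \<le> 30"
    unfolding X_smult using degree_jacobian[of 3 P 5 Q] deg by simp
  have X0: "X \<noteq> 0"
  proof
    assume "X = 0"
    then have "P dvd 3 * P1 * Q" unfolding X_def by (metis dvd_triv_left eq_iff_diff_eq_0 mult.assoc mult.left_commute)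
    then have "P dvd 3 * P1" using copPQ by (simp add: coprime_dvd_mult_left_iff)
    moreover have "3 * P1 \<noteq> 0" using deg by (simp add: D pderiv_eq_0_iff)
    ultimately have "degree P \<le> degree (3 * P1)" by (rule dvd_imp_degree_le)
    moreover have "degree (3 * P1) \<le> 19"
      using degree_mult_le[of 3 P1] deg by (simp add: D degree_pderiv)
    ultimately show False using deg by simp
  qed
  then have "degree S = 0" using degX deg nz degree_mult_eq[of R S] by (auto simp: S)
  then obtain \<rho> where \<rho>: "S = [:\<rho>:]" by (rule degree_eq_zeroE)
  have \<rho>0: "\<rho> \<noteq> 0" using X0 S \<rho> by auto
  define c where "c = [:\<rho>:]"
  have c0: "c \<noteq> 0" using \<rho>0 by (simp add: c_def)
  have XR: "X = c * R" using S \<rho> by (simp add: c_def)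
  have b1: "c * P\<^sup>2 = 2 * R1 * Q - 5 * R * Q1"
  proof -
    have "R * (c * P\<^sup>2) = R * (2 * R1 * Q - 5 * R * Q1)" using a1 XR by (simp add: mult_ac)
    then show ?thesis using nz(3) by simp
  qed
  have b2: "- c * Q ^ 4 = 2 * R1 * P - 3 * P1 * R"
  proof -
    have "R * (- c * Q ^ 4) = R * (2 * R1 * P - 3 * P1 * R)" using a2 XR by (simp add: mult_ac)
    then show ?thesis using nz(3) by (simp only: mult_cancel_left) simp
  qed
  have "pderiv X = c * R1" unfolding XR D c_def by (simp add: pderiv_smult)
  moreover have "pderiv X = 3 * P2 * Q - 2 * P1 * Q1 - 5 * P * Q2"
    unfolding X_smult
    by (rule poly_eqI_infinite[OF infinite_UNIV_char_0])
       (simp add: D pderiv_diff pderiv_smult pderiv_mult algebra_simps)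
  ultimately have R1: "c * R1 = 3 * P2 * Q - 2 * P1 * Q1 - 5 * P * Q2" by simp
  have R: "c * R = 3 * P1 * Q - 5 * P * Q1" using XR X_def by simp
  \<comment> \<open>These are the equations with R and its derivative eliminated.\<close>
  have E2: "c\<^sup>2 * P\<^sup>2 = 6 * P2 * Q\<^sup>2 - 19 * P1 * Q1 * Q + P * (25 * Q1\<^sup>2 - 10 * Q * Q2)"
    using b1 R R1 by algebra
  have E3: "- (c\<^sup>2) * Q ^ 4 = 6 * P * P2 * Q + 11 * P * P1 * Q1 - 10 * P\<^sup>2 * Q2 - 9 * P1\<^sup>2 * Q"
    using b2 R R1 by algebra
  have "P * (11 * P1 * Q1 - 10 * P * Q2) = Q * (9 * P1\<^sup>2 - 6 * P * P2 - c\<^sup>2 * Q ^ 3)"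
    using E3 by algebra
  then have "Q dvd P * (11 * P1 * Q1 - 10 * P * Q2)" by simp
  moreover have copQP: "coprime Q P" using copPQ by (simp add: coprime_commute)
  ultimately have "Q dvd 11 * P1 * Q1 - 10 * P * Q2" by (simp add: coprime_dvd_mult_right_iff)
  then obtain Y where Y: "11 * P1 * Q1 - 10 * P * Q2 = Q * Y" by (rule dvdE)
  define Z where "Z = 11 * c\<^sup>2 * P - 275 * Q1\<^sup>2 + 300 * Q * Q2"
  have ZQ: "P * Z = Q\<^sup>2 * (66 * P2 - 19 * Y)" unfolding Z_def using E2 Y by algebra
  then have "Q\<^sup>2 dvd P * Z" by simp
  then have "Q\<^sup>2 dvd Z" using copQP by (simp add: coprime_dvd_mult_right_iff)
  moreover have "degree Z \<le> 22"
  proof -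
    have dQ: "degree Q1 = 11" "degree Q2 = 10" using deg by (simp_all add: D degree_pderiv)
    have "degree (11 * c\<^sup>2 * P) \<le> 22"
    proof -
      have "11 * c\<^sup>2 * P = smult (11 * \<rho>\<^sup>2) P" by (rule poly_eqI_infinite[OF infinite_UNIV_char_0]) (simp add: c_def)
      then show ?thesis using deg degree_smult_le[of "11 * \<rho>\<^sup>2" P] by simp
    qed
    moreover have "degree (275 * Q1\<^sup>2) \<le> 22"
      using degree_power_le[of Q1 2] dQ by (simp add: numeral_mult_smult)
    moreover have "degree (300 * Q * Q2) \<le> 22"
      using degree_mult_le[of Q Q2] dQ deg by (simp add: numeral_mult_smult)
    ultimately show ?thesis unfolding Z_def by (intro degree_add_le degree_diff_le) auto
  qed
  moreover have "degree (Q\<^sup>2) = 24" using deg nz by (simp add: degree_power_eq)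
  ultimately have Z0: "Z = 0" using dvd_imp_degree_le[of "Q\<^sup>2" Z] by fastforce
  have hessQ: "hess 12 Q = 12 * Q * Q2 - 11 * Q1\<^sup>2"
    by (simp add: hess_def D numeral_mult_smult)
  have "smult (11 * \<rho>\<^sup>2) P = smult (- 25) (hess 12 Q)"
  proof -
    have "11 * c\<^sup>2 * P = - 25 * (12 * Q * Q2 - 11 * Q1\<^sup>2)" using Z0 unfolding Z_def by algebra
    moreover have "11 * c\<^sup>2 * P = smult (11 * \<rho>\<^sup>2) P" by (rule poly_eqI_infinite[OF infinite_UNIV_char_0]) (simp add: c_def)
    moreover have "- 25 * (12 * Q * Q2 - 11 * Q1\<^sup>2) = smult (- 25) (12 * Q * Q2 - 11 * Q1\<^sup>2)"
      by (simp only: mult_minus_left numeral_mult_smult smult_minus_left)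
    ultimately show ?thesis unfolding hessQ by simp
  qed
  from arg_cong[OF this, of "smult (1 / (11 * \<rho>\<^sup>2))"]
  have k: "P = smult (- 25 / (11 * \<rho>\<^sup>2)) (hess 12 Q)" using \<rho>0 by simp
  then show "\<exists>k. k \<noteq> 0 \<and> P = smult k (hess 12 Q)" using \<rho>0 by (intro exI[of _ "- 25 / (11 * \<rho>\<^sup>2)"]) simp
  have "66 * P2 - 19 * Y = 0" using ZQ Z0 nz by simp
  then have E: "66 * P2 * Q - 209 * P1 * Q1 + 190 * P * Q2 = 0" using Y by algebra
  define \<kappa> where "\<kappa> = - 25 / (11 * \<rho>\<^sup>2)"
  have \<kappa>0: "\<kappa> \<noteq> 0" using \<rho>0 by (simp add: \<kappa>_def)
  define Q3 Q4 where D2: "Q3 = pderiv Q2" "Q4 = pderiv Q3"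
  define h where "h = 12 * Q * Q2 - 11 * Q1\<^sup>2"
  have Ph: "P = smult \<kappa> h" using k hessQ by (simp add: \<kappa>_def h_def)
  have h_smult: "h = smult 12 (Q * Q2) - smult 11 (Q1 * Q1)"
    by (simp add: h_def numeral_mult_smult power2_eq_square)
  have h1: "pderiv h = smult 12 (Q * Q3) - smult 10 (Q1 * Q2)"
    unfolding h_smult by (simp add: pderiv_diff pderiv_smult pderiv_mult flip: D D2)
      (rule poly_eqI_infinite[OF infinite_UNIV_char_0], simp add: algebra_simps)
  have h2: "pderiv (pderiv h) = smult 12 (Q * Q4) + smult 2 (Q1 * Q3) - smult 10 (Q2 * Q2)"
    unfolding h1 by (simp add: pderiv_diff pderiv_smult pderiv_mult flip: D D2)
      (rule poly_eqI_infinite[OF infinite_UNIV_char_0], simp add: algebra_simps)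
  have PP: "P1 = smult \<kappa> (pderiv h)" "P2 = smult \<kappa> (pderiv (pderiv h))"
    unfolding D Ph by (simp_all add: pderiv_smult)
  have "poly Q z * (22 * poly Q z * poly Q4 z - 66 * poly Q1 z * poly Q3 z + 45 * (poly Q2 z)\<^sup>2) = 0" for z
  proof -
    define q q1 q2 q3 q4 where q: "q = poly Q z" "q1 = poly Q1 z" "q2 = poly Q2 z" "q3 = poly Q3 z" "q4 = poly Q4 z"
    have "\<kappa> * (66 * (12 * q * q4 + 2 * q1 * q3 - 10 * q2 * q2) * q - 209 * (12 * q * q3 - 10 * q1 * q2) * q1
        + 190 * (12 * q * q2 - 11 * q1 * q1) * q2) = 0"
      using arg_cong[OF E, of "\<lambda>p. poly p z"] unfolding PP unfolding h2 unfolding h1 unfolding Ph unfolding h_smult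
      by (simp add: q algebra_simps)
    then have "66 * (12 * q * q4 + 2 * q1 * q3 - 10 * q2 * q2) * q - 209 * (12 * q * q3 - 10 * q1 * q2) * q1
        + 190 * (12 * q * q2 - 11 * q1 * q1) * q2 = 0" using \<kappa>0 by simp
    then have "36 * (q * (22 * q * q4 - 66 * q1 * q3 + 45 * q2\<^sup>2)) = 0" by algebra
    then show ?thesis unfolding q by simp
  qed
  then have "Q * transvectant4 Q = 0"
    by (intro poly_eqI_infinite[OF infinite_UNIV_char_0]) (simp add: transvectant4_def mult_ac flip: D D2)
  then show "transvectant4 Q = 0" using nz by simp
qed

section \<open>The covariants under changes of coordinates\<close>

text \<open>The dehomogenized form of degree n after exchanging the two variables.\<close>

definition rev_form :: "nat \<Rightarrow> complex poly \<Rightarrow> complex poly" where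
  "rev_form n p = (\<Sum>i\<le>n. monom (coeff p (n - i)) i)"

lemma coeff_rev_form: "coeff (rev_form n p) i = (if i \<le> n then coeff p (n - i) else 0)"
  by (simp add: rev_form_def coeff_sum)

lemma degree_rev_form: "degree (rev_form n p) \<le> n"
  by (rule degree_le) (simp add: coeff_rev_form)

lemma hom_eval_rev_form: "hom_eval n (rev_form n p) x y = hom_eval n p y x"
proof -
  have "hom_eval n (rev_form n p) x y = (\<Sum>i\<le>n. coeff p (n - i) * x ^ i * y ^ (n - i))"
    by (simp add: hom_eval_def coeff_rev_form)
  also have "\<dots> = (\<Sum>i\<le>n. coeff p i * y ^ i * x ^ (n - i))"
    by (rule sum.reindex_bij_witness[of _ "\<lambda>i. n - i" "\<lambda>i. n - i"]) (auto simp: mult_ac)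
  finally show ?thesis by (simp add: hom_eval_def)
qed

lemma poly_rev_form:
  assumes "degree p \<le> n" "t \<noteq> 0"
  shows "poly (rev_form n p) t = t ^ n * poly p (1 / t)"
  using hom_eval_rev_form[of n p t 1] hom_eval_eq[OF assms, of 1] hom_eval_1[OF degree_rev_form[of n p], of t] by simp

lemma poly_pderiv_eq:
  fixes p :: "complex poly"
  assumes "\<And>t. t \<noteq> 0 \<Longrightarrow> poly p t = h t" "t \<noteq> 0" "(h has_field_derivative h') (at t)"
  shows "poly (pderiv p) t = h'"
proof -
  have "(h has_field_derivative poly (pderiv p) t) (at t)"
    by (rule has_field_derivative_transform_within_open[OF poly_DERIV, of "- {0}"]) (use assms in auto)
  then show ?thesis using assms(3) DERIV_unique by blast
qed

lemma DERIV_poly_inverse: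
  fixes p :: "complex poly"
  assumes "t \<noteq> 0"
  shows "((\<lambda>t. t ^ Suc (Suc k) * poly p (1 / t)) has_field_derivative
    (of_nat k + 2) * t ^ Suc k * poly p (1 / t) - t ^ k * poly (pderiv p) (1 / t)) (at t)"
proof -
  have "((\<lambda>t. 1 / t) has_field_derivative - (1 / (t * t))) (at t)"
    using assms by (auto intro!: derivative_eq_intros simp: power2_eq_square)
  then have "((\<lambda>t. poly p (1 / t)) has_field_derivative poly (pderiv p) (1 / t) * (- (1 / (t * t)))) (at t)"
    by (rule DERIV_chain2[OF poly_DERIV])
  then have 2: "((\<lambda>t. poly p (1 / t)) has_field_derivative poly (pderiv p) (1 / t) * (- (1 / (t * t)))) (at t)" .
  have 1: "((\<lambda>t. t ^ Suc (Suc k)) has_field_derivative of_nat (Suc (Suc k)) * t ^ Suc k) (at t)"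
    by (rule DERIV_cong[OF DERIV_power_Suc[OF DERIV_ident]]) simp
  show ?thesis
    by (rule DERIV_cong[OF DERIV_mult[OF 1 2]]) (use assms in \<open>simp add: field_simps\<close>)
qed

text \<open>The degree is written as n + 8 to keep all exponents free of truncated subtractions.\<close>

lemma rev_form_derivatives:
  fixes f g :: "complex poly" and n :: nat
  assumes f: "degree f \<le> n + 8" and g_def: "g = rev_form (n + 8) f" and t: "t \<noteq> 0"
  defines "N \<equiv> of_nat n + (8::complex)"
  defines "F \<equiv> poly f (1 / t)" and "F1 \<equiv> poly (pderiv f) (1 / t)" and "F2 \<equiv> poly (pderiv (pderiv f)) (1 / t)"
    and "F3 \<equiv> poly (pderiv (pderiv (pderiv f))) (1 / t)"
    and "F4 \<equiv> poly (pderiv (pderiv (pderiv (pderiv f)))) (1 / t)"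
  shows "poly g t = t ^ (n + 8) * F"
    "poly (pderiv g) t = N * t ^ (n + 7) * F - t ^ (n + 6) * F1"
    "poly (pderiv (pderiv g)) t = N * (N - 1) * t ^ (n + 6) * F - 2 * (N - 1) * t ^ (n + 5) * F1 + t ^ (n + 4) * F2"
    "poly (pderiv (pderiv (pderiv g))) t = N * (N - 1) * (N - 2) * t ^ (n + 5) * F - 3 * (N - 1) * (N - 2) * t ^ (n + 4) * F1
      + 3 * (N - 2) * t ^ (n + 3) * F2 - t ^ (n + 2) * F3"
    "poly (pderiv (pderiv (pderiv (pderiv g)))) t = N * (N - 1) * (N - 2) * (N - 3) * t ^ (n + 4) * F
      - 4 * (N - 1) * (N - 2) * (N - 3) * t ^ (n + 3) * F1 + 6 * (N - 2) * (N - 3) * t ^ (n + 2) * F2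
      - 4 * (N - 3) * t ^ (n + 1) * F3 + t ^ n * F4"
proof -
  have D: "((\<lambda>t. c * t ^ (k + 2) * poly p (1 / t)) has_field_derivative
      c * ((of_nat k + 2) * t ^ (k + 1) * poly p (1 / t) - t ^ k * poly (pderiv p) (1 / t))) (at t)"
    if "t \<noteq> 0" for c t and k and p :: "complex poly"
    using DERIV_cmult[OF DERIV_poly_inverse[OF that, of k p], of c] by (simp add: mult.assoc)
  have e: "n + 8 = (n + 6) + 2" "n + 7 = (n + 5) + 2" "n + 6 = (n + 4) + 2" "n + 5 = (n + 3) + 2"
    "n + 4 = (n + 2) + 2" "n + 3 = (n + 1) + 2" "n + 2 = n + 2" by simp_all
  have g0: "poly g t = 1 * t ^ (n + 8) * poly f (1 / t)" if "t \<noteq> 0" for t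
    using poly_rev_form[OF f that] by (simp add: g_def)
  have g1: "poly (pderiv g) t = N * t ^ (n + 7) * poly f (1 / t) + - 1 * t ^ (n + 6) * poly (pderiv f) (1 / t)" if "t \<noteq> 0" for t
    using poly_pderiv_eq[OF g0 that D[OF that, of 1 "n + 6" f, folded e]] by (simp add: N_def algebra_simps)
  have g2: "poly (pderiv (pderiv g)) t = N * (N - 1) * t ^ (n + 6) * poly f (1 / t) + - 2 * (N - 1) * t ^ (n + 5) * poly (pderiv f) (1 / t)
      + 1 * t ^ (n + 4) * poly (pderiv (pderiv f)) (1 / t)" if "t \<noteq> 0" for t
  proof -
    have "n + 7 = (n + 5) + 2" "n + 6 = (n + 4) + 2" by simp_all
    note d = DERIV_add[OF D[OF that, of N "n + 5" f] D[OF that, of "- 1" "n + 4" "pderiv f"]]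
    have "poly (pderiv (pderiv g)) t = N * ((of_nat (n + 5) + 2) * t ^ (n + 5 + 1) * poly f (1 / t) - t ^ (n + 5) * poly (pderiv f) (1 / t))
      + - 1 * ((of_nat (n + 4) + 2) * t ^ (n + 4 + 1) * poly (pderiv f) (1 / t) - t ^ (n + 4) * poly (pderiv (pderiv f)) (1 / t))"
      by (rule poly_pderiv_eq[OF _ that d]) (simp add: g1 add.commute)
    then show ?thesis by (simp add: N_def algebra_simps power_add power_numeral_reduce)
  qed
  have g3: "poly (pderiv (pderiv (pderiv g))) t = N * (N - 1) * (N - 2) * t ^ (n + 5) * poly f (1 / t)
      + - 3 * (N - 1) * (N - 2) * t ^ (n + 4) * poly (pderiv f) (1 / t)
      + 3 * (N - 2) * t ^ (n + 3) * poly (pderiv (pderiv f)) (1 / t) + - 1 * t ^ (n + 2) * poly (pderiv (pderiv (pderiv f))) (1 / t)"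
    if "t \<noteq> 0" for t
  proof -
    note d = DERIV_add[OF DERIV_add[OF D[OF that, of "N * (N - 1)" "n + 4" f] D[OF that, of "- 2 * (N - 1)" "n + 3" "pderiv f"]]
        D[OF that, of 1 "n + 2" "pderiv (pderiv f)"]]
    have "poly (pderiv (pderiv (pderiv g))) t =
      N * (N - 1) * ((of_nat (n + 4) + 2) * t ^ (n + 4 + 1) * poly f (1 / t) - t ^ (n + 4) * poly (pderiv f) (1 / t))
      + - 2 * (N - 1) * ((of_nat (n + 3) + 2) * t ^ (n + 3 + 1) * poly (pderiv f) (1 / t) - t ^ (n + 3) * poly (pderiv (pderiv f)) (1 / t))
      + 1 * ((of_nat (n + 2) + 2) * t ^ (n + 2 + 1) * poly (pderiv (pderiv f)) (1 / t) - t ^ (n + 2) * poly (pderiv (pderiv (pderiv f))) (1 / t))"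
      by (rule poly_pderiv_eq[OF _ that d]) (simp add: g2 power_add power_numeral_reduce mult_ac)
    then show ?thesis by (simp add: N_def algebra_simps power_add power_numeral_reduce)
  qed
  have g4: "poly (pderiv (pderiv (pderiv (pderiv g)))) t = N * (N - 1) * (N - 2) * (N - 3) * t ^ (n + 4) * poly f (1 / t)
      + - 4 * (N - 1) * (N - 2) * (N - 3) * t ^ (n + 3) * poly (pderiv f) (1 / t)
      + 6 * (N - 2) * (N - 3) * t ^ (n + 2) * poly (pderiv (pderiv f)) (1 / t)
      + - 4 * (N - 3) * t ^ (n + 1) * poly (pderiv (pderiv (pderiv f))) (1 / t) + t ^ n * poly (pderiv (pderiv (pderiv (pderiv f)))) (1 / t)"
    if "t \<noteq> 0" for t
  proof -
    note d = DERIV_add[OF DERIV_add[OF DERIV_add[OF D[OF that, of "N * (N - 1) * (N - 2)" "n + 3" f]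
          D[OF that, of "- 3 * (N - 1) * (N - 2)" "n + 2" "pderiv f"]] D[OF that, of "3 * (N - 2)" "n + 1" "pderiv (pderiv f)"]]
        D[OF that, of "- 1" n "pderiv (pderiv (pderiv f))"]]
    have "poly (pderiv (pderiv (pderiv (pderiv g)))) t =
      N * (N - 1) * (N - 2) * ((of_nat (n + 3) + 2) * t ^ (n + 3 + 1) * poly f (1 / t) - t ^ (n + 3) * poly (pderiv f) (1 / t))
      + - 3 * (N - 1) * (N - 2) * ((of_nat (n + 2) + 2) * t ^ (n + 2 + 1) * poly (pderiv f) (1 / t) - t ^ (n + 2) * poly (pderiv (pderiv f)) (1 / t))
      + 3 * (N - 2) * ((of_nat (n + 1) + 2) * t ^ (n + 1 + 1) * poly (pderiv (pderiv f)) (1 / t) - t ^ (n + 1) * poly (pderiv (pderiv (pderiv f))) (1 / t))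
      + - 1 * ((of_nat n + 2) * t ^ (n + 1) * poly (pderiv (pderiv (pderiv f))) (1 / t) - t ^ n * poly (pderiv (pderiv (pderiv (pderiv f)))) (1 / t))"
      by (rule poly_pderiv_eq[OF _ that d]) (simp add: g3 power_add power_numeral_reduce mult_ac)
    then show ?thesis by (simp add: N_def algebra_simps power_add power_numeral_reduce)
  qed
  show "poly g t = t ^ (n + 8) * F"
    "poly (pderiv g) t = N * t ^ (n + 7) * F - t ^ (n + 6) * F1"
    "poly (pderiv (pderiv g)) t = N * (N - 1) * t ^ (n + 6) * F - 2 * (N - 1) * t ^ (n + 5) * F1 + t ^ (n + 4) * F2"
    "poly (pderiv (pderiv (pderiv g))) t = N * (N - 1) * (N - 2) * t ^ (n + 5) * F - 3 * (N - 1) * (N - 2) * t ^ (n + 4) * F1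
      + 3 * (N - 2) * t ^ (n + 3) * F2 - t ^ (n + 2) * F3"
    "poly (pderiv (pderiv (pderiv (pderiv g)))) t = N * (N - 1) * (N - 2) * (N - 3) * t ^ (n + 4) * F
      - 4 * (N - 1) * (N - 2) * (N - 3) * t ^ (n + 3) * F1 + 6 * (N - 2) * (N - 3) * t ^ (n + 2) * F2
      - 4 * (N - 3) * t ^ (n + 1) * F3 + t ^ n * F4"
    unfolding F_def F1_def F2_def F3_def F4_def g0[OF t] g1[OF t] g2[OF t] g3[OF t] g4[OF t] by (simp_all add: algebra_simps)
qed

lemma poly_eqI_nonzero:
  fixes p q :: "complex poly"
  assumes "\<And>t. t \<noteq> 0 \<Longrightarrow> poly p t = poly q t"
  shows "p = q"
  by (rule poly_eqI_infinite[of "UNIV - {0}"]) (use assms in \<open>auto simp: infinite_UNIV_char_0\<close>)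

text \<open>The next two lemmas express that transvectant and Hessian are covariants: with the affine substitutions,
  the inversion generates all changes of coordinates.\<close>

lemma transvectant4_rev_form:
  assumes f: "degree f \<le> 12" and 0: "transvectant4 f = 0"
  shows "transvectant4 (rev_form 12 f) = 0"
proof (rule poly_eqI_nonzero)
  fix t :: complex assume t: "t \<noteq> 0"
  note d = rev_form_derivatives[of f 4 "rev_form 12 f" t, OF _ _ t, simplified, OF f]
  define F F1 F2 F3 F4 where F: "F = poly f (1 / t)" "F1 = poly (pderiv f) (1 / t)" "F2 = poly (pderiv (pderiv f)) (1 / t)"
    "F3 = poly (pderiv (pderiv (pderiv f))) (1 / t)" "F4 = poly (pderiv (pderiv (pderiv (pderiv f)))) (1 / t)"
  have h: "22 * F * F4 - 66 * F1 * F3 + 45 * F2\<^sup>2 = 0"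
    using arg_cong[OF 0, of "\<lambda>p. poly p (1 / t)"] by (simp add: transvectant4_def F mult.assoc)
  have "poly (transvectant4 (rev_form 12 f)) t = t ^ 16 * (22 * F * F4 - 66 * F1 * F3 + 45 * F2\<^sup>2)"
    unfolding transvectant4_def poly_add poly_diff poly_smult poly_mult poly_power d F[symmetric]
    by algebra
  then show "poly (transvectant4 (rev_form 12 f)) t = poly 0 t" using h by simp
qed

lemma hess_rev_form:
  assumes f: "degree f \<le> n + 8" and t: "t \<noteq> 0"
  shows "poly (hess (n + 8) (rev_form (n + 8) f)) t = t ^ (2 * n + 12) * poly (hess (n + 8) f) (1 / t)"
proof -
  note d = rev_form_derivatives[OF f refl t]
  define F F1 F2 where F: "F = poly f (1 / t)" "F1 = poly (pderiv f) (1 / t)" "F2 = poly (pderiv (pderiv f)) (1 / t)"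
  define N s where "N = of_nat n + (8::complex)" and "s = t ^ n"
  have p: "t ^ (n + k) = s * t ^ k" "t ^ (2 * n + 12) = s * s * t ^ 12" for k
    by (simp_all add: s_def power_add power_mult power2_eq_square flip: power_mult_distrib)
  have N: "of_nat (n + 8) = N" by (simp add: N_def)
  have "poly (hess (n + 8) (rev_form (n + 8) f)) t =
      N * (s * t ^ 8 * F * (N * (N - 1) * (s * t ^ 6) * F - 2 * (N - 1) * (s * t ^ 5) * F1 + (s * t ^ 4) * F2))
      - (N - 1) * (N * (s * t ^ 7) * F - (s * t ^ 6) * F1)\<^sup>2"
    unfolding hess_def poly_diff poly_smult poly_mult poly_power d(1-3) F[symmetric] N N_def[symmetric] p(1) by simp
  also have "\<dots> = s * s * t ^ 12 * (N * (F * F2) - (N - 1) * F1\<^sup>2)" by algebra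
  finally show ?thesis
    unfolding p(2) hess_def poly_diff poly_smult poly_mult poly_power F[symmetric] N .
qed

lemma hess_affine: "hess n (pcompose f [:m, l:]) = smult (l\<^sup>2) (pcompose (hess n f) [:m, l:])"
  by (rule poly_eqI_infinite[OF infinite_UNIV_char_0])
     (simp add: hess_def pderiv_pcompose pderiv_mult pderiv_pCons pderiv_smult poly_pcompose power2_eq_square algebra_simps)

lemma hess_smult: "hess n (smult c f) = smult (c\<^sup>2) (hess n f)"
  by (rule poly_eqI_infinite[OF infinite_UNIV_char_0])
     (simp add: hess_def pderiv_smult power2_eq_square algebra_simps)

lemma transvectant4_affine: "transvectant4 (pcompose f [:m, l:]) = smult (l ^ 4) (pcompose (transvectant4 f) [:m, l:])"
  by (rule poly_eqI_infinite[OF infinite_UNIV_char_0])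
     (simp add: transvectant4_def pderiv_pcompose pderiv_mult pderiv_pCons pderiv_smult poly_pcompose power2_eq_square power4_eq_xxxx algebra_simps)

lemma transvectant4_smult: "transvectant4 (smult c f) = smult (c\<^sup>2) (transvectant4 f)"
  by (rule poly_eqI_infinite[OF infinite_UNIV_char_0])
     (simp add: transvectant4_def pderiv_smult power2_eq_square algebra_simps)

subsection \<open>The vertices of the icosahedron\<close>

text \<open>The form with the vertices of the icosahedron as zeros. One of the twelve is at infinity, which lowers
  the degree to 11.\<close>

definition icosa :: "complex poly" where "icosa = [:0, -1, 0, 0, 0, 0, 11, 0, 0, 0, 0, 1:]"

definition icosa_hess :: "complex poly" where
  "icosa_hess = [:1, 0, 0, 0, 0, 228, 0, 0, 0, 0, 494, 0, 0, 0, 0, -228, 0, 0, 0, 0, 1:]"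

lemma hess_icosa: "hess 12 icosa = smult (- 11) icosa_hess"
  by (simp add: hess_def icosa_def icosa_hess_def pderiv_pCons power2_eq_square)

text \<open>This identity is peculiar to the icosahedron. It fixes the factor in the symmetries of the form.\<close>

lemma hess_icosa_hess: "\<exists>k. k \<noteq> 0 \<and> hess 20 icosa_hess = smult k (icosa ^ 3)"
  by (rule exI[of _ "- 91200"]) (simp add: hess_def icosa_def icosa_hess_def pderiv_pCons power3_eq_cube power2_eq_square)

lemma transvectant4_icosa: "transvectant4 icosa = 0"
  by (simp add: transvectant4_def icosa_def pderiv_pCons power2_eq_square)

lemma coeff_translate_top:
  fixes p :: "complex poly"
  shows "degree p \<le> n \<Longrightarrow> coeff (pcompose p [:m, 1:]) n = coeff p n"
    "degree p \<le> Suc n \<Longrightarrow> coeff (pcompose p [:m, 1:]) n = coeff p n + of_nat (Suc n) * m * coeff p (Suc n)"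
proof -
  show top: "degree p \<le> n \<Longrightarrow> coeff (pcompose p [:m, 1:]) n = coeff p n" for p :: "complex poly" and n
  proof (induction p arbitrary: n)
    case (pCons a p)
    show ?case
    proof (cases n)
      case 0
      then have "p = 0" using pCons by (cases "p = 0") auto
      then show ?thesis using 0 by (simp add: pcompose_pCons)
    next
      case (Suc k)
      then have "degree p \<le> k" using pCons(3) by (cases "p = 0") auto
      moreover have "coeff (pcompose p [:m, 1:]) n = 0"
        using degree_pcompose_le[of p "[:m, 1:]"] \<open>degree p \<le> k\<close> Suc by (intro coeff_eq_0) simp
      ultimately show ?thesis using pCons(2) Suc by (simp add: pcompose_pCons coeff_pCons)
    qed
  qed simp
  show "degree p \<le> Suc n \<Longrightarrow> coeff (pcompose p [:m, 1:]) n = coeff p n + of_nat (Suc n) * m * coeff p (Suc n)"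
    for p :: "complex poly" and n
  proof (induction p arbitrary: n)
    case (pCons a p)
    have dp: "degree p \<le> n" using pCons(3) by (cases "p = 0") auto
    show ?case
    proof (cases n)
      case 0
      then obtain c where "p = [:c:]" using dp by (auto elim: degree_eq_zeroE)
      then show ?thesis using 0 by (simp add: pcompose_pCons)
    next
      case (Suc k)
      have "coeff (pcompose p [:m, 1:]) n = coeff p n" by (rule top[OF dp])
      moreover have "coeff (pcompose p [:m, 1:]) k = coeff p k + of_nat (Suc k) * m * coeff p (Suc k)"
        using pCons(2) dp Suc by simp
      ultimately show ?thesis using Suc by (simp add: pcompose_pCons coeff_pCons algebra_simps)
    qed
  qed simp
qed

section \<open>Uniqueness and symmetries of the icosahedral form\<close>

lemma explicit_degree_11:
  fixes g :: "complex poly"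
  assumes "degree g \<le> 11"
  shows "g = [:coeff g 0, coeff g 1, coeff g 2, coeff g 3, coeff g 4, coeff g 5, coeff g 6, coeff g 7, coeff g 8,
    coeff g 9, coeff g 10, coeff g 11:]" (is "_ = ?h")
proof (rule poly_eqI)
  fix n :: nat
  have "n = 0 \<or> n = 1 \<or> n = 2 \<or> n = 3 \<or> n = 4 \<or> n = 5 \<or> n = 6 \<or> n = 7 \<or> n = 8 \<or> n = 9 \<or> n = 10 \<or> n = 11 \<or> n > 11"
    by arith
  then show "coeff g n = coeff ?h n"
  proof (elim disjE)
    assume n: "n > 11"
    have "degree ?h \<le> 11" by simp
    then have "coeff ?h n = 0" using n by (rule coeff_eq_0[OF le_less_trans])
    moreover have "coeff g n = 0" using assms n by (rule coeff_eq_0[OF le_less_trans])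
    ultimately show ?thesis by (simp only:)
  qed (simp_all add: numeral_eq_Suc)
qed

text \<open>The vanishing of the transvectant is a recursion from the top coefficient down, in which only the
  sixth coefficient is free.\<close>

lemma transvectant4_recursion:
  fixes a0 a1 a2 a3 a4 a5 a6 a7 a8 a9 :: complex
  assumes 0: "transvectant4 [:a0, a1, a2, a3, a4, a5, a6, a7, a8, a9, 0, 1:] = 0"
  shows "a9 = 0" "a8 = 0" "a7 = 0" "a5 = 0" "a4 = 0" "a3 = 0" "a2 = 0" "a0 = 0" "121 * a1 + a6\<^sup>2 = 0"
proof -
  have z1: "a9 = 0 \<and> a8 = 0" using 0 by (simp add: transvectant4_def pderiv_pCons power2_eq_square)
  have z2: "a7 = 0" using 0 z1 by (simp add: transvectant4_def pderiv_pCons power2_eq_square)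
  have z3: "a5 = 0 \<and> a4 = 0 \<and> a3 = 0" using 0 z1 z2 by (simp add: transvectant4_def pderiv_pCons power2_eq_square)
  have z4: "a2 = 0" using 0 z1 z2 z3 by (simp add: transvectant4_def pderiv_pCons power2_eq_square)
  have "900 * (a6 * a6) + 108900 * a1 = 0"
    using 0 z1 z2 z3 z4 by (simp add: transvectant4_def pderiv_pCons power2_eq_square)
  moreover have "900 * (121 * a1 + a6\<^sup>2) = 900 * (a6 * a6) + 108900 * a1"
    by (simp add: power2_eq_square algebra_simps)
  ultimately have "900 * (121 * a1 + a6\<^sup>2) = 0" by (simp only:)
  then show "121 * a1 + a6\<^sup>2 = 0" by (metis mult_eq_0_iff zero_neq_numeral)
  have "a0 = 0" using 0 z1 z2 z3 z4 by (simp add: transvectant4_def pderiv_pCons power2_eq_square)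
  then show "a0 = 0" .
  show "a9 = 0" "a8 = 0" "a7 = 0" "a5 = 0" "a4 = 0" "a3 = 0" "a2 = 0" using z1 z2 z3 z4 by auto
qed

text \<open>A translation removes the coefficient next to the leading one, and the recursion then leaves the family
  \<open>t\<^sup>1\<^sup>1 + s t\<^sup>6 - (s/11)\<^sup>2 t\<close>. Two different roots exclude s = 0, and a scaling of t achieves s = 11.\<close>

lemma icosa_normal_form:
  fixes f :: "complex poly"
  assumes deg: "degree f = 11" and tv: "transvectant4 f = 0"
    and roots: "poly f p = 0" "poly f q = 0" "p \<noteq> q"
  obtains c l m where "c \<noteq> 0" "l \<noteq> 0" "f = smult c (pcompose icosa [:m, l:])"
proof -
  define k where "k = coeff f 11"
  have k: "k \<noteq> 0" using deg by (metis k_def leading_coeff_0_iff degree_0 zero_neq_numeral)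
  define \<mu> where "\<mu> = - coeff f 10 / (11 * k)"
  define g where "g = smult (1 / k) (pcompose f [:\<mu>, 1:])"
  have "degree (pcompose f [:\<mu>, 1:]) \<le> 11" using degree_pcompose_le[of f "[:\<mu>, 1:]"] deg by simp
  then have dg: "degree g \<le> 11" unfolding g_def using degree_smult_le order.trans by blast
  have g11: "coeff g 11 = 1"
    unfolding g_def coeff_smult using coeff_translate_top(1)[of f 11 \<mu>] deg k by (simp add: k_def)
  have "coeff (pcompose f [:\<mu>, 1:]) 10 = coeff f 10 + 11 * \<mu> * coeff f 11"
    using coeff_translate_top(2)[of f 10 \<mu>] deg by simp
  then have g10: "coeff g 10 = 0" using k by (simp add: g_def \<mu>_def flip: k_def)
  have "transvectant4 g = 0" by (simp add: g_def transvectant4_smult transvectant4_affine tv)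
  then have tvg: "transvectant4 [:coeff g 0, coeff g 1, coeff g 2, coeff g 3, coeff g 4, coeff g 5, coeff g 6,
      coeff g 7, coeff g 8, coeff g 9, 0, 1:] = 0"
    using explicit_degree_11[OF dg] unfolding g10 g11 by metis
  note rec = transvectant4_recursion[OF tvg]
  define s where "s = coeff g 6"
  have a1: "coeff g 1 = - (s / 11)\<^sup>2" using rec(9) by (simp add: s_def power_divide field_simps) (simp add: add_eq_0_iff)
  have g: "g = [:0, - (s / 11)\<^sup>2, 0, 0, 0, 0, s, 0, 0, 0, 0, 1:]"
    using explicit_degree_11[OF dg] unfolding g10 g11 rec(1-8) a1 s_def by metis
  have gval: "poly g t = t ^ 11 + s * t ^ 6 - (s / 11)\<^sup>2 * t" for t
    unfolding g by (simp add: algebra_simps power_numeral_reduce)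
  have "s \<noteq> 0"
  proof
    assume "s = 0"
    then have "poly g t = t ^ 11" for t by (simp add: gval)
    moreover have "poly g (t - \<mu>) = 1 / k * poly f t" for t by (simp add: g_def poly_pcompose)
    ultimately have "(t - \<mu>) ^ 11 = 1 / k * poly f t" for t by metis
    from this[of p] this[of q] have "(p - \<mu>) ^ 11 = 0" "(q - \<mu>) ^ 11 = 0" using roots by simp_all
    then have "p = \<mu>" "q = \<mu>" by auto
    then show False using roots(3) by simp
  qed
  obtain l where l: "l ^ 5 = 11 / s" "11 / s \<noteq> 0 \<Longrightarrow> l \<noteq> 0" using complex_root_exists[of 5 "11 / s"] by (metis one_le_numeral)
  have l0: "l \<noteq> 0" using l \<open>s \<noteq> 0\<close> by simp
  have s: "s = 11 / l ^ 5" using l(1) l0 \<open>s \<noteq> 0\<close> by (simp add: field_simps)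
  have icosa: "poly icosa t = t ^ 11 + 11 * t ^ 6 - t" for t
    by (simp add: icosa_def algebra_simps power_numeral_reduce)
  have "f = smult (k / l ^ 11) (pcompose icosa [:- l * \<mu>, l:])"
  proof (rule poly_eqI_infinite[OF infinite_UNIV_char_0])
    fix t
    have "poly f t = k * poly g (t - \<mu>)" using k by (simp add: g_def poly_pcompose)
    also have "poly g (t - \<mu>) = 1 / l ^ 11 * ((l * (t - \<mu>)) ^ 11 + 11 * (l * (t - \<mu>)) ^ 6 - l * (t - \<mu>))"
    proof -
      define v w where "v = t - \<mu>" and "w = l ^ 5"
      have lw: "l ^ 11 = w * w * l" "l ^ 6 = w * l" by (simp_all add: w_def flip: power_add power_Suc2)
      have w0: "w \<noteq> 0" using l0 by (simp add: w_def)
      have "v ^ 11 + 11 / w * v ^ 6 - (11 / w / 11)\<^sup>2 * v = 1 / (w * w * l) * (w * w * l * v ^ 11 + 11 * (w * l * v ^ 6) - l * v)"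
        using w0 l0 by (simp add: right_diff_distrib distrib_left power2_eq_square)
      then show ?thesis unfolding gval s power_mult_distrib lw w_def[symmetric] v_def[symmetric] .
    qed
    finally show "poly f t = poly (smult (k / l ^ 11) (pcompose icosa [:- l * \<mu>, l:])) t"
      by (simp add: poly_pcompose icosa algebra_simps)
  qed
  then show ?thesis using that[of "k / l ^ 11" l "- l * \<mu>"] k l0 by simp
qed

text \<open>Moving a simple zero to infinity lowers the degree from 12 to exactly 11, while the transvectant still
  vanishes.\<close>

lemma vertex_to_infinity:
  fixes f :: "complex poly"
  assumes deg: "degree f \<le> 12" and tv: "transvectant4 f = 0" and z: "poly f z = 0" "poly (pderiv f) z \<noteq> 0"
    and others: "poly f p = 0" "poly f q = 0" "p \<noteq> q" "p \<noteq> z" "q \<noteq> z"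
  obtains c l m where "c \<noteq> 0" "l \<noteq> 0" "rev_form 12 (pcompose f [:z, 1:]) = smult c (pcompose icosa [:m, l:])"
proof -
  let ?f = "pcompose f [:z, 1:]"
  have degf: "degree ?f \<le> 12" using degree_pcompose_le[of f "[:z, 1:]"] deg by simp
  have c0: "coeff ?f 0 = 0" using z(1) by (simp add: poly_pcompose flip: poly_0_coeff_0)
  have c1: "coeff ?f 1 \<noteq> 0"
  proof -
    have "coeff ?f 1 = poly (pderiv ?f) 0" by (simp add: poly_0_coeff_0 coeff_pderiv)
    then show ?thesis using z(2) by (simp add: pderiv_pcompose poly_pcompose pderiv_pCons)
  qed
  let ?g = "rev_form 12 ?f"
  have "degree ?g = 11"
  proof (rule antisym)
    show "degree ?g \<le> 11"
    proof (rule degree_le, safe)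
      fix i :: nat assume "11 < i"
      then show "coeff ?g i = 0" using c0 by (cases "i = 12") (auto simp: coeff_rev_form)
    qed
    show "11 \<le> degree ?g" using c1 by (intro le_degree) (simp add: coeff_rev_form)
  qed
  moreover have "transvectant4 ?g = 0"
    by (rule transvectant4_rev_form[OF degf]) (simp add: transvectant4_affine tv)
  moreover have "poly ?g (1 / (w - z)) = 0" if "poly f w = 0" "w \<noteq> z" for w
    using that by (subst poly_rev_form[OF degf]) (auto simp: poly_pcompose)
  moreover have "1 / (p - z) \<noteq> 1 / (q - z)" using others by simp
  ultimately show ?thesis using icosa_normal_form that others by metis
qed

subsection \<open>From polynomials to forms\<close>

lemma form_eqI:
  assumes "is_form n F" "is_form n G" "\<And>t. t \<noteq> 0 \<Longrightarrow> F t 1 = G t 1"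
  shows "F = G"
proof -
  obtain p q where p: "degree p \<le> n" "F = hom_eval n p" and q: "degree q \<le> n" "G = hom_eval n q"
    using assms(1,2) unfolding is_form_def by blast
  have "p = q" by (rule poly_eqI_nonzero) (use assms(3) p q in \<open>simp add: hom_eval_1\<close>)
  then show ?thesis using p q by simp
qed

lemma is_form_hom_eval: "degree p \<le> n \<Longrightarrow> is_form n (hom_eval n p)"
  unfolding is_form_def by blast

lemma is_form_subst:
  assumes "is_form n F"
  shows "is_form n (\<lambda>x y. F (m1 a x y) (m2 a x y))"
  using is_form_linear_change(1)[OF assms assms, of "(1, 0, 0, 1)" a] by simp

lemma is_form_cmult:
  assumes "is_form n F"
  shows "is_form n (\<lambda>x y. c * F x y)"
  using is_form_linear_change(1)[OF assms assms, of "(c, 0, 0, 1)" "(1, 0, 0, 1)"] by simp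

text \<open>The Hessian being a covariant, a normal form of the vertex form carries over to it.\<close>

lemma vertex_transport:
  assumes deg: "degree f \<le> 12" "degree (hess 12 f) \<le> 20"
    and nf: "rev_form 12 (pcompose f [:z, 1:]) = smult c (pcompose icosa [:m, l:])"
  defines "N \<equiv> (z, 1, 1, 0)" and "A \<equiv> (l, m, 0, 1)"
  shows "hom_eval 12 f (m1 N x y) (m2 N x y) = c * hom_eval 12 icosa (m1 A x y) (m2 A x y)"
    "hom_eval 20 (hess 12 f) (m1 N x y) (m2 N x y) = - 11 * c\<^sup>2 * l\<^sup>2 * hom_eval 20 icosa_hess (m1 A x y) (m2 A x y)"
proof -
  have di: "degree icosa \<le> 12" "degree icosa_hess \<le> 20" by (simp_all add: icosa_def icosa_hess_def)
  have degT: "degree (pcompose f [:z, 1:]) \<le> 12" using degree_pcompose_le[of f "[:z, 1:]"] deg by simp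
  have "(\<lambda>x y. hom_eval 12 f (m1 N x y) (m2 N x y)) = (\<lambda>x y. c * hom_eval 12 icosa (m1 A x y) (m2 A x y))"
  proof (rule form_eqI[of 12])
    fix t :: complex assume t: "t \<noteq> 0"
    have "hom_eval 12 f (m1 N t 1) (m2 N t 1) = t ^ 12 * poly f (z + 1 / t)"
      using hom_eval_eq[OF deg(1) t, of "z * t + 1"] t by (simp add: N_def add_divide_distrib)
    also have "\<dots> = poly (rev_form 12 (pcompose f [:z, 1:])) t"
      using poly_rev_form[OF degT t] by (simp add: poly_pcompose)
    finally show "hom_eval 12 f (m1 N t 1) (m2 N t 1) = c * hom_eval 12 icosa (m1 A t 1) (m2 A t 1)"
      unfolding nf by (simp add: A_def hom_eval_1[OF di(1)] poly_pcompose algebra_simps)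
  qed (intro is_form_cmult is_form_subst is_form_hom_eval deg di)+
  then show "hom_eval 12 f (m1 N x y) (m2 N x y) = c * hom_eval 12 icosa (m1 A x y) (m2 A x y)" by metis
  have "(\<lambda>x y. hom_eval 20 (hess 12 f) (m1 N x y) (m2 N x y)) = (\<lambda>x y. (- 11 * c\<^sup>2 * l\<^sup>2) * hom_eval 20 icosa_hess (m1 A x y) (m2 A x y))"
  proof (rule form_eqI[of 20])
    fix t :: complex assume t: "t \<noteq> 0"
    have "hom_eval 20 (hess 12 f) (m1 N t 1) (m2 N t 1) = t ^ 20 * poly (hess 12 f) (z + 1 / t)"
      using hom_eval_eq[OF deg(2) t, of "z * t + 1"] t by (simp add: N_def add_divide_distrib)
    also have "\<dots> = poly (hess 12 (rev_form 12 (pcompose f [:z, 1:]))) t"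
      using hess_rev_form[of "pcompose f [:z, 1:]" 4 t] degT t by (simp add: hess_affine poly_pcompose)
    finally show "hom_eval 20 (hess 12 f) (m1 N t 1) (m2 N t 1) = (- 11 * c\<^sup>2 * l\<^sup>2) * hom_eval 20 icosa_hess (m1 A t 1) (m2 A t 1)"
      unfolding nf by (simp add: A_def hom_eval_1[OF di(2)] poly_pcompose hess_smult hess_affine hess_icosa algebra_simps)
  qed (intro is_form_cmult is_form_subst is_form_hom_eval deg di)+
  then show "hom_eval 20 (hess 12 f) (m1 N x y) (m2 N x y) = - 11 * c\<^sup>2 * l\<^sup>2 * hom_eval 20 icosa_hess (m1 A x y) (m2 A x y)"
    by metis
qed

definition icosa_F :: "complex \<Rightarrow> complex \<Rightarrow> complex" where
  "icosa_F x y = (x ^ 20 - 228 * x ^ 15 * y ^ 5 + 494 * x ^ 10 * y ^ 10 + 228 * x ^ 5 * y ^ 15 + y ^ 20) ^ 3"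

definition icosa_G :: "complex \<Rightarrow> complex \<Rightarrow> complex" where
  "icosa_G x y = (x * y * (x ^ 10 + 11 * x ^ 5 * y ^ 5 - y ^ 10)) ^ 5"

lemma icosa_forms: "icosa_F x y = hom_eval 20 icosa_hess x y ^ 3" "icosa_G x y = hom_eval 12 icosa x y ^ 5"
proof -
  have "hom_eval 20 icosa_hess x y = x ^ 20 - 228 * x ^ 15 * y ^ 5 + 494 * x ^ 10 * y ^ 10 + 228 * x ^ 5 * y ^ 15 + y ^ 20"
    by (simp add: hom_eval_def icosa_hess_def numeral_eq_Suc)
  then show "icosa_F x y = hom_eval 20 icosa_hess x y ^ 3" by (simp add: icosa_F_def)
  have "hom_eval 12 icosa x y = x * y * (x ^ 10 + 11 * x ^ 5 * y ^ 5 - y ^ 10)"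
    by (simp add: hom_eval_def icosa_def numeral_eq_Suc algebra_simps)
  then show "icosa_G x y = hom_eval 12 icosa x y ^ 5" by (simp add: icosa_G_def)
qed

text \<open>Q is brought to normal form, and P follows because it is a multiple of the Hessian of Q.\<close>

lemma icosahedral_lr_equiv:
  fixes P Q R :: "complex poly"
  assumes deg: "degree P = 20" "degree Q = 12" "degree R = 30" and eq: "P ^ 3 + Q ^ 5 = R\<^sup>2"
    and cop: "\<And>z. poly P z = 0 \<Longrightarrow> poly Q z \<noteq> 0" and card: "card {z. poly Q z = 0} = 12"
  shows "lr_equiv icosa_F icosa_G (\<lambda>x y. hom_eval 20 P x y ^ 3) (\<lambda>x y. hom_eval 12 Q x y ^ 5)"
proof -
  obtain k where k: "k \<noteq> 0" "P = smult k (hess 12 Q)" and tv: "transvectant4 Q = 0"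
    using icosahedral_equation[OF deg eq cop] by blast
  have Q0: "Q \<noteq> 0" using deg by auto
  have fin: "finite {z. poly Q z = 0}" by (rule poly_roots_finite[OF Q0])
  have "3 \<le> card {z. poly Q z = 0}" using card by simp
  then obtain T where T: "T \<subseteq> {z. poly Q z = 0}" "card T = 3"
    using obtain_subset_with_card_n[of 3 "{z. poly Q z = 0}"] by metis
  then obtain z p q where zpq: "T = {z, p, q}" "z \<noteq> p" "p \<noteq> q" "z \<noteq> q" unfolding card_3_iff by blast
  then have roots: "poly Q z = 0" "poly Q p = 0" "poly Q q = 0" using T by auto
  have "poly (pderiv Q) z \<noteq> 0" by (rule order_one_if_many_roots) (use Q0 card deg roots in auto)
  then obtain c l m where nf: "c \<noteq> 0" "l \<noteq> 0" "rev_form 12 (pcompose Q [:z, 1:]) = smult c (pcompose icosa [:m, l:])"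
    using vertex_to_infinity[of Q z p q] deg tv roots zpq by (metis order.refl)
  have dh: "degree (hess 12 Q) \<le> 20" using deg(1) k by simp
  note tr = vertex_transport[OF _ dh nf(3)]
  define N A :: moebius where "N = (z, 1, 1, 0)" and "A = (l, m, 0, 1)"
  have N: "mdet N \<noteq> 0" "mdet A \<noteq> 0" using nf by (simp_all add: N_def A_def)
  have Qv: "hom_eval 12 Q x y = c * hom_eval 12 icosa (m1 (mmult A (minv N)) x y) (m2 (mmult A (minv N)) x y)" for x y
    using tr(1)[of "m1 (minv N) x y" "m2 (minv N) x y", folded N_def A_def] deg(2) by (simp add: minv_apply[OF N(1)] mmult_apply)
  have "hom_eval 20 (hess 12 Q) x y = - 11 * c\<^sup>2 * l\<^sup>2 * hom_eval 20 icosa_hess (m1 (mmult A (minv N)) x y) (m2 (mmult A (minv N)) x y)" for x y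
    using tr(2)[of "m1 (minv N) x y" "m2 (minv N) x y", folded N_def A_def] deg(2) by (simp add: minv_apply[OF N(1)] mmult_apply)
  then have Pv: "hom_eval 20 P x y = (- 11 * k * c\<^sup>2 * l\<^sup>2) * hom_eval 20 icosa_hess (m1 (mmult A (minv N)) x y) (m2 (mmult A (minv N)) x y)" for x y
    by (simp add: k(2) hom_eval_smult)
  show ?thesis
  proof (rule lr_equivI[of "mmult A (minv N)" "((- 11 * k * c\<^sup>2 * l\<^sup>2) ^ 3, 0, 0, c ^ 5)"])
    show "mdet (mmult A (minv N)) \<noteq> 0" using N mdet_minv mdet_mmult by simp
    show "mdet ((- 11 * k * c\<^sup>2 * l\<^sup>2) ^ 3, 0, 0, c ^ 5) \<noteq> 0" using k nf by simp
  qed (simp_all add: Pv Qv icosa_forms power_mult_distrib del: mmult.simps minv.simps)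
qed

lemma card_roots_if_simple:
  fixes p :: "complex poly"
  assumes "p \<noteq> 0" "\<And>z. poly p z = 0 \<Longrightarrow> poly (pderiv p) z \<noteq> 0"
  shows "card {z. poly p z = 0} = degree p"
proof -
  have "order z p = 1" if "poly p z = 0" for z
    using order_pderiv[OF assms(1) that] order_0I[OF assms(2)[OF that]] by simp
  then have "(\<Sum>z\<in>{z. poly p z = 0}. order z p) = card {z. poly p z = 0}" by simp
  then show ?thesis using size_proots_complex[of p] assms(1) by (simp add: size_multiset_overloaded_eq)
qed

lemma poly_icosa: "poly icosa t = t * ((t ^ 5)\<^sup>2 + 11 * t ^ 5 - 1)"
  by (simp add: icosa_def algebra_simps power_numeral_reduce)

lemma icosa_simple_roots:
  assumes "poly icosa z = 0"
  shows "poly (pderiv icosa) z \<noteq> 0"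
proof
  assume d: "poly (pderiv icosa) z = 0"
  define u where "u = z ^ 5"
  have d: "11 * u\<^sup>2 + 66 * u - 1 = 0"
    using d by (simp add: icosa_def pderiv_pCons u_def algebra_simps power_numeral_reduce)
  show False
  proof (cases "z = 0")
    case True
    then show False using d by (simp add: u_def)
  next
    case False
    then have e: "u\<^sup>2 + 11 * u - 1 = 0" using assms by (simp add: poly_icosa u_def)
    have "55 * u - 10 = 11 * (u\<^sup>2 + 11 * u - 1) - (11 * u\<^sup>2 + 66 * u - 1)" by (simp add: algebra_simps)
    then have u: "u = 2 / 11" unfolding d e by (simp add: field_simps)
    from e[unfolded u] show False by (simp add: power2_eq_square)
  qed
qed

lemma card_icosa_roots: "card {z. poly icosa z = 0} = 11"
  using card_roots_if_simple[of icosa] icosa_simple_roots by (simp add: icosa_def)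

text \<open>Applied to the standard form itself, the normal form produces a symmetry that moves infinity to a
  prescribed vertex. Since the Hessian of the Hessian is a multiple of the cube of the form, the factors by
  which form and Hessian are multiplied are related, and the two members of the pair get the same factor.\<close>

lemma icosa_vertex_symmetry:
  assumes z: "poly icosa z = 0"
  obtains g where "g \<in> deck icosa_F icosa_G" "m1 g 1 0 = z * m2 g 1 0" "m2 g 1 0 \<noteq> 0"
proof -
  have "card ({z. poly icosa z = 0} - {z}) = 10" using z card_icosa_roots by (subst card_Diff_singleton) auto
  then have "2 \<le> card ({z. poly icosa z = 0} - {z})" by simp
  then obtain T where T: "T \<subseteq> {z. poly icosa z = 0} - {z}" "card T = 2"
    using obtain_subset_with_card_n[of 2 "{z. poly icosa z = 0} - {z}"] by metis
  then obtain p q where pq: "T = {p, q}" "p \<noteq> q" unfolding card_2_iff by blast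
  have deg: "degree icosa \<le> 12" by (simp add: icosa_def)
  obtain c l m where nf: "c \<noteq> 0" "l \<noteq> 0" "rev_form 12 (pcompose icosa [:z, 1:]) = smult c (pcompose icosa [:m, l:])"
    using vertex_to_infinity[OF deg transvectant4_icosa z icosa_simple_roots[OF z], of p q] T pq by blast
  have dh: "degree (hess 12 icosa) \<le> 20" unfolding hess_icosa by (simp add: icosa_hess_def)
  note tr = vertex_transport[OF deg dh nf(3)]
  define N A :: moebius where "N = (z, 1, 1, 0)" and "A = (l, m, 0, 1)"
  have dets: "mdet N \<noteq> 0" "mdet A \<noteq> 0" using nf by (simp_all add: N_def A_def)
  obtain k where k: "k \<noteq> 0" "hess 20 icosa_hess = smult k (icosa ^ 3)" using hess_icosa_hess by blast
  have degT: "degree (pcompose icosa [:z, 1:]) \<le> 12" "degree (pcompose icosa_hess [:z, 1:]) \<le> 20"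
    using degree_pcompose_le[of icosa "[:z, 1:]"] degree_pcompose_le[of icosa_hess "[:z, 1:]"]
    by (simp_all add: icosa_def icosa_hess_def)
  have val: "t ^ 12 * poly icosa (z + 1 / t) = c * poly icosa (m + t * l)" if "t \<noteq> 0" for t
    using poly_rev_form[OF degT(1) that] unfolding nf(3) by (simp add: poly_pcompose)
  have valh: "t ^ 20 * poly icosa_hess (z + 1 / t) = c\<^sup>2 * l\<^sup>2 * poly icosa_hess (m + t * l)" if "t \<noteq> 0" for t
    using hess_rev_form[of "pcompose icosa [:z, 1:]" 4 t] degT(1) that
    by (simp add: nf(3) hess_smult hess_affine hess_icosa poly_pcompose mult.assoc)
  have revh: "rev_form 20 (pcompose icosa_hess [:z, 1:]) = smult (c\<^sup>2 * l\<^sup>2) (pcompose icosa_hess [:m, l:])"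
    by (rule poly_eqI_nonzero) (simp add: poly_rev_form[OF degT(2)] poly_pcompose valh)
  have "pcompose icosa [:m, l:] \<noteq> 0" using nf(2) by (simp add: pcompose_eq_0_iff) (simp add: icosa_def)
  then have "finite ({0} \<union> {t. poly (pcompose icosa [:m, l:]) t = 0})" by (simp add: poly_roots_finite)
  from ex_new_if_finite[OF infinite_UNIV_char_0 this]
  obtain t where t: "t \<noteq> 0" "poly icosa (m + t * l) \<noteq> 0" by (auto simp: poly_pcompose)
  have "k * (c * poly icosa (m + t * l)) ^ 3 = poly (hess 20 (rev_form 20 (pcompose icosa_hess [:z, 1:]))) t"
    using hess_rev_form[of "pcompose icosa_hess [:z, 1:]" 12 t] degT(2) t(1)
    by (simp add: hess_affine k(2) poly_pcompose power_mult_distrib flip: val[OF t(1)])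
  also have "\<dots> = (c\<^sup>2 * l\<^sup>2)\<^sup>2 * (l\<^sup>2 * (k * poly icosa (m + t * l) ^ 3))"
    unfolding revh by (simp add: hess_smult hess_affine k(2) poly_pcompose)
  finally have "k * c ^ 3 * poly icosa (m + t * l) ^ 3 * (1 - c * l ^ 6) = 0"
    by (simp add: power_mult_distrib algebra_simps power_numeral_reduce)
  then have cl: "c * l ^ 6 = 1" using k(1) nf(1) t(2) by simp
  have G: "hom_eval 12 icosa (m1 N (m1 (minv A) x y) (m2 (minv A) x y)) (m2 N (m1 (minv A) x y) (m2 (minv A) x y))
      = c * hom_eval 12 icosa x y" for x y
    using tr(1)[of "m1 (minv A) x y" "m2 (minv A) x y", folded N_def A_def] by (simp add: minv_apply[OF dets(2)])
  have F: "hom_eval 20 icosa_hess (m1 N (m1 (minv A) x y) (m2 (minv A) x y)) (m2 N (m1 (minv A) x y) (m2 (minv A) x y))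
      = c\<^sup>2 * l\<^sup>2 * hom_eval 20 icosa_hess x y" for x y
    using tr(2)[of "m1 (minv A) x y" "m2 (minv A) x y", folded N_def A_def, unfolded hess_icosa hom_eval_smult]
    by (simp add: minv_apply[OF dets(2)] mult.assoc)
  have "(c\<^sup>2 * l\<^sup>2) ^ 3 = c ^ 5 * (c * l ^ 6)" by (simp add: power_mult_distrib algebra_simps power_numeral_reduce)
  then have cube: "(c\<^sup>2 * l\<^sup>2) ^ 3 = c ^ 5" by (simp add: cl)
  let ?g = "mmult N (minv A)"
  have "?g \<in> deck icosa_F icosa_G"
    unfolding deck_iff
  proof (intro conjI exI[of _ "c ^ 5"] allI)
    show "mdet ?g \<noteq> 0" using dets mdet_minv mdet_mmult by simp
    show "icosa_F (m1 ?g x y) (m2 ?g x y) = c ^ 5 * icosa_F x y" for x y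
      unfolding icosa_forms mmult_apply F power_mult_distrib[of "c\<^sup>2 * l\<^sup>2"] cube ..
    show "icosa_G (m1 ?g x y) (m2 ?g x y) = c ^ 5 * icosa_G x y" for x y
      unfolding icosa_forms mmult_apply G power_mult_distrib ..
  qed
  moreover have "m1 ?g 1 0 = z * m2 ?g 1 0" "m2 ?g 1 0 \<noteq> 0" using nf(2) by (simp_all add: N_def A_def)
  ultimately show ?thesis using that by blast
qed

section \<open>Classification of the pairs with many deck transformations\<close>

lemma lr_equiv_from_linear:
  assumes uv: "independent_linear u v" and k: "k1 \<noteq> 0" "k2 \<noteq> 0"
    and F: "\<And>x y. F (hom_eval 1 u x y) (hom_eval 1 v x y) = k1 * F' x y"
    and G: "\<And>x y. G (hom_eval 1 u x y) (hom_eval 1 v x y) = k2 * G' x y"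
  shows "lr_equiv F G F' G'"
proof (rule lr_equiv_trans[OF lr_equiv_of_linear[OF uv, of F G]])
  show "lr_equiv (\<lambda>x y. F (hom_eval 1 u x y) (hom_eval 1 v x y)) (\<lambda>x y. G (hom_eval 1 u x y) (hom_eval 1 v x y)) F' G'"
    by (rule lr_equivI[of "(1, 0, 0, 1)" "(1 / k1, 0, 0, 1 / k2)"]) (use k in \<open>simp_all only: m1.simps m2.simps F G mdet.simps, simp_all\<close>)
qed

lemma hom_eval_tet_plus:
  assumes "degree u \<le> 1" "degree v \<le> 1"
  shows "hom_eval 4 (tet_plus [:k:] u v) x y = tet_plus k (hom_eval 1 u x y) (hom_eval 1 v x y)"
proof -
  have u4: "hom_eval 4 (u ^ 4) x y = hom_eval 1 u x y ^ 4" "hom_eval 4 (v ^ 4) x y = hom_eval 1 v x y ^ 4"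
    using hom_eval_power[OF assms(1), of 4] hom_eval_power[OF assms(2), of 4] by simp_all
  have u2: "hom_eval 2 (u\<^sup>2) x y = (hom_eval 1 u x y)\<^sup>2" "hom_eval 2 (v\<^sup>2) x y = (hom_eval 1 v x y)\<^sup>2"
    using hom_eval_power[OF assms(1), of 2] hom_eval_power[OF assms(2), of 2] by simp_all
  have "degree (u\<^sup>2) \<le> 2" "degree (v\<^sup>2) \<le> 2"
    using degree_power_le[of u 2] degree_power_le[of v 2] assms by linarith+
  then have "hom_eval (2 + 2) (u\<^sup>2 * v\<^sup>2) x y = (hom_eval 1 u x y)\<^sup>2 * (hom_eval 1 v x y)\<^sup>2"
    by (subst hom_eval_mult) (simp_all only: u2)
  moreover have "tet_plus [:k:] u v = u ^ 4 + smult k (u\<^sup>2 * v\<^sup>2) + v ^ 4" by (simp add: tet_plus_def)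
  ultimately show ?thesis by (simp add: hom_eval_add hom_eval_smult u4 tet_plus_def mult.assoc)
qed

definition octa_F :: "complex \<Rightarrow> complex \<Rightarrow> complex" where
  "octa_F x y = (x ^ 8 + 14 * x ^ 4 * y ^ 4 + y ^ 8) ^ 3"

definition octa_G :: "complex \<Rightarrow> complex \<Rightarrow> complex" where
  "octa_G x y = (x * y * (x ^ 4 - y ^ 4)) ^ 4"

text \<open>The eight faces of the octahedron belong to two opposite tetrahedra, and the square of the vertex form lies
  in the pencil of their cubes. In this way the octahedral pair reduces to the tetrahedral one.\<close>

lemma octa_via_tet:
  "octa_F x y = (tet_plus tet x y * tet_plus (- tet) x y) ^ 3"
  "tet_plus tet x y ^ 3 - tet_plus (- tet) x y ^ 3 = 6 * tet * (x * y * (x ^ 4 - y ^ 4))\<^sup>2"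
proof -
  have "tet_plus tet x y * tet_plus (- tet) x y = (x ^ 4 + y ^ 4)\<^sup>2 - tet * tet * (x\<^sup>2 * y\<^sup>2)\<^sup>2"
    by (simp add: tet_plus_def power2_eq_square algebra_simps)
  also have "\<dots> = x ^ 8 + 14 * x ^ 4 * y ^ 4 + y ^ 8"
    unfolding tet_square by algebra
  finally show "octa_F x y = (tet_plus tet x y * tet_plus (- tet) x y) ^ 3" by (simp add: octa_F_def)
  have k: "tet * tet = - 12" by (rule tet_square)
  show "tet_plus tet x y ^ 3 - tet_plus (- tet) x y ^ 3 = 6 * tet * (x * y * (x ^ 4 - y ^ 4))\<^sup>2"
    unfolding tet_plus_def using k by algebra
qed

context normalized_pair
begin

text \<open>Any two members of the pencil serve as a basis, so that it suffices to identify two ramified fibres.\<close>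

lemma pencil_lr_equiv:
  assumes "c1 \<noteq> c2"
  shows "lr_equiv (hom_eval d (a - smult c1 b)) (hom_eval d (a - smult c2 b)) (hom_eval d a) (hom_eval d b)"
proof (rule lr_equiv_sym, rule lr_equivI[of "(1, 0, 0, 1)" "(1, - c1, 1, - c2)"])
  show "mdet (1, - c1, 1, - c2) \<noteq> 0" using assms by simp
qed (simp_all add: hom_eval_diff hom_eval_smult)

lemma fibres_no_common_root:
  assumes "c1 \<noteq> c2" "poly (a - smult c1 b) z = 0"
  shows "poly (a - smult c2 b) z \<noteq> 0"
proof
  assume "poly (a - smult c2 b) z = 0"
  then have "(c2 - c1) * poly b z = 0" using assms(2) by (simp add: algebra_simps)
  then have "poly b z = 0" using assms(1) by simp
  then show False using common[of z] assms(2) by simp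
qed

text \<open>Three members of a pencil are linearly dependent. For three ramified fibres, which are powers, this is the
  equation to be solved.\<close>

lemma fibre_relation:
  "smult (c2 - c3) (a - smult c1 b) + smult (c3 - c1) (a - smult c2 b) + smult (c1 - c2) (a - smult c3 b) = 0"
  by (rule poly_eqI_infinite[OF infinite_UNIV_char_0]) (simp add: algebra_simps)

text \<open>Two ramified fibres with a single point each are powers of independent linear polynomials. For three
  ramified fibres, the factors in their linear relation are absorbed by roots, which gives the equations
  \<open>p\<^sup>2 - q\<^sup>2 = r\<^sup>n\<close>, \<open>p\<^sup>3 - q\<^sup>3 = r\<^sup>2\<close>, \<open>r\<^sup>2 + q\<^sup>4 = p\<^sup>3\<close> and \<open>p\<^sup>3 + q\<^sup>5 = r\<^sup>2\<close> up to constants.\<close>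

lemma normalized_classification:
  "lr_equiv (\<lambda>x y. x ^ d) (\<lambda>x y. y ^ d) (hom_eval d a) (hom_eval d b) \<or>
   (\<exists>n. d = 2 * n \<and> lr_equiv (\<lambda>x y. (x ^ n + y ^ n)\<^sup>2) (\<lambda>x y. (x ^ n - y ^ n)\<^sup>2) (hom_eval d a) (hom_eval d b)) \<or>
   (d = 12 \<and> lr_equiv (\<lambda>x y. tet_plus tet x y ^ 3) (\<lambda>x y. tet_plus (- tet) x y ^ 3) (hom_eval d a) (hom_eval d b)) \<or>
   (d = 24 \<and> lr_equiv octa_F octa_G (hom_eval d a) (hom_eval d b)) \<or>
   (d = 60 \<and> lr_equiv icosa_F icosa_G (hom_eval d a) (hom_eval d b))"
proof -
  obtain Br m e where Br: "finite Br" "\<And>c. c \<in> Br \<Longrightarrow> a - smult c b = m c ^ e c" "\<And>c. c \<in> Br \<Longrightarrow> e c \<ge> 2"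
    "\<And>c. c \<in> Br \<Longrightarrow> degree (m c) * e c = d" "\<And>c. c \<in> Br \<Longrightarrow> lead_coeff (m c) = 1"
    "\<And>c. c \<in> Br \<Longrightarrow> card {p. poly (m c) p = 0} = degree (m c)"
    "(\<Sum>c\<in>Br. degree (m c) * (e c - 1)) = 2 * d - 2"
    by (rule riemann_hurwitz) (rule that)
  have hom: "hom_eval d (a - smult c b) x y = hom_eval (degree (m c)) (m c) x y ^ e c" if "c \<in> Br" for c x y
    using hom_eval_power[of "m c" "degree (m c)" "e c" x y] Br(2,4)[OF that] by (simp add: mult.commute)
  have epos: "e c \<ge> 1" if "c \<in> Br" for c using Br(3)[OF that] by simp
  have cop: "poly (m c') z \<noteq> 0" if "c \<in> Br" "c' \<in> Br" "c \<noteq> c'" "poly (m c) z = 0" for c c' z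
  proof -
    have "poly (a - smult c b) z = 0" using that epos[of c] by (simp add: Br(2) zero_power)
    then have "poly (a - smult c' b) z \<noteq> 0" using fibres_no_common_root that by blast
    then show ?thesis using epos[of c'] that by (auto simp: Br(2) zero_power)
  qed
  have rel: "smult (c2 - c3) (m c1 ^ e c1) + smult (c3 - c1) (m c2 ^ e c2) + smult (c1 - c2) (m c3 ^ e c3) = 0"
    if "c1 \<in> Br" "c2 \<in> Br" "c3 \<in> Br" for c1 c2 c3
    using fibre_relation[of c2 c3 c1] that by (simp only: Br(2))
  have pencil: "lr_equiv F G (hom_eval d a) (hom_eval d b)"
    if "lr_equiv F G (\<lambda>x y. hom_eval (degree (m c1)) (m c1) x y ^ e c1) (\<lambda>x y. hom_eval (degree (m c2)) (m c2) x y ^ e c2)"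
      "c1 \<in> Br" "c2 \<in> Br" "c1 \<noteq> c2" for F G c1 c2
  proof -
    have "(\<lambda>x y. hom_eval (degree (m c)) (m c) x y ^ e c) = hom_eval d (a - smult c b)" if "c \<in> Br" for c
      by (intro ext) (rule hom[OF that, symmetric])
    then show ?thesis using lr_equiv_trans[OF that(1)] pencil_lr_equiv[OF that(4)] that(2,3) by simp
  qed
  have mnz: "m c \<noteq> 0" if "c \<in> Br" for c using Br(5)[OF that] by auto
  consider (one) "d = 1"
    | (two) c1 c2 where "c1 \<in> Br" "c2 \<in> Br" "c1 \<noteq> c2" "degree (m c1) = 1" "degree (m c2) = 1"
    | (three) c1 c2 c3 where "c1 \<in> Br" "c2 \<in> Br" "c3 \<in> Br" "c1 \<noteq> c2" "c1 \<noteq> c3" "c2 \<noteq> c3"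
      "e c1 = 2 \<and> e c2 = 2 \<and> degree (m c3) = 2 \<or> e c1 = 3 \<and> e c2 = 3 \<and> e c3 = 2 \<and> d = 12 \<or>
       e c1 = 3 \<and> e c2 = 4 \<and> e c3 = 2 \<and> d = 24 \<or> e c1 = 3 \<and> e c2 = 5 \<and> e c3 = 2 \<and> d = 60"
    by (rule signature[of Br e "\<lambda>c. degree (m c)" d, OF Br(1,3,4,7) d]) blast+
  then show ?thesis
  proof cases
    case one
    then have "degree b = 0" using b by simp
    then obtain b0 where b0: "b = [:b0:]" "b0 \<noteq> 0" using b(1) by (auto elim: degree_eq_zeroE)
    have "lr_equiv (\<lambda>x y. x ^ d) (\<lambda>x y. y ^ d) (hom_eval d a) (hom_eval d b)"
      unfolding one
      by (rule lr_equivI[of "(1, 0, 0, 1)" "(1, coeff a 0, 0, b0)"])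
         (use b0 a one in \<open>simp_all add: hom_eval_linear[unfolded One_nat_def]\<close>)
    then show ?thesis by blast
  next
    case two
    have "e c1 = d" "e c2 = d" using Br(4)[OF two(1)] Br(4)[OF two(2)] two by auto
    moreover have "independent_linear (m c1) (m c2)"
      by (rule independent_if_no_common_root) (use two cop in auto)
    ultimately have "lr_equiv (\<lambda>x y. x ^ d) (\<lambda>x y. y ^ d) (hom_eval d a) (hom_eval d b)"
      using lr_equiv_of_linear[of "m c1" "m c2" "\<lambda>x y. x ^ d" "\<lambda>x y. y ^ d"] two
      by (intro pencil[of _ _ c1 c2]) auto
    then show ?thesis by blast
  next
    case three
    define \<alpha> \<beta> \<gamma> where "\<alpha> = c2 - c3" and "\<beta> = c3 - c1" and "\<gamma> = c1 - c2"
    have nz: "\<alpha> \<noteq> 0" "\<beta> \<noteq> 0" "\<gamma> \<noteq> 0" using three by (auto simp: \<alpha>_def \<beta>_def \<gamma>_def)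
    define p q r where "p = m c1" and "q = m c2" and "r = m c3"
    have rel: "smult \<alpha> (p ^ e c1) + smult \<beta> (q ^ e c2) + smult \<gamma> (r ^ e c3) = 0"
      unfolding \<alpha>_def \<beta>_def \<gamma>_def p_def q_def r_def by (rule rel[OF three(1-3)])
    have copp: "poly q z \<noteq> 0" if "poly p z = 0" for z unfolding q_def using cop[OF three(1,2,4)] that p_def by simp
    have r0: "r \<noteq> 0" using mnz three by (simp add: r_def)
    have dg: "degree p * e c1 = d" "degree q * e c2 = d" "degree r * e c3 = d"
      using Br(4) three by (simp_all add: p_def q_def r_def)
    have pencil12: "lr_equiv F G (hom_eval d a) (hom_eval d b)"
      if "lr_equiv F G (\<lambda>x y. hom_eval (degree p) p x y ^ e c1) (\<lambda>x y. hom_eval (degree q) q x y ^ e c2)" for F G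
      using pencil[OF that[unfolded p_def q_def] three(1,2,4)] .
    have pencil21: "lr_equiv F G (hom_eval d a) (hom_eval d b)"
      if "lr_equiv F G (\<lambda>x y. hom_eval (degree q) q x y ^ e c2) (\<lambda>x y. hom_eval (degree p) p x y ^ e c1)" for F G
      using pencil[OF that[unfolded p_def q_def] three(2,1)] three(4) by simp
    from three(7) show ?thesis
    proof (elim disjE conjE)
      assume s: "e c1 = 2" "e c2 = 2" "degree (m c3) = 2"
      define n where "n = degree p"
      have n: "d = 2 * n" "degree p = n" "degree q = n" "e c3 = n" "n \<ge> 1"
        using dg s d by (auto simp: n_def r_def)
      obtain sa where sa: "sa ^ 2 = \<alpha>" "\<alpha> \<noteq> 0 \<Longrightarrow> sa \<noteq> 0" using complex_root_exists[of 2 \<alpha>] by (metis one_le_numeral)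
      obtain sb where sb: "sb ^ 2 = - \<beta>" "- \<beta> \<noteq> 0 \<Longrightarrow> sb \<noteq> 0" using complex_root_exists[of 2 "- \<beta>"] by (metis one_le_numeral)
      define P Q where "P = smult sa p" and "Q = smult sb q"
      have eq: "P\<^sup>2 - Q\<^sup>2 = smult (- \<gamma>) (r ^ n)"
        using rel unfolding P_def Q_def smult_power sa sb s n(4) by (simp add: eq_neg_iff_add_eq_0)
      have degs: "degree P \<le> n" "degree Q \<le> n" "degree P = n \<or> degree Q = n"
        using n nz sa sb by (auto simp: P_def Q_def)
      have cop': "poly Q z \<noteq> 0" if "poly P z = 0" for z using copp[of z] that nz sa sb by (auto simp: P_def Q_def)
      have g: "- \<gamma> \<noteq> 0" using nz by simp
      obtain u v where uv: "independent_linear u v" "smult 2 P = u ^ n + v ^ n" "smult 2 Q = v ^ n - u ^ n"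
        by (rule dihedral_equation[OF n(5) degs cop' eq g r0])
      have uv1: "degree u \<le> 1" "degree v \<le> 1" using uv(1) by (auto simp: independent_linear_def)
      have un: "hom_eval n (u ^ n) x y = hom_eval 1 u x y ^ n" "hom_eval n (v ^ n) x y = hom_eval 1 v x y ^ n" for x y
        using hom_eval_power[OF uv1(1), of n] hom_eval_power[OF uv1(2), of n] by simp_all
      have h: "hom_eval 1 u x y ^ n + hom_eval 1 v x y ^ n = 2 * sa * hom_eval n p x y"
        "hom_eval 1 u x y ^ n - hom_eval 1 v x y ^ n = - 2 * sb * hom_eval n q x y" for x y
        using arg_cong[OF uv(2), of "\<lambda>p. hom_eval n p x y"] arg_cong[OF uv(3), of "\<lambda>p. hom_eval n p x y"]
        by (simp_all add: hom_eval_add hom_eval_diff hom_eval_smult un P_def Q_def)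
      have "lr_equiv (\<lambda>x y. (x ^ n + y ^ n)\<^sup>2) (\<lambda>x y. (x ^ n - y ^ n)\<^sup>2) (\<lambda>x y. hom_eval (degree p) p x y ^ e c1) (\<lambda>x y. hom_eval (degree q) q x y ^ e c2)"
      proof (rule lr_equiv_from_linear[OF uv(1), of "(2 * sa)\<^sup>2" "(- 2 * sb)\<^sup>2"])
        show "(2 * sa)\<^sup>2 \<noteq> 0" "(- 2 * sb)\<^sup>2 \<noteq> 0" using sa sb nz by simp_all
      qed (simp_all only: h n(2,3) s power_mult_distrib)
      then show ?thesis using pencil12 n(1) by blast
    next
      assume s: "e c1 = 3" "e c2 = 3" "e c3 = 2" "d = 12"
      have n: "degree p = 4" "degree q = 4" using dg s by auto
      obtain sa where sa: "sa ^ 3 = \<alpha>" "\<alpha> \<noteq> 0 \<Longrightarrow> sa \<noteq> 0" using complex_root_exists[of 3 \<alpha>] by (metis one_le_numeral)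
      obtain sb where sb: "sb ^ 3 = - \<beta>" "- \<beta> \<noteq> 0 \<Longrightarrow> sb \<noteq> 0" using complex_root_exists[of 3 "- \<beta>"] by (metis one_le_numeral)
      obtain sc where sc: "sc ^ 2 = - \<gamma>" "- \<gamma> \<noteq> 0 \<Longrightarrow> sc \<noteq> 0" using complex_root_exists[of 2 "- \<gamma>"] by (metis one_le_numeral)
      define P Q R where "P = smult sa p" and "Q = smult sb q" and "R = smult sc r"
      have eq: "P ^ 3 - Q ^ 3 = R\<^sup>2"
        using rel unfolding P_def Q_def R_def smult_power sa sb sc s by (simp add: eq_neg_iff_add_eq_0)
      have R0: "R \<noteq> 0" using r0 sc nz by (simp add: R_def)
      have degs: "degree P \<le> 4" "degree Q \<le> 4" "degree P = 4 \<or> degree Q = 4"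
        using n nz sa sb by (auto simp: P_def Q_def)
      have cop': "poly Q z \<noteq> 0" if "poly P z = 0" for z using copp[of z] that nz sa sb by (auto simp: P_def Q_def)
      define K where "K = 4 * (1 - omega3)"
      have K: "K \<noteq> 0" "omega3 \<noteq> 0" using omega3 by (auto simp: K_def)
      obtain u v where uv: "independent_linear u v"
        "smult K P = tet_plus [:- tet:] u v" "smult K Q = smult omega3 (tet_plus [:tet:] u v)"
        unfolding K_def by (rule tetrahedral_equation[OF degs cop' eq R0])
      have uv1: "degree u \<le> 1" "degree v \<le> 1" using uv(1) by (auto simp: independent_linear_def)
      have h: "tet_plus (- tet) (hom_eval 1 u x y) (hom_eval 1 v x y) = K * sa * hom_eval 4 p x y"
        "omega3 * tet_plus tet (hom_eval 1 u x y) (hom_eval 1 v x y) = K * sb * hom_eval 4 q x y" for x y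
        using arg_cong[OF uv(2), of "\<lambda>p. hom_eval 4 p x y"] arg_cong[OF uv(3), of "\<lambda>p. hom_eval 4 p x y"]
        unfolding hom_eval_smult hom_eval_tet_plus[OF uv1] P_def Q_def by (simp_all add: mult.assoc)
      have h': "tet_plus tet (hom_eval 1 u x y) (hom_eval 1 v x y) = K * sb / omega3 * hom_eval 4 q x y" for x y
        using h(2)[of x y] K by (simp add: field_simps)
      have "lr_equiv (\<lambda>x y. tet_plus tet x y ^ 3) (\<lambda>x y. tet_plus (- tet) x y ^ 3)
          (\<lambda>x y. hom_eval (degree q) q x y ^ e c2) (\<lambda>x y. hom_eval (degree p) p x y ^ e c1)"
        unfolding n s
      proof (rule lr_equiv_from_linear[OF uv(1), of "(K * sb / omega3) ^ 3" "(K * sa) ^ 3"])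
        show "(K * sb / omega3) ^ 3 \<noteq> 0" "(K * sa) ^ 3 \<noteq> 0" using sa sb nz K by simp_all
      qed (simp_all only: h(1) h' power_mult_distrib)
      then show ?thesis using pencil21 s(4) by blast
    next
      assume s: "e c1 = 3" "e c2 = 4" "e c3 = 2" "d = 24"
      have n: "degree p = 8" "degree q = 6" "degree r = 12" using dg s by auto
      obtain sb where sb: "sb ^ 4 = \<beta>" "\<beta> \<noteq> 0 \<Longrightarrow> sb \<noteq> 0" using complex_root_exists[of 4 \<beta>] by (metis one_le_numeral)
      obtain sc where sc: "sc ^ 2 = \<gamma>" "\<gamma> \<noteq> 0 \<Longrightarrow> sc \<noteq> 0" using complex_root_exists[of 2 \<gamma>] by (metis one_le_numeral)
      obtain j where j: "j ^ 2 = 2 * \<i>" "2 * \<i> \<noteq> 0 \<Longrightarrow> j \<noteq> 0" using complex_root_exists[of 2 "2 * \<i>"] by (metis one_le_numeral)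
      define Q R where "Q = smult sb q" and "R = smult sc r"
      have eq: "R\<^sup>2 + Q ^ 4 = smult (- \<alpha>) (p ^ 3)"
        using rel unfolding Q_def R_def smult_power sb sc s by (simp add: eq_neg_iff_add_eq_0 add.commute add.left_commute)
      \<comment> \<open>The two factors of \<open>R\<^sup>2 + Q\<^sup>4\<close> are coprime, hence cubes, and their difference is a square: this is the
        tetrahedral equation.\<close>
      define f1 f2 where "f1 = R + smult \<i> (Q\<^sup>2)" and "f2 = R - smult \<i> (Q\<^sup>2)"
      have prod: "f1 * f2 = smult (- \<alpha>) (p ^ 3)" "f2 * f1 = smult (- \<alpha>) (p ^ 3)"
        unfolding eq[symmetric]
        by (rule poly_eqI_infinite[OF infinite_UNIV_char_0], simp add: f1_def f2_def power2_eq_square power4_eq_xxxx algebra_simps)+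
      have p0: "p \<noteq> 0" using n by auto
      have c12: "poly f2 z \<noteq> 0" if "poly f1 z = 0" for z
      proof
        assume f2: "poly f2 z = 0"
        have "poly p z = 0" using arg_cong[OF prod(1), of "\<lambda>p. poly p z"] that nz by simp
        moreover have "2 * \<i> * (poly Q z)\<^sup>2 = poly f1 z - poly f2 z" by (simp add: f1_def f2_def)
        then have "poly Q z = 0" using that f2 by simp
        then have "poly q z = 0" using sb nz by (simp add: Q_def)
        ultimately show False using copp by blast
      qed
      have a0: "- \<alpha> \<noteq> 0" "(3::nat) \<ge> 1" using nz by auto
      obtain U where U: "f1 = U ^ 3" "degree f1 = 3 * degree U"
        using coprime_factor_of_power[OF a0(2) prod(1) a0(1) p0 c12] by blast
      obtain V where V: "f2 = V ^ 3" "degree f2 = 3 * degree V"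
        using coprime_factor_of_power[OF a0(2) prod(2) a0(1) p0] c12 by blast
      have "degree R \<le> 12" "degree Q \<le> 6" using n by (auto simp: Q_def R_def)
      then have dQR: "degree R \<le> 12" "degree (smult \<i> (Q\<^sup>2)) \<le> 12"
        using degree_power_le[of Q 2] degree_smult_le[of \<i> "Q\<^sup>2"] by linarith+
      have "degree f1 \<le> 12" "degree f2 \<le> 12"
        unfolding f1_def f2_def by (rule degree_add_le[OF dQR], rule degree_diff_le[OF dQR])
      then have dUV: "degree U \<le> 4" "degree V \<le> 4" using U V by auto
      have "f1 * f2 \<noteq> 0" using prod p0 nz by simp
      then have "degree f1 + degree f2 = degree (smult (- \<alpha>) (p ^ 3))"
        using degree_mult_eq[of f1 f2] by (metis prod(1) mult_zero_left mult_zero_right)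
      then have "3 * (degree U + degree V) = 24" using U V n nz p0 by (simp add: degree_power_eq)
      then have degs: "degree U = 4 \<or> degree V = 4" using dUV by arith
      have eq2: "U ^ 3 - V ^ 3 = (smult j Q)\<^sup>2"
        unfolding U(1)[symmetric] V(1)[symmetric] f1_def f2_def smult_power j
        by (rule poly_eqI_infinite[OF infinite_UNIV_char_0]) simp
      have jQ0: "smult j Q \<noteq> 0" using j sb nz n by (auto simp: Q_def)
      have cUV: "poly V z \<noteq> 0" if "poly U z = 0" for z using c12[of z] that by (auto simp: U V)
      define K where "K = 4 * (1 - omega3)"
      have K: "K \<noteq> 0" "omega3 \<noteq> 0" using omega3 by (auto simp: K_def)
      obtain u v where uv: "independent_linear u v"
        "smult K U = tet_plus [:- tet:] u v" "smult K V = smult omega3 (tet_plus [:tet:] u v)"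
        unfolding K_def by (rule tetrahedral_equation[OF dUV degs cUV eq2 jQ0])
      have uv1: "degree u \<le> 1" "degree v \<le> 1" using uv(1) by (auto simp: independent_linear_def)
      have h: "tet_plus (- tet) (hom_eval 1 u x y) (hom_eval 1 v x y) = K * hom_eval 4 U x y"
        "omega3 * tet_plus tet (hom_eval 1 u x y) (hom_eval 1 v x y) = K * hom_eval 4 V x y" for x y
        using arg_cong[OF uv(2), of "\<lambda>p. hom_eval 4 p x y"] arg_cong[OF uv(3), of "\<lambda>p. hom_eval 4 p x y"]
        unfolding hom_eval_smult hom_eval_tet_plus[OF uv1] by simp_all
      have hp: "(hom_eval 4 U x y * hom_eval 4 V x y) ^ 3 = - \<alpha> * hom_eval 8 p x y ^ 3" for x y
      proof -
        have "hom_eval (3 * 4) (U ^ 3) x y = hom_eval 4 U x y ^ 3" "hom_eval (3 * 4) (V ^ 3) x y = hom_eval 4 V x y ^ 3"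
          by (rule hom_eval_power[OF dUV(1)], rule hom_eval_power[OF dUV(2)])
        moreover have "hom_eval (12 + 12) (f1 * f2) x y = hom_eval 12 f1 x y * hom_eval 12 f2 x y"
          by (rule hom_eval_mult) fact+
        then have "- \<alpha> * hom_eval (12 + 12) (p ^ 3) x y = hom_eval 12 f1 x y * hom_eval 12 f2 x y"
          unfolding prod(1) hom_eval_smult .
        moreover have "hom_eval (3 * 8) (p ^ 3) x y = hom_eval 8 p x y ^ 3" by (rule hom_eval_power) (simp add: n)
        ultimately show ?thesis by (simp add: U V power_mult_distrib)
      qed
      have hq: "hom_eval 4 U x y ^ 3 - hom_eval 4 V x y ^ 3 = 2 * \<i> * sb\<^sup>2 * (hom_eval 6 q x y)\<^sup>2" for x y
      proof -
        have "hom_eval (3 * 4) (U ^ 3) x y = hom_eval 4 U x y ^ 3" "hom_eval (3 * 4) (V ^ 3) x y = hom_eval 4 V x y ^ 3"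
          by (rule hom_eval_power[OF dUV(1)], rule hom_eval_power[OF dUV(2)])
        moreover have "hom_eval (2 * 6) (q\<^sup>2) x y = (hom_eval 6 q x y)\<^sup>2" by (rule hom_eval_power) (simp add: n)
        moreover have "hom_eval 12 (U ^ 3) x y - hom_eval 12 (V ^ 3) x y = 2 * \<i> * sb\<^sup>2 * hom_eval 12 (q\<^sup>2) x y"
          unfolding hom_eval_diff[symmetric] eq2 Q_def smult_power j smult_smult[symmetric] hom_eval_smult
          by (simp add: hom_eval_smult smult_power power_mult_distrib j)
        ultimately show ?thesis by simp
      qed
      have oF: "octa_F (hom_eval 1 u x y) (hom_eval 1 v x y) = (K\<^sup>2 / omega3) ^ 3 * - \<alpha> * hom_eval 8 p x y ^ 3" for x y
      proof -
        have "tet_plus tet (hom_eval 1 u x y) (hom_eval 1 v x y) = K / omega3 * hom_eval 4 V x y"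
          using h(2)[of x y] K by (simp add: field_simps)
        then have "octa_F (hom_eval 1 u x y) (hom_eval 1 v x y) = (K\<^sup>2 / omega3 * (hom_eval 4 U x y * hom_eval 4 V x y)) ^ 3"
          unfolding octa_via_tet(1) h(1) by (simp add: power2_eq_square mult_ac)
        then show ?thesis unfolding power_mult_distrib[of "K\<^sup>2 / omega3"] hp by simp
      qed
      have oG: "octa_G (hom_eval 1 u x y) (hom_eval 1 v x y) = (K ^ 3 * (2 * \<i> * sb\<^sup>2) / (6 * tet))\<^sup>2 * hom_eval 6 q x y ^ 4" for x y
      proof -
        define X Y where "X = hom_eval 1 u x y" and "Y = hom_eval 1 v x y"
        have t0: "tet \<noteq> 0" using tet_square by auto
        have "tet_plus tet X Y ^ 3 = (omega3 * tet_plus tet X Y) ^ 3" by (simp add: power_mult_distrib omega3)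
        then have "tet_plus tet X Y ^ 3 - tet_plus (- tet) X Y ^ 3 = - (K ^ 3 * (hom_eval 4 U x y ^ 3 - hom_eval 4 V x y ^ 3))"
          unfolding X_def Y_def h by (simp add: power_mult_distrib algebra_simps)
        then have "6 * tet * (X * Y * (X ^ 4 - Y ^ 4))\<^sup>2 = - (K ^ 3 * (2 * \<i> * sb\<^sup>2 * (hom_eval 6 q x y)\<^sup>2))"
          unfolding octa_via_tet(2) hq .
        then have "(X * Y * (X ^ 4 - Y ^ 4))\<^sup>2 = - (K ^ 3 * (2 * \<i> * sb\<^sup>2) / (6 * tet)) * (hom_eval 6 q x y)\<^sup>2"
          using t0 by (simp add: field_simps)
        then have "((X * Y * (X ^ 4 - Y ^ 4))\<^sup>2)\<^sup>2 = (K ^ 3 * (2 * \<i> * sb\<^sup>2) / (6 * tet))\<^sup>2 * ((hom_eval 6 q x y)\<^sup>2)\<^sup>2"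
          by (simp only: power_mult_distrib power2_minus)
        then show ?thesis unfolding octa_G_def X_def Y_def by (simp only: power_mult[symmetric]) simp
      qed
      have t0: "tet \<noteq> 0" using tet_square by auto
      have "lr_equiv octa_F octa_G (\<lambda>x y. hom_eval (degree p) p x y ^ e c1) (\<lambda>x y. hom_eval (degree q) q x y ^ e c2)"
        unfolding n s
      proof (rule lr_equiv_from_linear[OF uv(1)])
        show "(K\<^sup>2 / omega3) ^ 3 * - \<alpha> \<noteq> 0" "(K ^ 3 * (2 * \<i> * sb\<^sup>2) / (6 * tet))\<^sup>2 \<noteq> 0"
          using sb nz K t0 by simp_all
      qed (rule oF, rule oG)
      then show ?thesis using pencil12 s(4) by blast
    next
      assume s: "e c1 = 3" "e c2 = 5" "e c3 = 2" "d = 60"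
      have n: "degree p = 20" "degree q = 12" "degree r = 30" using dg s by auto
      obtain sa where sa: "sa ^ 3 = \<alpha>" "\<alpha> \<noteq> 0 \<Longrightarrow> sa \<noteq> 0" using complex_root_exists[of 3 \<alpha>] by (metis one_le_numeral)
      obtain sb where sb: "sb ^ 5 = \<beta>" "\<beta> \<noteq> 0 \<Longrightarrow> sb \<noteq> 0" using complex_root_exists[of 5 \<beta>] by (metis one_le_numeral)
      obtain sc where sc: "sc ^ 2 = - \<gamma>" "- \<gamma> \<noteq> 0 \<Longrightarrow> sc \<noteq> 0" using complex_root_exists[of 2 "- \<gamma>"] by (metis one_le_numeral)
      define P Q R where "P = smult sa p" and "Q = smult sb q" and "R = smult sc r"
      have eq: "P ^ 3 + Q ^ 5 = R\<^sup>2"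
        using rel unfolding P_def Q_def R_def smult_power sa sb sc s by (simp add: eq_neg_iff_add_eq_0)
      have degs: "degree P = 20" "degree Q = 12" "degree R = 30"
        using n nz sa sb sc by (auto simp: P_def Q_def R_def)
      have cop': "poly Q z \<noteq> 0" if "poly P z = 0" for z using copp[of z] that nz sa sb by (auto simp: P_def Q_def)
      have "card {z. poly q z = 0} = 12" using Br(6)[OF three(2)] n by (simp add: q_def)
      then have card: "card {z. poly Q z = 0} = 12" using sb nz by (simp add: Q_def)
      have "lr_equiv icosa_F icosa_G (\<lambda>x y. hom_eval 20 P x y ^ 3) (\<lambda>x y. hom_eval 12 Q x y ^ 5)"
        by (rule icosahedral_lr_equiv[OF degs eq cop' card])
      moreover have "lr_equiv (\<lambda>x y. hom_eval 20 P x y ^ 3) (\<lambda>x y. hom_eval 12 Q x y ^ 5)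
          (\<lambda>x y. hom_eval (degree p) p x y ^ e c1) (\<lambda>x y. hom_eval (degree q) q x y ^ e c2)"
        by (rule lr_equivI[of "(1, 0, 0, 1)" "(1 / \<alpha>, 0, 0, 1 / \<beta>)"])
           (use nz n s in \<open>simp_all add: P_def Q_def hom_eval_smult power_mult_distrib sa(1) sb(1)\<close>)
      ultimately show ?thesis using pencil12 lr_equiv_trans s(4) by blast
    qed
  qed
qed

end

theorem classification_of_forms:
  assumes "d \<ge> 1" "is_form d F" "is_form d G" "no_common_zero F G" "many_deck d F G"
  shows "lr_equiv (\<lambda>x y. x ^ d) (\<lambda>x y. y ^ d) F G \<or>
   (\<exists>n. d = 2 * n \<and> lr_equiv (\<lambda>x y. (x ^ n + y ^ n)\<^sup>2) (\<lambda>x y. (x ^ n - y ^ n)\<^sup>2) F G) \<or>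
   (d = 12 \<and> lr_equiv (\<lambda>x y. tet_plus tet x y ^ 3) (\<lambda>x y. tet_plus (- tet) x y ^ 3) F G) \<or>
   (d = 24 \<and> lr_equiv octa_F octa_G F G) \<or> (d = 60 \<and> lr_equiv icosa_F icosa_G F G)"
proof -
  obtain a b where "normalized_pair d a b" and lr: "lr_equiv F G (hom_eval d a) (hom_eval d b)"
    using exists_normalized_pair[OF assms] by blast
  then interpret normalized_pair d a b by blast
  note to_FG = lr_equiv_trans[OF _ lr_equiv_sym[OF lr]]
  show ?thesis using normalized_classification to_FG by blast
qed

section \<open>The deck transformations of the models\<close>

lemma deckI:
  assumes "mdet g \<noteq> 0" "\<And>x y. F (m1 g x y) (m2 g x y) = u * F x y" "\<And>x y. G (m1 g x y) (m2 g x y) = u * G x y"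
  shows "g \<in> deck F G"
  using assms unfolding deck_iff by blast

text \<open>The set \<open>Gs\<close> contains one transformation for each point in the orbit of infinity, and the rotations by
  k-th roots of unity fix infinity. All products are different as Moebius transformations: the image of infinity
  determines the first factor, and then the second can be cancelled out.\<close>

lemma many_deck_if_orbit_stabilizer:
  assumes Gs: "finite Gs" "Gs \<subseteq> deck F G"
    and orbit: "\<And>g g'. g \<in> Gs \<Longrightarrow> g' \<in> Gs \<Longrightarrow> m1 g 1 0 * m2 g' 1 0 = m2 g 1 0 * m1 g' 1 0 \<Longrightarrow> g = g'"
    and k: "k \<ge> 1" and stab: "\<And>z. z ^ k = 1 \<Longrightarrow> (z, 0, 0, 1) \<in> deck F G"
    and d: "card Gs * k = d"
  shows "many_deck d F G"
proof -
  define U where "U = {z::complex. z ^ k = 1}"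
  have U: "finite U" "card U = k" using card_complex_roots_unity[OF k] k card_ge_0_finite[of U]
    by (auto simp: U_def)
  define f :: "moebius \<times> complex \<Rightarrow> moebius" where "f = (\<lambda>(g, z). mmult g (z, 0, 0, 1))"
  have nz: "z \<noteq> 0" if "z \<in> U" for z using that k by (auto simp: U_def zero_power)
  have key: "g = g' \<and> z = z'" if "g \<in> Gs" "g' \<in> Gs" "z \<in> U" "z' \<in> U" "same_moebius (f (g, z)) (f (g', z'))" for g g' z z'
  proof
    have f1: "m1 (f (g, z)) x y = m1 g (z * x) y" "m2 (f (g, z)) x y = m2 g (z * x) y" for g z x y
      unfolding f_def split_conv mmult_apply by simp_all
    have same: "m1 g (z * x) y * m2 g' (z' * x) y = m2 g (z * x) y * m1 g' (z' * x) y" for x y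
      using that(5) unfolding same_moebius_iff f1 by blast
    have "z * z' * (m1 g 1 0 * m2 g' 1 0) = z * z' * (m2 g 1 0 * m1 g' 1 0)"
      using same[of 1 0] m_linear[of g z 1 0] m_linear[of g' z' 1 0] by (simp add: mult_ac)
    then have "m1 g 1 0 * m2 g' 1 0 = m2 g 1 0 * m1 g' 1 0" using nz that by simp
    then show g: "g = g'" by (rule orbit[OF that(1,2)])
    obtain a b c e where abce: "g = (a, b, c, e)" by (metis prod_cases4)
    have "mdet g \<noteq> 0" using Gs(2) that(1) by (auto simp: deck_iff)
    moreover have "mdet g * (z - z') = 0" using same[of 1 1] unfolding g[symmetric] abce by (simp add: algebra_simps)
    ultimately show "z = z'" by simp
  qed
  have refl: "same_moebius g g" for g by (simp add: same_moebius_iff mult.commute)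
  have inj: "inj_on f (Gs \<times> U)"
  proof (rule inj_onI, clarify)
    fix g z g' z' assume "g \<in> Gs" "z \<in> U" "g' \<in> Gs" "z' \<in> U" "f (g, z) = f (g', z')"
    then show "g = g' \<and> z = z'" using key[of g g' z z'] refl[of "f (g, z)"] by simp
  qed
  show ?thesis unfolding many_deck_def
  proof (intro exI[of _ "f ` (Gs \<times> U)"] conjI ballI impI)
    show "f ` (Gs \<times> U) \<subseteq> deck F G"
      using Gs(2) stab by (auto simp: f_def U_def simp del: mmult.simps intro!: deck_mmult)
    show "card (f ` (Gs \<times> U)) = d" using d U by (simp add: card_image[OF inj] card_cartesian_product)
    show "finite (f ` (Gs \<times> U))" using Gs(1) U(1) by simp
    fix g h assume "g \<in> f ` (Gs \<times> U)" "h \<in> f ` (Gs \<times> U)" "same_moebius g h"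
    then show "g = h" using key by (fastforce simp del: same_moebius.simps)
  qed
qed

lemma cyclic_no_common_zero: "d \<ge> 1 \<Longrightarrow> no_common_zero (\<lambda>x y. x ^ d) (\<lambda>x y. y ^ d)"
  by (auto simp: no_common_zero_def)

lemma cyclic_many_deck:
  assumes "d \<ge> 1"
  shows "many_deck d (\<lambda>x y. x ^ d) (\<lambda>x y. y ^ d)"
proof (rule many_deck_if_orbit_stabilizer[where Gs = "{(1, 0, 0, 1)}" and k = d])
  show "{(1, 0, 0, 1)} \<subseteq> deck (\<lambda>x y. x ^ d) (\<lambda>x y. y ^ d)"
    by (auto intro: deckI[where u = 1])
  show "(z, 0, 0, 1) \<in> deck (\<lambda>x y. x ^ d) (\<lambda>x y. y ^ d)" if "z ^ d = 1" for z
    using that assms by (intro deckI[where u = 1]) (auto simp: power_mult_distrib zero_power)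
qed (use assms in auto)

lemma dihedral_no_common_zero: "n \<ge> 1 \<Longrightarrow> no_common_zero (\<lambda>x y. (x ^ n + y ^ n)\<^sup>2) (\<lambda>x y. (x ^ n - y ^ n)\<^sup>2)"
  by (auto simp: no_common_zero_def zero_power)

lemma dihedral_many_deck:
  assumes "n \<ge> 1"
  shows "many_deck (2 * n) (\<lambda>x y. (x ^ n + y ^ n)\<^sup>2) (\<lambda>x y. (x ^ n - y ^ n)\<^sup>2)" (is "many_deck _ ?F ?G")
proof (rule many_deck_if_orbit_stabilizer[where Gs = "{(1, 0, 0, 1), (0, 1, 1, 0)}" and k = n])
  show "{(1, 0, 0, 1), (0, 1, 1, 0)} \<subseteq> deck ?F ?G"
    by (auto intro: deckI[where u = 1] simp: power2_commute add.commute)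
  show "(z, 0, 0, 1) \<in> deck ?F ?G" if "z ^ n = 1" for z
    using that assms by (intro deckI[where u = 1]) (auto simp: power_mult_distrib zero_power)
qed (use assms in auto)

lemma tetrahedral_no_common_zero: "no_common_zero (\<lambda>x y. tet_plus tet x y ^ 3) (\<lambda>x y. tet_plus (- tet) x y ^ 3)"
  unfolding no_common_zero_def
proof (intro allI impI)
  fix x y :: complex assume "tet_plus tet x y ^ 3 = 0 \<and> tet_plus (- tet) x y ^ 3 = 0"
  then have z: "x ^ 4 + tet * x\<^sup>2 * y\<^sup>2 + y ^ 4 = 0" "x ^ 4 - tet * x\<^sup>2 * y\<^sup>2 + y ^ 4 = 0"
    by (simp_all add: tet_plus_def)
  then have "2 * (tet * x\<^sup>2 * y\<^sup>2) = 0" by algebra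
  then have "x = 0 \<or> y = 0" using tet_square by auto
  then show "x = 0 \<and> y = 0" using z by auto
qed

text \<open>A rotation of order three about the center of a face of the octahedron. Both tetrahedral forms are
  multiplied by numbers with the same cube.\<close>

lemma tet_plus_rotate:
  assumes "k * k = - 12"
  shows "tet_plus k (x + \<i> * y) (x - \<i> * y) = (2 + k) * tet_plus k x y" "(2 + k) ^ 3 = - 64"
proof -
  have "\<i> * \<i> = - 1" by simp
  then show "tet_plus k (x + \<i> * y) (x - \<i> * y) = (2 + k) * tet_plus k x y"
    unfolding tet_plus_def using assms by algebra
  show "(2 + k) ^ 3 = - 64" using assms by algebra
qed

lemma tetrahedral_many_deck: "many_deck 12 (\<lambda>x y. tet_plus tet x y ^ 3) (\<lambda>x y. tet_plus (- tet) x y ^ 3)"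
  (is "many_deck 12 ?F ?G")
proof (rule many_deck_if_orbit_stabilizer)
  \<comment> \<open>The images of infinity are the six vertices of the octahedron, and \<open>c\<close> has order three as a Moebius
    transformation.\<close>
  define c :: moebius where "c = (1, \<i>, 1, - \<i>)"
  have cc: "mmult c c = (1 + \<i>, 1 + \<i>, 1 - \<i>, \<i> - 1)" by (simp add: c_def)
  define Gs :: "moebius set" where "Gs = {(1, 0, 0, 1), (0, 1, 1, 0), (1, \<i>, 1, - \<i>), (- 1, - \<i>, 1, - \<i>),
    (1 + \<i>, 1 + \<i>, 1 - \<i>, \<i> - 1), (- (1 + \<i>), - (1 + \<i>), 1 - \<i>, \<i> - 1)}"
  show "finite Gs" by (simp add: Gs_def)
  have s: "(- 1, 0, 0, 1) \<in> deck ?F ?G" and t: "(0, 1, 1, 0) \<in> deck ?F ?G" and id: "(1, 0, 0, 1) \<in> deck ?F ?G"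
    by (rule deckI[where u = 1]; simp add: tet_plus_def algebra_simps)+
  have t2: "tet * tet = - 12" "- tet * - tet = - 12" using tet_square by simp_all
  have c: "c \<in> deck ?F ?G"
    by (rule deckI[where u = "- 64"])
      (simp_all add: c_def power_mult_distrib tet_plus_rotate[OF t2(1)] tet_plus_rotate[OF t2(2), unfolded add_uminus_conv_diff])
  note cc' = deck_mmult[OF c c, unfolded cc]
  show "Gs \<subseteq> deck ?F ?G"
    using id t c cc' deck_mmult[OF s c] deck_mmult[OF s cc'] by (simp add: Gs_def c_def)
  show "g = g'" if "g \<in> Gs" "g' \<in> Gs" "m1 g 1 0 * m2 g' 1 0 = m2 g 1 0 * m1 g' 1 0" for g g'
    using that unfolding Gs_def by (auto simp: complex_eq_iff)
  show "(1::nat) \<le> 2" by simp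
  show "(z, 0, 0, 1) \<in> deck ?F ?G" if "z ^ 2 = 1" for z using that id s by (auto simp: power2_eq_1_iff)
  show "card Gs * 2 = 12" unfolding Gs_def by (simp add: complex_eq_iff)
qed

lemma octahedral_no_common_zero: "no_common_zero octa_F octa_G"
  unfolding no_common_zero_def octa_F_def octa_G_def
proof (intro allI impI)
  fix x y :: complex
  assume "(x ^ 8 + 14 * x ^ 4 * y ^ 4 + y ^ 8) ^ 3 = 0 \<and> (x * y * (x ^ 4 - y ^ 4)) ^ 4 = 0"
  then have F: "x ^ 8 + 14 * x ^ 4 * y ^ 4 + y ^ 8 = 0" and G: "x = 0 \<or> y = 0 \<or> x ^ 4 = y ^ 4" by auto
  have "16 * (y ^ 4) ^ 2 = 0" if "x ^ 4 = y ^ 4" using F that by algebra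
  then have "x ^ 4 = y ^ 4 \<Longrightarrow> y = 0" by simp
  then show "x = 0 \<and> y = 0" using F G by auto
qed

lemma octahedral_many_deck: "many_deck 24 octa_F octa_G"
proof (rule many_deck_if_orbit_stabilizer)
  define U :: "complex set" where "U = {z. z ^ 4 = 1}"
  have U: "card U = 4" "finite U" using card_complex_roots_unity[of 4] card_ge_0_finite[of U] by (auto simp: U_def)
  define Gs :: "moebius set" where "Gs = {(1, 0, 0, 1), (0, 1, 1, 0)} \<union> (\<lambda>z. (z, - z, 1, 1)) ` U"
  show "finite Gs" using U by (simp add: Gs_def)
  have rotate: "(z, - z, 1, 1) \<in> deck octa_F octa_G" if "z \<in> U" for z
  proof (rule deckI[where u = 4096])
    have z: "z ^ 4 = 1" using that by (simp add: U_def)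
    then show "mdet (z, - z, 1, 1) \<noteq> 0" by auto
    have e: "z * x - z * y = z * (x - y)" for x y by algebra
    have z8: "z ^ 8 = 1" using z by algebra
    have "(x - y) ^ 8 + 14 * (x - y) ^ 4 * (x + y) ^ 4 + (x + y) ^ 8 = 16 * (x ^ 8 + 14 * x ^ 4 * y ^ 4 + y ^ 8)"
      "(x - y) * (x + y) * ((x - y) ^ 4 - (x + y) ^ 4) = - 8 * (x * y * (x ^ 4 - y ^ 4))" for x y :: complex by algebra+
    note h = this
    have scale: "(16 * t) ^ 3 = 4096 * t ^ 3" "(- 8 * t) ^ 4 = 4096 * t ^ 4" for t :: complex by algebra+
    show "octa_F (m1 (z, - z, 1, 1) x y) (m2 (z, - z, 1, 1) x y) = 4096 * octa_F x y" for x y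
    proof -
      have "octa_F (m1 (z, - z, 1, 1) x y) (m2 (z, - z, 1, 1) x y) =
          ((x - y) ^ 8 + 14 * (x - y) ^ 4 * (x + y) ^ 4 + (x + y) ^ 8) ^ 3"
        by (simp add: octa_F_def e power_mult_distrib[of z] z z8)
      then show ?thesis unfolding h(1) scale octa_F_def .
    qed
    show "octa_G (m1 (z, - z, 1, 1) x y) (m2 (z, - z, 1, 1) x y) = 4096 * octa_G x y" for x y
    proof -
      have "z * (x - y) * (x + y) * ((z * (x - y)) ^ 4 - (x + y) ^ 4) = z * ((x - y) * (x + y) * ((x - y) ^ 4 - (x + y) ^ 4))"
        by (simp add: power_mult_distrib z)
      then have "octa_G (m1 (z, - z, 1, 1) x y) (m2 (z, - z, 1, 1) x y) =
          (z * ((x - y) * (x + y) * ((x - y) ^ 4 - (x + y) ^ 4))) ^ 4"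
        by (simp only: octa_G_def m1.simps m2.simps mult_1 mult_minus_left add_uminus_conv_diff e)
      also have "\<dots> = ((x - y) * (x + y) * ((x - y) ^ 4 - (x + y) ^ 4)) ^ 4"
        unfolding power_mult_distrib[of z] z by simp
      finally show ?thesis unfolding h(2) scale octa_G_def .
    qed
  qed
  have "(0, 1, 1, 0) \<in> deck octa_F octa_G" "(1, 0, 0, 1) \<in> deck octa_F octa_G"
    by (rule deckI[where u = 1]; simp add: octa_F_def octa_G_def power_mult_distrib power4_eq_xxxx algebra_simps)+
  then show "Gs \<subseteq> deck octa_F octa_G" using rotate by (auto simp: Gs_def)
  show "g = g'" if "g \<in> Gs" "g' \<in> Gs" "m1 g 1 0 * m2 g' 1 0 = m2 g 1 0 * m1 g' 1 0" for g g'
    using that unfolding Gs_def by (auto simp: U_def)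
  show "(1::nat) \<le> 4" by simp
  show "(z, 0, 0, 1) \<in> deck octa_F octa_G" if "z ^ 4 = 1" for z
  proof (rule deckI[where u = 1])
    have "z ^ 8 = 1" using that by algebra
    then show "octa_F (m1 (z, 0, 0, 1) x y) (m2 (z, 0, 0, 1) x y) = 1 * octa_F x y"
      "octa_G (m1 (z, 0, 0, 1) x y) (m2 (z, 0, 0, 1) x y) = 1 * octa_G x y" for x y
      using that by (simp_all add: octa_F_def octa_G_def power_mult_distrib)
  qed (use that in auto)
  have "card ((\<lambda>z::complex. (z, - z, 1::complex, 1::complex)) ` U) = 4"
    by (subst card_image) (auto simp: inj_on_def U)
  moreover have "{(1, 0, 0, 1), (0, 1, 1, 0)} \<inter> (\<lambda>z::complex. (z, - z, 1::complex, 1::complex)) ` U = {}" by auto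
  ultimately have "card Gs = 6" unfolding Gs_def using U by (subst card_Un_disjoint) auto
  then show "card Gs * 4 = 24" by simp
qed

lemma icosahedral_no_common_zero: "no_common_zero icosa_F icosa_G"
  unfolding no_common_zero_def icosa_F_def icosa_G_def
proof (intro allI impI)
  fix x y :: complex
  assume "(x ^ 20 - 228 * x ^ 15 * y ^ 5 + 494 * x ^ 10 * y ^ 10 + 228 * x ^ 5 * y ^ 15 + y ^ 20) ^ 3 = 0 \<and>
    (x * y * (x ^ 10 + 11 * x ^ 5 * y ^ 5 - y ^ 10)) ^ 5 = 0"
  then have F: "x ^ 20 - 228 * x ^ 15 * y ^ 5 + 494 * x ^ 10 * y ^ 10 + 228 * x ^ 5 * y ^ 15 + y ^ 20 = 0"
    and G: "x = 0 \<or> y = 0 \<or> x ^ 10 + 11 * x ^ 5 * y ^ 5 - y ^ 10 = 0" by auto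
  define u v where "u = x ^ 5" and "v = y ^ 5"
  have pw: "x ^ 10 = u ^ 2" "x ^ 15 = u ^ 3" "x ^ 20 = u ^ 4" "y ^ 10 = v ^ 2" "y ^ 15 = v ^ 3" "y ^ 20 = v ^ 4"
    by (simp_all add: u_def v_def flip: power_mult)
  have F': "u ^ 4 - 228 * u ^ 3 * v + 494 * u ^ 2 * v ^ 2 + 228 * u * v ^ 3 + v ^ 4 = 0"
    using F unfolding pw by (simp add: u_def v_def)
  have "x = 0 \<or> y = 0"
  proof (rule ccontr)
    assume n: "\<not> (x = 0 \<or> y = 0)"
    then have G': "u ^ 2 + 11 * u * v - v ^ 2 = 0" using G unfolding pw by (simp add: u_def v_def)
    have "3125 * (v ^ 3 * (v - 11 * u)) = 0" using F' G' by algebra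
    then have "v = 11 * u" using n by (simp add: v_def)
    then have "u ^ 2 = 0" using G' by algebra
    then show False using n by (simp add: u_def)
  qed
  then show "x = 0 \<and> y = 0" using F by auto
qed

text \<open>The orbit of infinity consists of the twelve vertices, and the stabilizer of infinity of five rotations.\<close>

lemma icosahedral_many_deck: "many_deck 60 icosa_F icosa_G"
proof -
  define V where "V = {z. poly icosa z = 0}"
  have V: "card V = 11" "finite V" using card_icosa_roots card_ge_0_finite[of V] by (auto simp: V_def)
  have ex: "\<forall>z\<in>V. \<exists>g. g \<in> deck icosa_F icosa_G \<and> m1 g 1 0 = z * m2 g 1 0 \<and> m2 g 1 0 \<noteq> 0"
    using icosa_vertex_symmetry unfolding V_def by blast
  obtain r where "\<forall>z\<in>V. r z \<in> deck icosa_F icosa_G \<and> m1 (r z) 1 0 = z * m2 (r z) 1 0 \<and> m2 (r z) 1 0 \<noteq> 0"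
    using bchoice[OF ex] by blast
  then have r: "r z \<in> deck icosa_F icosa_G" "m1 (r z) 1 0 = z * m2 (r z) 1 0" "m2 (r z) 1 0 \<noteq> 0"
    if "z \<in> V" for z using that by auto
  define Gs :: "moebius set" where "Gs = insert (1, 0, 0, 1) (r ` V)"
  show ?thesis
  proof (rule many_deck_if_orbit_stabilizer[where Gs = Gs and k = 5])
    show "finite Gs" using V by (simp add: Gs_def)
    have stab: "(z, 0, 0, 1) \<in> deck icosa_F icosa_G" if "z ^ 5 = 1" for z
    proof (rule deckI[where u = 1])
      have "(z ^ 5) ^ 2 = 1" "(z ^ 5) ^ 3 = 1" "(z ^ 5) ^ 4 = 1" unfolding that by simp_all
      then have "z ^ 10 = 1" "z ^ 15 = 1" "z ^ 20 = 1" by (simp_all flip: power_mult)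
      then show "icosa_F (m1 (z, 0, 0, 1) x y) (m2 (z, 0, 0, 1) x y) = 1 * icosa_F x y"
        "icosa_G (m1 (z, 0, 0, 1) x y) (m2 (z, 0, 0, 1) x y) = 1 * icosa_G x y" for x y
        using that by (simp_all add: icosa_F_def icosa_G_def power_mult_distrib)
    qed (use that in auto)
    then show "(z, 0, 0, 1) \<in> deck icosa_F icosa_G" if "z ^ 5 = 1" for z using that .
    show "Gs \<subseteq> deck icosa_F icosa_G" using r stab[of 1] by (auto simp: Gs_def)
    have inf: "m1 (1, 0, 0, 1) 1 0 = 1" "m2 (1, 0, 0, 1) 1 0 = 0" by simp_all
    have neq: "r z \<noteq> (1, 0, 0, 1)" if "z \<in> V" for z using r(3)[OF that] by auto
    have inj: "z = z'" if "z \<in> V" "z' \<in> V" "m1 (r z) 1 0 * m2 (r z') 1 0 = m2 (r z) 1 0 * m1 (r z') 1 0" for z z'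
      using r(2,3)[OF that(1)] r(2,3)[OF that(2)] that(3) by simp
    show "g = g'" if "g \<in> Gs" "g' \<in> Gs" "m1 g 1 0 * m2 g' 1 0 = m2 g 1 0 * m1 g' 1 0" for g g'
    proof -
      have "g = (1, 0, 0, 1) \<or> (\<exists>z\<in>V. g = r z)" "g' = (1, 0, 0, 1) \<or> (\<exists>z\<in>V. g' = r z)"
        using that by (auto simp: Gs_def)
      then show ?thesis using that(3) inj r(3) by (elim disjE bexE) (auto simp: inf)
    qed
    show "(1::nat) \<le> 5" by simp
    have "inj_on r V" by (rule inj_onI) (rule inj, auto)
    then have "card (r ` V) = 11" by (simp add: card_image V)
    moreover have "(1, 0, 0, 1) \<notin> r ` V" using neq by (metis imageE)
    ultimately have "card Gs = 12" unfolding Gs_def using V(2) by simp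
    then show "card Gs * 5 = 60" by simp
  qed
qed

section \<open>The Galois homogeneous foliations\<close>

lemma homogeneous2_monomials:
  "homogeneous2 n (varx ^ n)" "homogeneous2 n (vary ^ n)"
  "i + j = n \<Longrightarrow> homogeneous2 n (numeral k * varx ^ i * vary ^ j)"
  "i + j = n \<Longrightarrow> homogeneous2 n (const2 c * varx ^ i * vary ^ j)"
  by (auto simp: homogeneous2_iff power_mult_distrib power_add)

lemma homogeneous2_add: "homogeneous2 n A \<Longrightarrow> homogeneous2 n B \<Longrightarrow> homogeneous2 n (A + B)"
  by (simp add: homogeneous2_iff algebra_simps)

lemma homogeneous2_diff: "homogeneous2 n A \<Longrightarrow> homogeneous2 n B \<Longrightarrow> homogeneous2 n (A - B)"
  by (simp add: homogeneous2_iff algebra_simps)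

lemma homogeneous2_mult: "homogeneous2 m A \<Longrightarrow> homogeneous2 n B \<Longrightarrow> homogeneous2 (m + n) (A * B)"
  by (simp add: homogeneous2_iff power_add)

lemma homogeneous2_power: "homogeneous2 m A \<Longrightarrow> homogeneous2 (m * n) (A ^ n)"
  by (simp add: homogeneous2_iff power_mult_distrib power_mult)

lemmas homogeneous2_intros = homogeneous2_add homogeneous2_diff homogeneous2_monomials

lemma orbit_iff_model:
  assumes "homogeneous2 d A0" "homogeneous2 d B0" "\<And>x y. ev2 A0 x y = F x y" "\<And>x y. ev2 B0 x y = G x y"
  shows "(A, B) \<in> left_right_orbit (A0, B0) \<longleftrightarrow> lr_equiv F G (ev2 A) (ev2 B)"
proof -
  have "ev2 A0 = F" "ev2 B0 = G" using assms by (auto intro!: ext)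
  then show ?thesis using orbit_iff_lr_equiv[OF assms(1,2)] by simp
qed

lemma forms_equivalent_to_model:
  assumes "homogeneous2 d A0" "homogeneous2 d B0" "\<And>x y. ev2 A0 x y = F x y" "\<And>x y. ev2 B0 x y = G x y"
    and "no_common_zero F G" "many_deck d F G" "lr_equiv F G (ev2 A) (ev2 B)"
  shows "homogeneous2 d A \<and> homogeneous2 d B \<and> no_common_zero (ev2 A) (ev2 B) \<and> many_deck d (ev2 A) (ev2 B)"
proof -
  have "ev2 A0 = F" "ev2 B0 = G" using assms by (auto intro!: ext)
  then show ?thesis
    using homogeneous_if_lr_equiv[OF assms(1,2), of A B] lr_equiv_no_common_zero[OF assms(7,5)]
      lr_equiv_many_deck[OF assms(7,6)] assms(7) by simp
qed

theorem theorem7: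
  fixes d :: nat and A B :: cpoly2
  assumes "d \<ge> 1"
  shows "homogeneous_foliation d (A, B) \<and> galois_foliation (projective_form (A, B)) \<longleftrightarrow>
    vary * A \<noteq> varx * B \<and>
    ((A, B) \<in> left_right_orbit (varx ^ d, vary ^ d) \<or>
     (\<exists>n. d = 2 * n \<and>
        (A, B) \<in> left_right_orbit ((varx ^ n + vary ^ n) ^ 2, (varx ^ n - vary ^ n) ^ 2)) \<or>
     (d = 12 \<and>
        (A, B) \<in> left_right_orbit
          ((varx ^ 4 + const2 (2 * \<i> * complex_of_real (sqrt 3)) * varx ^ 2 * vary ^ 2 + vary ^ 4) ^ 3,
           (varx ^ 4 - const2 (2 * \<i> * complex_of_real (sqrt 3)) * varx ^ 2 * vary ^ 2 + vary ^ 4) ^ 3)) \<or>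
     (d = 24 \<and>
        (A, B) \<in> left_right_orbit
          ((varx ^ 8 + 14 * varx ^ 4 * vary ^ 4 + vary ^ 8) ^ 3,
           (varx * vary * (varx ^ 4 - vary ^ 4)) ^ 4)) \<or>
     (d = 60 \<and>
        (A, B) \<in> left_right_orbit
          ((varx ^ 20 - 228 * varx ^ 15 * vary ^ 5 + 494 * varx ^ 10 * vary ^ 10
              + 228 * varx ^ 5 * vary ^ 15 + vary ^ 20) ^ 3,
           (varx * vary * (varx ^ 10 + 11 * varx ^ 5 * vary ^ 5 - vary ^ 10)) ^ 5)))"
    (is "_ \<longleftrightarrow> _ \<and> (_ \<in> left_right_orbit (?A1, ?B1) \<or>
      (\<exists>n. _ \<and> _ \<in> left_right_orbit (?A2 n, ?B2 n)) \<or> (_ \<and> _ \<in> left_right_orbit (?A3, ?B3)) \<or>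
      (_ \<and> _ \<in> left_right_orbit (?A4, ?B4)) \<or> (_ \<and> _ \<in> left_right_orbit (?A5, ?B5)))")
proof -
  let ?F2 = "\<lambda>n x y. (x ^ n + y ^ n)\<^sup>2 :: complex" and ?G2 = "\<lambda>n x y. (x ^ n - y ^ n)\<^sup>2 :: complex"
  let ?F3 = "\<lambda>x y. tet_plus tet x y ^ 3" and ?G3 = "\<lambda>x y. tet_plus (- tet) x y ^ 3"
  let ?good = "\<lambda>A B. homogeneous2 d A \<and> homogeneous2 d B \<and> no_common_zero (ev2 A) (ev2 B) \<and> many_deck d (ev2 A) (ev2 B)"
  have h1: "homogeneous2 d ?A1" "homogeneous2 d ?B1" by (rule homogeneous2_monomials)+
  have e1: "ev2 ?A1 x y = x ^ d" "ev2 ?B1 x y = y ^ d" for x y by simp_all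
  have h2: "homogeneous2 (2 * n) (?A2 n)" "homogeneous2 (2 * n) (?B2 n)" for n
    unfolding mult.commute[of 2 n] by (intro homogeneous2_power homogeneous2_intros)+
  have e2: "ev2 (?A2 n) x y = ?F2 n x y" "ev2 (?B2 n) x y = ?G2 n x y" for n x y by simp_all
  have "homogeneous2 (4 * 3) ?A3" "homogeneous2 (4 * 3) ?B3"
    by (intro homogeneous2_power homogeneous2_intros; simp)+
  then have h3: "homogeneous2 12 ?A3" "homogeneous2 12 ?B3" by simp_all
  have e3: "ev2 ?A3 x y = ?F3 x y" "ev2 ?B3 x y = ?G3 x y" for x y by (simp_all add: tet_plus_def tet_def)
  have lin: "homogeneous2 1 varx" "homogeneous2 1 vary" by (simp_all add: homogeneous2_iff)
  have "homogeneous2 (8 * 3) ?A4" by (intro homogeneous2_power homogeneous2_intros; simp)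
  moreover have "homogeneous2 ((1 + 1 + 4) * 4) ?B4"
    by (intro homogeneous2_power homogeneous2_mult homogeneous2_intros lin)
  ultimately have h4: "homogeneous2 24 ?A4" "homogeneous2 24 ?B4" by simp_all
  have e4: "ev2 ?A4 x y = octa_F x y" "ev2 ?B4 x y = octa_G x y" for x y by (simp_all add: octa_F_def octa_G_def)
  have "homogeneous2 (20 * 3) ?A5" by (intro homogeneous2_power homogeneous2_intros; simp)
  moreover have "homogeneous2 ((1 + 1 + 10) * 5) ?B5"
    by (intro homogeneous2_power homogeneous2_mult homogeneous2_intros lin; simp)
  ultimately have h5: "homogeneous2 60 ?A5" "homogeneous2 60 ?B5" by simp_all
  have e5: "ev2 ?A5 x y = icosa_F x y" "ev2 ?B5 x y = icosa_G x y" for x y by (simp_all add: icosa_F_def icosa_G_def)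
  note orbits = orbit_iff_model[OF h1 e1] orbit_iff_model[OF h2 e2] orbit_iff_model[OF h3 e3]
    orbit_iff_model[OF h4 e4] orbit_iff_model[OF h5 e5]
  let ?models = "lr_equiv (\<lambda>x y. x ^ d) (\<lambda>x y. y ^ d) (ev2 A) (ev2 B) \<or>
    (\<exists>n. d = 2 * n \<and> lr_equiv (?F2 n) (?G2 n) (ev2 A) (ev2 B)) \<or> (d = 12 \<and> lr_equiv ?F3 ?G3 (ev2 A) (ev2 B)) \<or>
    (d = 24 \<and> lr_equiv octa_F octa_G (ev2 A) (ev2 B)) \<or> (d = 60 \<and> lr_equiv icosa_F icosa_G (ev2 A) (ev2 B))"
  have "?good A B \<longleftrightarrow> ?models"
  proof
    assume "?good A B"
    then show ?models using classification_of_forms[OF assms is_form_ev2 is_form_ev2] by blast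
  next
    assume ?models
    then consider (1) "lr_equiv (\<lambda>x y. x ^ d) (\<lambda>x y. y ^ d) (ev2 A) (ev2 B)"
      | (2) n where "d = 2 * n" "lr_equiv (?F2 n) (?G2 n) (ev2 A) (ev2 B)"
      | (3) "d = 12" "lr_equiv ?F3 ?G3 (ev2 A) (ev2 B)"
      | (4) "d = 24" "lr_equiv octa_F octa_G (ev2 A) (ev2 B)"
      | (5) "d = 60" "lr_equiv icosa_F icosa_G (ev2 A) (ev2 B)" by blast
    then show "?good A B"
    proof cases
      case 1
      then show ?thesis
        by (rule forms_equivalent_to_model[OF h1 e1 cyclic_no_common_zero[OF assms] cyclic_many_deck[OF assms]])
    next
      case (2 n)
      \<comment> \<open>The case n = 0 is excluded by \<open>d \<ge> 1\<close>.\<close>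
      then have n: "n \<ge> 1" using assms by simp
      show ?thesis unfolding 2(1)
        by (rule forms_equivalent_to_model[OF h2 e2 dihedral_no_common_zero[OF n] dihedral_many_deck[OF n] 2(2)])
    next
      case 3
      show ?thesis unfolding 3(1)
        by (rule forms_equivalent_to_model[OF h3 e3 tetrahedral_no_common_zero tetrahedral_many_deck 3(2)])
    next
      case 4
      show ?thesis unfolding 4(1)
        by (rule forms_equivalent_to_model[OF h4 e4 octahedral_no_common_zero octahedral_many_deck 4(2)])
    next
      case 5
      show ?thesis unfolding 5(1)
        by (rule forms_equivalent_to_model[OF h5 e5 icosahedral_no_common_zero icosahedral_many_deck 5(2)])
    qed
  qed
  then show ?thesis unfolding orbits foliation_galois_iff[OF assms] by blast
qed

end
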